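(* For each $n$, let $\boldsymbol{d}=(d_i)_{i\in[n]}$ be a degree sequence with $d_i\geq1$ for all $i$ and $\ell_n=\sum_{i\in[n]}d_i$ even, and consider the configuration model $\mathrm{CM}_n(\boldsymbol{d})$. Let $D_n=d_{o}$, where $o$ is uniform on $[n]$. Suppose that there is a random variable $D$ with $\mathbb{P}(D\geq1)=1$ such that, as $n\to\infty$, $D_n\to D$ in distribution, $\mathbb{E}[D_n]\to\mathbb{E}[D]<\infty$, and $\mathbb{E}[D_n^2]\to\mathbb{E}[D^2]<\infty$, and suppose that $\nu=\mathbb{E}[D(D-1)]/\mathbb{E}[D]\in(1,\infty)$. Let $o_1,o_2$ be two vertices chosen independently and uniformly at random from $[n]$. Then, conditionally on $\mathrm{dist}_{\mathrm{CM}_n(\boldsymbol{d})}(o_1,o_2)<\infty$, $$\frac{\mathrm{dist}_{\mathrm{CM}_n(\boldsymbol{d})}(o_1,o_2)}{\log n}\to\frac{1}{\log\nu}\quad\text{in probability},$$ i.e., for every $\varepsilon>0$, $\mathbb{P}\big(\big|\mathrm{dist}_{\mathrm{CM}_n(\boldsymbol{d})}(o_1,o_2)/\log n-1/\log\nu\big|>\varepsilon\ \big|\ \mathrm{dist}_{\mathrm{CM}_n(\boldsymbol{d})}(o_1,o_2)<\infty\big)\to0$ as $n\to\infty$.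
   Context: Configuration model $\mathrm{CM}_n(\boldsymbol{d})$: attach $d_j$ half-edges to each vertex $j\in[n]=\{1,\dots,n\}$ and pair all $\ell_n$ half-edges uniformly at random (i.e. according to a uniform perfect matching of the half-edges); each pair of half-edges forms an edge. The result is a random multigraph (self-loops and multiple edges allowed) in which vertex $j$ has degree $d_j$ (a self-loop contributes 2 to the degree). $\mathrm{dist}_{\mathrm{CM}_n(\boldsymbol{d})}(u,v)$ is the graph distance between $u$ and $v$ in $\mathrm{CM}_n(\boldsymbol{d})$, equal to $\infty$ if $u$ and $v$ are not connected. The vertices $o_1,o_2$ are independent of the random graph. *)

theory Defs
  imports "HOL-Probability.Probability" "Graph_Theory.Shortest_Path"
begin

text \<open>The half-edge \<open>(j, k)\<close> is the \<open>k\<close>-th half-edge attached to vertex \<open>j\<close>.\<close>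

type_synonym half_edge = "nat \<times> nat"

definition half_edges :: "nat \<Rightarrow> (nat \<Rightarrow> nat) \<Rightarrow> half_edge set" where
  "half_edges n d = (SIGMA j:{1..n}. {..<d j})"

definition perfect_matchings :: "'a set \<Rightarrow> 'a set set set" where
  "perfect_matchings H = {P. partition_on H P \<and> (\<forall>e\<in>P. card e = 2)}"

text \<open>
  An undirected multigraph is represented in \<open>Graph_Theory\<close> by its bidirected version: each edge
  \<open>{h, h'}\<close> of the pairing contributes the two opposite arcs \<open>(h, h')\<close> and \<open>(h', h)\<close>, so parallel
  edges remain distinct, a self-loop contributes 2 to the degree, and undirected walks are exactly
  the directed ones.
\<close>

definition pairing_graph :: "nat \<Rightarrow> half_edge set set \<Rightarrow> (nat, half_edge \<times> half_edge) pre_digraph"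
  where
  "pairing_graph n P =
     \<lparr>verts = {1..n}, arcs = {(h, h'). {h, h'} \<in> P}, tail = (\<lambda>a. fst (fst a)), head = (\<lambda>a. fst (snd a))\<rparr>"

definition configuration_model ::
  "nat \<Rightarrow> (nat \<Rightarrow> nat) \<Rightarrow> (nat, half_edge \<times> half_edge) pre_digraph pmf" where
  "configuration_model n d =
     map_pmf (pairing_graph n) (pmf_of_set (perfect_matchings (half_edges n d)))"

text \<open>
  The infimum over all walks of the number of arcs; it is \<open>\<infinity>\<close> if there is no walk.
\<close>

definition graph_dist :: "('a, 'b) pre_digraph \<Rightarrow> 'a \<Rightarrow> 'a \<Rightarrow> ereal" where
  "graph_dist G u v = wf_digraph.\<mu> G (\<lambda>_. 1) u v"

definition uniform_vertex :: "nat \<Rightarrow> nat pmf" where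
  "uniform_vertex n = pmf_of_set {1..n}"

text \<open>
  \<open>pmf_of_set\<close> is only meaningful on finite nonempty sets and \<open>wf_digraph.\<mu>\<close> on well-formed
  graphs; the following facts show that both are used as intended.
\<close>

lemma finite_perfect_matchings: "finite H \<Longrightarrow> finite (perfect_matchings H)"
  by (rule finite_subset[of _ "Pow (Pow H)"]) (auto simp: perfect_matchings_def partition_on_def)

lemma perfect_matchings_nonempty:
  assumes "finite H" "even (card H)"
  shows "perfect_matchings H \<noteq> {}"
  using assms
proof (induction "card H" arbitrary: H rule: less_induct)
  case less
  show ?case
  proof (cases "H = {}")
    case True
    then have "{} \<in> perfect_matchings H"
      by (simp add: perfect_matchings_def partition_on_def)
    then show ?thesis by blast
  next
    case False
    then obtain a where a: "a \<in> H" by blast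
    have "card H \<noteq> 1" using less.prems by auto
    then have "H \<noteq> {a}" by auto
    then obtain b where b: "b \<in> H" "b \<noteq> a" using a by blast
    have card: "card (H - {a, b}) = card H - 2" "card H \<ge> 2"
      using a b less.prems card_mono[of H "{a, b}"] by (auto simp: card_Diff_subset)
    then obtain P where P: "P \<in> perfect_matchings (H - {a, b})"
      using less.hyps[of "H - {a, b}"] less.prems by fastforce
    have "partition_on H (insert {a, b} P)"
      using P a b by (intro partition_onI)
        (auto simp: perfect_matchings_def partition_on_def disjoint_def disjnt_def)
    then have "insert {a, b} P \<in> perfect_matchings H"
      using P b by (auto simp: perfect_matchings_def)
    then show ?thesis by blast
  qed
qed

lemma finite_half_edges: "finite (half_edges n d)"
  by (simp add: half_edges_def)

lemma card_half_edges: "card (half_edges n d) = (\<Sum>j=1..n. d j)"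
  by (simp add: half_edges_def)

lemma wf_pairing_graph:
  assumes "P \<in> perfect_matchings (half_edges n d)"
  shows "wf_digraph (pairing_graph n P)"
proof -
  have "h \<in> half_edges n d \<and> h' \<in> half_edges n d" if "{h, h'} \<in> P" for h h'
    using assms that by (auto simp: perfect_matchings_def partition_on_def)
  then show ?thesis
    by unfold_locales (fastforce simp: pairing_graph_def half_edges_def)+
qed

lemma out_degree_pairing_graph:
  assumes P: "P \<in> perfect_matchings (half_edges n d)" and j: "j \<in> {1..n}"
  shows "out_degree (pairing_graph n P) j = d j"
proof -
  let ?A = "out_arcs (pairing_graph n P) j"
  have part: "\<Union>P = half_edges n d" "disjoint P" and two: "\<And>e. e \<in> P \<Longrightarrow> card e = 2"
    using P by (auto simp: perfect_matchings_def partition_on_def)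
  have A: "?A = {(h, h'). {h, h'} \<in> P \<and> fst h = j}"
    by (auto simp: out_arcs_def pairing_graph_def)
  have "inj_on fst ?A"
  proof (rule inj_onI, clarsimp simp: A)
    fix k a b a' b'
    assume *: "{(j, k), (a, b)} \<in> P" "{(j, k), (a', b')} \<in> P"
    then have "{(j, k), (a, b)} = {(j, k), (a', b')}"
      using part(2) by (fastforce simp: disjoint_def)
    then show "a = a' \<and> b = b'" by (auto simp: doubleton_eq_iff)
  qed
  moreover have "fst ` ?A = {j} \<times> {..<d j}"
  proof (intro equalityI subsetI)
    fix h assume "h \<in> fst ` ?A"
    then obtain h' where "{h, h'} \<in> P" "fst h = j" by (auto simp: A)
    then have "h \<in> half_edges n d" using part(1) by blast
    then show "h \<in> {j} \<times> {..<d j}" using \<open>fst h = j\<close> by (auto simp: half_edges_def)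
  next
    fix h assume h: "h \<in> {j} \<times> {..<d j}"
    then have "h \<in> \<Union>P" using j part(1) by (auto simp: half_edges_def)
    then obtain e where e: "e \<in> P" "h \<in> e" by blast
    then obtain h' where "e = {h, h'}"
      using two[OF e(1)] by (auto simp: card_2_iff)
    then have "(h, h') \<in> ?A" using e h by (auto simp: A)
    then show "h \<in> fst ` ?A" by force
  qed
  ultimately have "card ?A = card ({j} \<times> {..<d j})" by (metis card_image)
  then show ?thesis by (simp add: out_degree_def card_cartesian_product)
qed

end

theory Submission
  imports Defs "HOL-Real_Asymp.Real_Asymp"
begin

text \<open>
  A uniform perfect matching can be revealed one pair at a time: the partner of a chosen half-edge
  is uniform among the other half-edges, and the remaining ones are again matched uniformly. This
  is \<open>match_prob_step\<close>, and every probabilistic estimate below is an induction along it, with a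
  bound that depends only on what has been revealed so far.

  That distances are not shorter is a first moment bound. A walk between two different vertices
  contains a trail that uses no edge twice. Revealing such a trail from its start, each further edge multiplies the expected
  number of continuations by about \<open>\<nu>\<close>. So vertices \<open>x\<close> and \<open>y\<close> are within distance \<open>k\<close> with
  probability of order at most \<open>d x * d y / total * (\<Sum>i<k. \<nu> ^ i)\<close> (\<open>match_prob_walk_le\<close>). Averaged
  over the two vertices, this is about \<open>k * \<nu> ^ k / n\<close>, which vanishes for \<open>k = c * ln n\<close> with
  \<open>c < 1 / ln \<nu>\<close>.

  To see that distances are not longer, grow a front of unpaired half-edges around each vertex. While only a
  small fraction of all half-edges has been explored, pairing one half-edge of a front leads to an
  untouched vertex of degree at most \<open>K\<close> with almost its size-biased probability, so a step brings in
  on average more than \<open>\<mu>\<close> new half-edges, for a given \<open>\<mu>\<close> with \<open>1 < \<mu> < \<nu>\<close> and a large enough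
  constant \<open>K\<close>. Consequently the average of \<open>exp (- \<theta> * gain)\<close> over the possible partners is at most
  \<open>exp (- \<theta> * \<mu>)\<close> for all small \<open>\<theta>\<close> (\<open>exploration_step_weight\<close>). This inequality is used in two
  ways.

  \<^item> If the failure probability is at most \<open>exp (- \<theta> * size)\<close> for the front of the next generation,
    it is at most \<open>exp (- \<theta> * \<mu> * size)\<close> for the present one: the exponential rate gains a factor
    \<open>\<mu>\<close> per generation. A front of size \<open>L\<close> slightly above \<open>sqrt n\<close> is as good as certain to meet
    another such front (\<open>apart_collision\<close>), and reaching \<open>L\<close> fails with at most the trivial bound
    \<open>exp (1 - size / L)\<close>. So after about \<open>ln L / ln \<mu>\<close> generations on either side, fronts of sizes
    \<open>a\<close> and \<open>b\<close> fail to meet with probability at most \<open>exp (1 - \<theta> * a) + exp (1 - \<theta> * b)\<close> plus a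
    negligible term, where \<open>\<theta>\<close> is now a constant (\<open>apart_two_fronts\<close>).

  \<^item> Explore the whole clusters of the two vertices for \<open>T\<close> steps each. If a cluster is exhausted, the
    vertices are not connected. On the event that it is not, the weight \<open>exp (- \<theta> * size)\<close> loses on
    average a factor \<open>exp (\<theta> * (\<mu> - 1))\<close> in each step (\<open>far_explore_cluster\<close>). With \<open>T\<close> a small multiple of
    \<open>ln n\<close>, the two terms of the first item become small, and the vertices are hardly ever connected
    at a distance above \<open>2 * T + 1\<close> plus twice the number of generations (\<open>far_le\<close>).

  The conditioning is harmless because connection has probability bounded away from zero: with a
  positive probability, the first few steps from either vertex all lead to untouched vertices of
  degree at least 3, and then the bound for two fronts applies (\<open>apart_le_uniform\<close>). Weak convergence
  enters only to show that a bounded degree \<open>K\<close> carries almost all of \<open>\<nu>\<close>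
  (\<open>truncated_forward_degree\<close>).
\<close>

lemma real_card_remove: "finite S \<Longrightarrow> x \<in> S \<Longrightarrow> real (card (S - {x})) = real (card S) - 1"
  using card_gt_0_iff[of S] by (auto simp: of_nat_diff Suc_leI)

section \<open>Revealing a uniform perfect matching one pair at a time\<close>

definition match_prob :: "'a set \<Rightarrow> ('a set set \<Rightarrow> bool) \<Rightarrow> real" where
  "match_prob H \<phi> = card {P \<in> perfect_matchings H. \<phi> P} / card (perfect_matchings H)"

lemma perfect_matchings_elem_subset:
  "P \<in> perfect_matchings H \<Longrightarrow> e \<in> P \<Longrightarrow> e \<subseteq> H"
  by (auto simp: perfect_matchings_def partition_on_def)

lemma insert_pair_perfect_matchings:
  assumes "h \<in> H" "h' \<in> H" "h \<noteq> h'" "P \<in> perfect_matchings (H - {h, h'})"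
  shows "insert {h, h'} P \<in> perfect_matchings H"
proof -
  have "partition_on H (insert {h, h'} P)"
    using assms by (intro partition_onI)
      (auto simp: perfect_matchings_def partition_on_def disjoint_def disjnt_def)
  then show ?thesis
    using assms by (auto simp: perfect_matchings_def)
qed

lemma perfect_matchings_pair_disjoint:
  assumes "P \<in> perfect_matchings H" "e \<in> P" "e' \<in> P" "x \<in> e" "x \<in> e'"
  shows "e = e'"
  using assms unfolding perfect_matchings_def partition_on_def disjoint_def by blast

lemma perfect_matchings_remove_pair:
  assumes P: "P \<in> perfect_matchings H" and e: "{h, h'} \<in> P"
  shows "P - {{h, h'}} \<in> perfect_matchings (H - {h, h'})"
proof -
  have "\<Union>(P - {{h, h'}}) = H - {h, h'}"
  proof
    show "\<Union>(P - {{h, h'}}) \<subseteq> H - {h, h'}"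
      using P e perfect_matchings_pair_disjoint[OF P _ e] perfect_matchings_elem_subset[OF P]
      by fast
    show "H - {h, h'} \<subseteq> \<Union>(P - {{h, h'}})"
      using P by (auto simp: perfect_matchings_def partition_on_def)
  qed
  then show ?thesis
    using P unfolding perfect_matchings_def partition_on_def disjoint_def by auto
qed

lemma perfect_matchings_partner:
  assumes P: "P \<in> perfect_matchings H" and h: "h \<in> H"
  obtains h' where "h' \<in> H" "h' \<noteq> h" "{h, h'} \<in> P"
proof -
  obtain e where e: "e \<in> P" "h \<in> e"
    using assms by (auto simp: perfect_matchings_def partition_on_def)
  then have "card e = 2" using P by (auto simp: perfect_matchings_def)
  then obtain x y where xy: "e = {x, y}" "x \<noteq> y" by (auto simp: card_2_iff)
  have "e \<subseteq> H" using P e perfect_matchings_elem_subset by blast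
  then show ?thesis
    using e xy that by (cases "h = x") (auto simp: insert_commute)
qed

lemma perfect_matchings_decompose:
  assumes h: "h \<in> H"
  shows "{P \<in> perfect_matchings H. \<phi> P} = (\<Union>h' \<in> H - {h}.
    insert {h, h'} ` {P \<in> perfect_matchings (H - {h, h'}). \<phi> (insert {h, h'} P)})"
    (is "?L = ?R")
proof
  show "?R \<subseteq> ?L"
    using h insert_pair_perfect_matchings by fastforce
  show "?L \<subseteq> ?R"
  proof
    fix P assume "P \<in> ?L"
    then have P: "P \<in> perfect_matchings H" "\<phi> P" by simp_all
    obtain h' where h': "h' \<in> H" "h' \<noteq> h" "{h, h'} \<in> P"
      by (rule perfect_matchings_partner[OF P(1) h])
    define Q where "Q = P - {{h, h'}}"
    have "P = insert {h, h'} Q" using h' by (auto simp: Q_def)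
    moreover have "Q \<in> perfect_matchings (H - {h, h'})"
      unfolding Q_def by (rule perfect_matchings_remove_pair[OF P(1) h'(3)])
    ultimately have "P \<in> insert {h, h'} `
        {P \<in> perfect_matchings (H - {h, h'}). \<phi> (insert {h, h'} P)}"
      using P(2) by (intro image_eqI[of _ _ Q]) simp_all
    then show "P \<in> ?R" using h' by blast
  qed
qed

lemma card_perfect_matchings_decompose:
  assumes fin: "finite H" and h: "h \<in> H"
  shows "card {P \<in> perfect_matchings H. \<phi> P} =
    (\<Sum>h' \<in> H - {h}. card {P \<in> perfect_matchings (H - {h, h'}). \<phi> (insert {h, h'} P)})"
proof -
  have fin': "finite {P \<in> perfect_matchings (H - {h, h'}). \<phi> (insert {h, h'} P)}" for h'
    using fin by (simp add: finite_perfect_matchings)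
  have notin: "{h, h'} \<notin> P" if "P \<in> perfect_matchings (H - {h, h'})" for P h'
    using perfect_matchings_elem_subset[OF that] by blast
  have inj: "inj_on (insert {h, h'})
      {P \<in> perfect_matchings (H - {h, h'}). \<phi> (insert {h, h'} P)}" for h'
    using notin by (intro inj_onI) (metis (no_types, lifting) Diff_insert_absorb mem_Collect_eq)
  have disj: "insert {h, x} ` {P \<in> perfect_matchings (H - {h, x}). \<phi> (insert {h, x} P)} \<inter>
      insert {h, y} ` {P \<in> perfect_matchings (H - {h, y}). \<phi> (insert {h, y} P)} = {}"
    if "x \<noteq> y" "x \<in> H - {h}" "y \<in> H - {h}" for x y
  proof -
    have "{h, x} \<notin> insert {h, y} P" if "P \<in> perfect_matchings (H - {h, y})" for P
      using perfect_matchings_elem_subset[OF that] \<open>x \<noteq> y\<close> by (auto simp: doubleton_eq_iff)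
    then show ?thesis by blast
  qed
  show ?thesis
    unfolding perfect_matchings_decompose[OF h]
    using fin fin' disj by (subst card_UN_disjoint) (auto simp: card_image[OF inj])
qed

text \<open>
  The number of matchings that remain does not depend on which partner was chosen; this is what makes
  the partner uniform in \<open>match_prob_step\<close>.
\<close>

lemma card_perfect_matchings_cong:
  fixes H H' :: "'a set"
  assumes "finite H" "finite H'" "card H = card H'"
  shows "card (perfect_matchings H) = card (perfect_matchings H')"
  using assms
proof (induction "card H" arbitrary: H H' rule: less_induct)
  case less
  show ?case
  proof (cases "H = {}")
    case True
    then show ?thesis using less.prems by auto
  next
    case False
    then obtain h g where h: "h \<in> H" "g \<in> H'" using less.prems by fastforce
    have rec: "card (perfect_matchings X) = (\<Sum>x' \<in> X - {x}. card (perfect_matchings (X - {x, x'})))"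
      if "finite X" "x \<in> X" for X :: "'a set" and x
      using card_perfect_matchings_decompose[OF that, of "\<lambda>_. True"] by simp
    have card2: "card (X - {x, x'}) = card X - 2" if "finite X" "x \<in> X" "x' \<in> X - {x}"
      for X :: "'a set" and x x' using that by (auto simp: card_Diff_subset)
    have lt: "card X - 2 < card X" if "finite X" "x \<in> X" for X :: "'a set" and x
      using that by (metis card_gt_0_iff diff_less empty_iff zero_less_numeral)
    show ?thesis
    proof (cases "H - {h} = {}")
      case True
      then have "card (H' - {g}) = 0"
        using h less.prems by (metis card_Diff_singleton card.empty)
      then have "H' - {g} = {}" using less.prems by simp
      then show ?thesis
        using rec[OF less.prems(1) h(1)] rec[OF less.prems(2) h(2)] True by (metis sum.empty)
    next
      case False
      then obtain h0 where h0: "h0 \<in> H - {h}" by blast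
      have cc: "card (H - {h}) = card (H' - {g})" using h less.prems by simp
      have 1: "card (perfect_matchings (H - {h, h'})) = card (perfect_matchings (H - {h, h0}))"
        if "h' \<in> H - {h}" for h'
        using less.hyps[of "H - {h, h'}" "H - {h, h0}"] card2[OF less.prems(1) h(1)] h0 that
          lt[OF less.prems(1) h(1)] less.prems by simp
      have 2: "card (perfect_matchings (H' - {g, g'})) = card (perfect_matchings (H - {h, h0}))"
        if "g' \<in> H' - {g}" for g'
        using less.hyps[of "H - {h, h0}" "H' - {g, g'}"] card2[OF less.prems(1) h(1)] h0 that
          card2[OF less.prems(2) h(2)] lt[OF less.prems(1) h(1)] less.prems by simp
      show ?thesis
        using rec[OF less.prems(1) h(1)] rec[OF less.prems(2) h(2)] 1 2 cc by simp
    qed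
  qed
qed

lemma match_prob_step:
  assumes fin: "finite H" and ev: "even (card H)" and h: "h \<in> H"
  shows "match_prob H \<phi> =
    (\<Sum>h' \<in> H - {h}. match_prob (H - {h, h'}) (\<lambda>P. \<phi> (insert {h, h'} P))) / (card H - 1)"
proof -
  have "card H \<noteq> 1" using ev by auto
  then have "H \<noteq> {h}" by auto
  then obtain h0 where h0: "h0 \<in> H - {h}" using h by blast
  define c where "c = card (perfect_matchings (H - {h, h0}))"
  have c: "card (perfect_matchings (H - {h, h'})) = c" if "h' \<in> H - {h}" for h'
    unfolding c_def using that h0 h fin
    by (intro card_perfect_matchings_cong) (auto simp: card_Diff_subset)
  have ev0: "even (card (H - {h, h0}))"
    using h0 h fin ev by (auto simp: card_Diff_subset)
  have "c \<noteq> 0"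
    unfolding c_def
    using perfect_matchings_nonempty[OF _ ev0] finite_perfect_matchings[of "H - {h, h0}"] fin
    by auto
  have tot: "card (perfect_matchings H) = (card H - 1) * c"
    using card_perfect_matchings_decompose[OF fin h, of "\<lambda>_. True"] c fin h by simp
  show ?thesis
    unfolding match_prob_def card_perfect_matchings_decompose[OF fin h] tot
    by (simp add: c sum_divide_distrib mult.commute)
qed

lemma match_prob_nonneg: "0 \<le> match_prob H \<phi>"
  by (simp add: match_prob_def)

lemma match_prob_mono:
  assumes "finite H" "\<And>P. P \<in> perfect_matchings H \<Longrightarrow> \<phi> P \<Longrightarrow> \<psi> P"
  shows "match_prob H \<phi> \<le> match_prob H \<psi>"
  unfolding match_prob_def using assms
  by (intro divide_right_mono) (auto intro!: card_mono simp: finite_perfect_matchings)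

lemma match_prob_le_1:
  assumes "finite H" shows "match_prob H \<phi> \<le> 1"
  unfolding match_prob_def using assms
  by (auto intro!: divide_le_eq_1[THEN iffD2] card_mono simp: finite_perfect_matchings)
    
lemma match_prob_eq_0:
  assumes "\<And>P. P \<in> perfect_matchings H \<Longrightarrow> \<not> \<phi> P"
  shows "match_prob H \<phi> = 0"
proof -
  have "{P \<in> perfect_matchings H. \<phi> P} = {}" using assms by auto
  then have "card {P \<in> perfect_matchings H. \<phi> P} = 0" by (simp only: card.empty)
  then show ?thesis by (simp add: match_prob_def)
qed

lemma match_prob_union_bound:
  assumes "finite I"
  shows "match_prob H (\<lambda>P. \<exists>i\<in>I. \<phi> i P) \<le> (\<Sum>i\<in>I. match_prob H (\<phi> i))"
proof -
  have "card {P \<in> perfect_matchings H. \<exists>i\<in>I. \<phi> i P}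
      = card (\<Union>i\<in>I. {P \<in> perfect_matchings H. \<phi> i P})"
    by (rule arg_cong[where f = card]) auto
  also have "\<dots> \<le> (\<Sum>i\<in>I. card {P \<in> perfect_matchings H. \<phi> i P})"
    by (rule card_UN_le[OF assms])
  finally show ?thesis
    unfolding match_prob_def sum_divide_distrib[symmetric]
    by (intro divide_right_mono) (simp_all flip: of_nat_sum)
qed

lemma match_prob_compl:
  assumes "finite H" "even (card H)"
  shows "match_prob H (\<lambda>P. \<not> \<phi> P) = 1 - match_prob H \<phi>"
proof -
  let ?S = "perfect_matchings H"
  have f: "finite ?S" "?S \<noteq> {}"
    using assms by (auto simp: finite_perfect_matchings perfect_matchings_nonempty)
  have "card ?S = card ({P \<in> ?S. \<phi> P} \<union> {P \<in> ?S. \<not> \<phi> P})"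
    by (rule arg_cong[where f = card]) auto
  also have "\<dots> = card {P \<in> ?S. \<phi> P} + card {P \<in> ?S. \<not> \<phi> P}"
    using f by (intro card_Un_disjoint) auto
  finally have "real (card {P \<in> ?S. \<not> \<phi> P}) = card ?S - real (card {P \<in> ?S. \<phi> P})"
    by linarith
  then show ?thesis
    using f by (simp add: match_prob_def diff_divide_distrib)
qed

text \<open>
  In all inductions the bound for the state after the step is \<open>c * w h' + f\<close>, where only the weight \<open>w\<close>
  depends on the partner \<open>h'\<close>. Then it suffices to estimate the average of \<open>w\<close>.
\<close>

lemma match_prob_step_le:
  assumes fin: "finite H" and ev: "even (card H)" and h: "h \<in> H"
    and le: "\<And>h'. h' \<in> H - {h} \<Longrightarrow>
      match_prob (H - {h, h'}) (\<lambda>P. \<phi> (insert {h, h'} P)) \<le> c * w h' + f"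
    and w: "(\<Sum>h' \<in> H - {h}. w h') \<le> (real (card H) - 1) * s" and c: "c \<ge> 0"
  shows "match_prob H \<phi> \<le> c * s + f"
proof -
  have "card H \<noteq> 1" "card H \<noteq> 0" using ev h fin by auto
  then have pos: "real (card H) - 1 > 0" "real (card H - 1) = real (card H) - 1" by linarith+
  have "(\<Sum>h' \<in> H - {h}. match_prob (H - {h, h'}) (\<lambda>P. \<phi> (insert {h, h'} P)))
      \<le> (\<Sum>h' \<in> H - {h}. c * w h' + f)"
    by (intro sum_mono le)
  also have "\<dots> = c * (\<Sum>h' \<in> H - {h}. w h') + (real (card H) - 1) * f"
    using pos h fin by (simp add: sum.distrib sum_distrib_left)
  also have "\<dots> \<le> c * ((real (card H) - 1) * s) + (real (card H) - 1) * f"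
    using w c by (intro add_right_mono mult_left_mono)
  also have "\<dots> = (c * s + f) * (real (card H) - 1)" by (simp add: algebra_simps)
  finally show ?thesis
    unfolding match_prob_step[OF fin ev h] using pos
    by (simp add: pos_divide_le_eq)
qed

section \<open>Walks between vertices of a pairing\<close>

definition adj :: "('v \<times> 'k) set set \<Rightarrow> 'v rel" where
  "adj P = {(u, v). \<exists>i k. {(u, i), (v, k)} \<in> P}"

definition walk_within :: "('v \<times> 'k) set set \<Rightarrow> nat \<Rightarrow> 'v \<Rightarrow> 'v \<Rightarrow> bool" where
  "walk_within P k u v \<longleftrightarrow> (\<exists>j\<le>k. (u, v) \<in> adj P ^^ j)"

lemma adj_mono: "P \<subseteq> Q \<Longrightarrow> adj P \<subseteq> adj Q"
  by (auto simp: adj_def)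

lemma adj_sym: "(u, v) \<in> adj P \<Longrightarrow> (v, u) \<in> adj P"
  by (auto simp: adj_def insert_commute)

lemma adj_pairI: "{h, h'} \<in> P \<Longrightarrow> (fst h, fst h') \<in> adj P"
  by (auto simp: adj_def) (metis prod.collapse)

lemma relpow_mono_rel: "R \<subseteq> S \<Longrightarrow> R ^^ k \<subseteq> (S :: 'a rel) ^^ k"
  by (induction k) auto

lemma walk_within_mono:
  assumes "walk_within P j u v" "P \<subseteq> Q" "j \<le> k"
  shows "walk_within Q k u v"
  using assms relpow_mono_rel[OF adj_mono[OF assms(2)]] unfolding walk_within_def
  by (meson order_trans subsetD)

lemma walk_within_refl: "walk_within P k u u"
  unfolding walk_within_def by (rule exI[of _ 0]) auto

lemma walk_within_trans:
  assumes "walk_within P j u v" "walk_within P k v w"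
  shows "walk_within P (j + k) u w"
proof -
  obtain a b where ab: "a \<le> j" "(u, v) \<in> adj P ^^ a" "b \<le> k" "(v, w) \<in> adj P ^^ b"
    using assms unfolding walk_within_def by blast
  then have "(u, w) \<in> adj P ^^ (a + b)" by (auto simp: relpow_add)
  then show ?thesis using ab unfolding walk_within_def by (meson add_mono)
qed

lemma walk_within_pair: "{h, h'} \<in> P \<Longrightarrow> walk_within P 1 (fst h) (fst h')"
  unfolding walk_within_def using adj_pairI[of h h' P] by (intro exI[of _ 1]) (simp add: relpow_1)

lemma walk_within_sym:
  assumes "walk_within P k u v" shows "walk_within P k v u"
proof -
  have "(v, u) \<in> adj P ^^ j" if "(u, v) \<in> adj P ^^ j" for j u v
    using that
  proof (induction j arbitrary: v)
    case (Suc j)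
    then obtain z where "(u, z) \<in> adj P ^^ j" "(z, v) \<in> adj P" by auto
    then show ?case by (meson Suc.IH adj_sym relpow_Suc_I2)
  qed simp
  then show ?thesis using assms unfolding walk_within_def by metis
qed

lemma walk_within_sym_iff: "walk_within P k u v \<longleftrightarrow> walk_within P k v u"
  by (rule iffI) (erule walk_within_sym)+

lemma walk_within_extend:
  assumes "walk_within R i v (fst h)"
  shows "walk_within (insert {h, h'} R) (i + 1) v (fst h')"
  by (rule walk_within_trans[OF walk_within_mono[OF assms] walk_within_pair]) auto

lemma walk_within_join:
  assumes "walk_within R i v (fst h)" "walk_within R j w (fst h')" "i + j + 1 \<le> r"
  shows "walk_within (insert {h, h'} R) r v w"
proof -
  have "walk_within (insert {h, h'} R) (i + 1 + j) v w"
    by (rule walk_within_trans[OF walk_within_extend[OF assms(1)]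
          walk_within_sym[OF walk_within_mono[OF assms(2)]]]) auto
  then show ?thesis by (rule walk_within_mono) (use assms in auto)
qed

section \<open>One exploration step\<close>

lemma exp_minus_le_quadratic: "exp (- x) \<le> 1 - x + x\<^sup>2" if "0 \<le> x" for x :: real
proof -
  have "exp (- x) \<le> 1 / (1 + x)"
    using exp_ge_add_one_self[of x] that by (simp add: exp_minus field_simps)
  also have "\<dots> \<le> 1 - x + x\<^sup>2"
  proof -
    have "(1 - x + x\<^sup>2) * (1 + x) = 1 + x ^ 3" by (simp add: algebra_simps power2_eq_square power3_eq_cube)
    then show ?thesis using that by (simp add: pos_divide_le_eq)
  qed
  finally show ?thesis .
qed

text \<open>
  The number \<open>d v * (d v - 1)\<close> sums \<open>d v - 1\<close>, the gain when \<open>v\<close> is discovered, over the half-edges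
  that lead to \<open>v\<close>. The assumption \<open>surplus\<close> says that the average gain, truncated at degree \<open>K\<close>, exceeds
  \<open>\<mu>\<close> by enough to absorb two losses: \<open>\<delta>\<close> is the fraction of half-edges that may have been explored
  already, and \<open>\<theta>\<^sub>0\<close> bounds the rate for which \<open>exp\<close> is replaced by its linear part.
\<close>

locale exploration =
  fixes n :: nat and d :: "nat \<Rightarrow> nat" and K :: nat and \<mu> \<delta> \<theta>\<^sub>0 :: real
  assumes mu_gt_1: "\<mu> > 1" and K_pos: "K \<ge> 1" and delta_nonneg: "\<delta> \<ge> 0"
    and theta0_pos: "\<theta>\<^sub>0 > 0" and theta0_mu: "\<theta>\<^sub>0 * \<mu> \<le> 1"
    and surplus: "(\<mu> + \<delta> * (real K ^ 2 + 2 * \<mu>) + \<theta>\<^sub>0 * real K ^ 2) * card (half_edges n d)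
      \<le> (\<Sum>v | v \<in> {1..n} \<and> d v \<le> K. real (d v) * (real (d v) - 1))"
begin

abbreviation HE :: "half_edge set" where "HE \<equiv> half_edges n d"

text \<open>
  Here \<open>F\<close> is the set of half-edges of which nothing is known yet. The bound on the degree makes sure that
  a step explores at most \<open>K\<close> half-edges.
\<close>

definition fresh :: "half_edge set \<Rightarrow> half_edge \<Rightarrow> bool" where
  "fresh F h \<longleftrightarrow> d (fst h) \<le> K \<and> {fst h} \<times> {..<d (fst h)} \<subseteq> F"

definition siblings :: "half_edge \<Rightarrow> half_edge set" where
  "siblings h = {fst h} \<times> {..<d (fst h)} - {h}"

lemma finite_HE: "finite HE" by (rule finite_half_edges)

lemma half_edge_in_own_star: "h \<in> HE \<Longrightarrow> h \<in> {fst h} \<times> {..<d (fst h)}"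
  by (auto simp: half_edges_def)

lemma finite_siblings: "finite (siblings h)"
  by (simp add: siblings_def)

lemma card_siblings: "h \<in> HE \<Longrightarrow> card (siblings h) = d (fst h) - 1"
  unfolding siblings_def using half_edge_in_own_star[of h]
  by (subst card_Diff_subset) auto

lemma degree_pos_if_half_edge: "h \<in> HE \<Longrightarrow> d (fst h) \<ge> 1"
  by (auto simp: half_edges_def)

text \<open>
  A vertex of degree at most \<open>K\<close> that is not fresh has an explored half-edge and costs at most
  \<open>K\<^sup>2\<close> of the surplus, so \<open>\<delta>\<close> times the number of all half-edges bounds the number of such vertices.
\<close>

lemma sum_fresh_ge:
  assumes F: "F \<subseteq> HE" and dam: "card (HE - F) \<le> \<delta> * card HE"
  shows "(\<mu> + 2 * \<delta> * \<mu> + \<theta>\<^sub>0 * real K ^ 2) * card HE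
    \<le> (\<Sum>h | h \<in> F \<and> fresh F h. real (d (fst h)) - 1)"
proof -
  define V where "V = {v \<in> {1..n}. d v \<le> K}"
  define W where "W = {v \<in> V. {v} \<times> {..<d v} \<subseteq> F}"
  have fin: "finite V" "finite W" by (auto simp: V_def W_def)
  have Y: "{h. h \<in> F \<and> fresh F h} = (SIGMA v:W. {..<d v})"
    using F by (fastforce simp: W_def V_def fresh_def half_edges_def)
  have "(\<Sum>h | h \<in> F \<and> fresh F h. real (d (fst h)) - 1)
      = (\<Sum>v\<in>W. \<Sum>k<d v. real (d v) - 1)"
    unfolding Y using fin by (subst sum.Sigma) (auto simp: case_prod_beta)
  also have "\<dots> = (\<Sum>v\<in>W. real (d v) * (real (d v) - 1))" by simp
  finally have eq: "(\<Sum>h | h \<in> F \<and> fresh F h. real (d (fst h)) - 1) = \<dots>" .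
  have "V - W \<subseteq> fst ` (HE - F)"
    by (force simp: V_def W_def half_edges_def)
  then have "card (V - W) \<le> card (HE - F)"
    using finite_HE by (meson card_image_le card_mono finite_Diff finite_imageI le_trans)
  then have c: "real (card (V - W)) \<le> \<delta> * card HE" using dam by linarith
  have "(\<Sum>v\<in>V - W. real (d v) * (real (d v) - 1)) \<le> (\<Sum>v\<in>V - W. real K ^ 2)"
  proof (rule sum_mono)
    fix v assume "v \<in> V - W"
    then have "real (d v) \<le> K" by (auto simp: V_def)
    then have "real (d v) * (real (d v) - 1) \<le> real (d v) * real (d v)"
      by (intro mult_left_mono) auto
    also have "\<dots> \<le> real K * real K" using \<open>real (d v) \<le> K\<close> by (intro mult_mono) auto
    finally show "real (d v) * (real (d v) - 1) \<le> real K ^ 2" by (simp add: power2_eq_square)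
  qed
  also have "\<dots> = card (V - W) * real K ^ 2" by simp
  also have "\<dots> \<le> \<delta> * card HE * real K ^ 2" using c by (intro mult_right_mono) auto
  finally have "(\<Sum>v\<in>V - W. real (d v) * (real (d v) - 1)) \<le> \<delta> * card HE * real K ^ 2" .
  moreover have "(\<Sum>v\<in>V. real (d v) * (real (d v) - 1)) =
      (\<Sum>v\<in>V - W. real (d v) * (real (d v) - 1)) + (\<Sum>v\<in>W. real (d v) * (real (d v) - 1))"
    using fin by (intro sum.subset_diff) (auto simp: W_def)
  moreover have "(\<mu> + \<delta> * (real K ^ 2 + 2 * \<mu>) + \<theta>\<^sub>0 * real K ^ 2) * card HE
      \<le> (\<Sum>v\<in>V. real (d v) * (real (d v) - 1))"
    using surplus by (simp add: V_def)
  ultimately show ?thesis unfolding eq by (simp add: algebra_simps)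
qed

text \<open>
  Vertices of degree at most 2 gain at most one half-edge each. As the average gain exceeds \<open>\<mu> > 1\<close>, the
  vertices of degree at least 3 must make up for the difference.
\<close>

lemma card_fresh_branching_ge:
  assumes F: "F \<subseteq> HE" and dam: "card (HE - F) \<le> \<delta> * card HE"
  shows "(\<mu> - 1) * card HE \<le> K * card {h \<in> F. fresh F h \<and> d (fst h) \<ge> 3}"
proof -
  let ?Y = "{h \<in> F. fresh F h}" and ?Z = "{h \<in> F. fresh F h \<and> d (fst h) \<ge> 3}"
  have finF: "finite F" using F finite_HE finite_subset by blast
  have "(\<Sum>h\<in>?Y. real (d (fst h)) - 1) \<le> (\<Sum>h\<in>?Y. 1 + (if d (fst h) \<ge> 3 then real K else 0))"
    by (intro sum_mono) (auto simp: fresh_def)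
  also have "\<dots> = real (card ?Y) + real K * real (card ?Z)"
    using finF by (simp add: sum.distrib sum.If_cases Int_def conj_ac)
  also have "real (card ?Y) \<le> real (card HE)"
    using F finite_HE by (intro of_nat_mono card_mono) auto
  finally have "(\<mu> + 2 * \<delta> * \<mu> + \<theta>\<^sub>0 * real K ^ 2) * card HE \<le> card HE + K * card ?Z"
    using sum_fresh_ge[OF assms] by simp
  moreover have "\<mu> * card HE \<le> (\<mu> + 2 * \<delta> * \<mu> + \<theta>\<^sub>0 * real K ^ 2) * card HE"
    using mu_gt_1 delta_nonneg theta0_pos by (intro mult_right_mono) auto
  ultimately have "\<mu> * card HE \<le> card HE + K * card ?Z" by linarith
  then show ?thesis by (simp add: algebra_simps)
qed

text \<open>
  The key inequality: if a step gains more than \<open>\<mu>\<close> on average, then \<open>exp (- \<theta> * gain)\<close> averages to at most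
  \<open>exp (- \<theta> * \<mu>)\<close> for all \<open>\<theta> \<le> \<theta>\<^sub>0\<close>. The set \<open>X\<close> contains the active half-edges on the growing side: pairing
  two of them wastes one, which is charged with the factor \<open>exp (\<theta> * \<mu>)\<close>. All other outcomes are
  counted as a gain of zero.
\<close>

lemma exploration_step_weight:
  assumes H: "H \<subseteq> HE" "h \<in> H" and F: "F \<subseteq> H - {h}" and X: "X \<subseteq> H - {h}" "X \<inter> F = {}"
    and dam: "card (HE - F) \<le> \<delta> * card HE"
    and theta: "0 < \<theta>" "\<theta> \<le> \<theta>\<^sub>0"
    and w: "\<And>h'. h' \<in> H - {h} \<Longrightarrow> w h' \<le>
      (if h' \<in> F \<and> fresh F h' then exp (- \<theta> * (real (d (fst h')) - 1))
       else if h' \<in> X then exp (\<theta> * \<mu>) else 1)"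
  shows "(\<Sum>h' \<in> H - {h}. w h') \<le> (real (card H) - 1) * exp (- \<theta> * \<mu>)"
proof -
  define tot where "tot = real (card HE)"
  have fin: "finite H" "finite F" "finite X"
    using H F X finite_HE by (meson finite_Diff finite_subset)+
  have FHE: "F \<subseteq> HE" using F H by auto
  let ?Y = "{h'. h' \<in> F \<and> fresh F h'}"
  have thmu: "0 \<le> \<theta> * \<mu>" "\<theta> * \<mu> \<le> 1"
    using theta mu_gt_1 theta0_mu mult_right_mono[of \<theta> \<theta>\<^sub>0 \<mu>] by (simp, linarith)
  have quad: "exp (- \<theta> * (real (d (fst h')) - 1)) \<le>
      1 + (- \<theta> * (real (d (fst h')) - 1) + \<theta> * (\<theta>\<^sub>0 * real K ^ 2))" if "h' \<in> F" "fresh F h'" for h'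
  proof -
    define y where "y = real (d (fst h')) - 1"
    have y: "0 \<le> y" "y \<le> K"
      using that FHE degree_pos_if_half_edge[of h'] by (auto simp: y_def fresh_def)
    have "exp (- (\<theta> * y)) \<le> 1 - \<theta> * y + (\<theta> * y)\<^sup>2"
      using theta y by (intro exp_minus_le_quadratic) auto
    also have "(\<theta> * y)\<^sup>2 \<le> \<theta> * \<theta>\<^sub>0 * real K ^ 2"
    proof -
      have "\<theta> * \<theta> \<le> \<theta> * \<theta>\<^sub>0" using theta by (intro mult_left_mono) auto
      moreover have "y\<^sup>2 \<le> real K ^ 2" using y by (intro power_mono) auto
      ultimately show ?thesis
        unfolding power_mult_distrib power2_eq_square[of \<theta>] using theta by (intro mult_mono) auto
    qed
    finally show ?thesis by (simp add: y_def algebra_simps)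
  qed
  have expX: "exp (\<theta> * \<mu>) \<le> 1 + 2 * (\<theta> * \<mu>)"
  proof -
    have "(\<theta> * \<mu>)\<^sup>2 \<le> \<theta> * \<mu>" using thmu by (simp add: power2_eq_square mult_left_le)
    then show ?thesis using exp_bound[of "\<theta> * \<mu>"] thmu by linarith
  qed
  have "(\<Sum>h' \<in> H - {h}. w h') \<le> (\<Sum>h' \<in> H - {h}. 1
      + (if h' \<in> ?Y then - \<theta> * (real (d (fst h')) - 1) + \<theta> * (\<theta>\<^sub>0 * real K ^ 2) else 0)
      + (if h' \<in> X then 2 * (\<theta> * \<mu>) else 0))"
  proof (rule sum_mono)
    fix h' assume "h' \<in> H - {h}"
    from w[OF this] show "w h' \<le> 1
      + (if h' \<in> ?Y then - \<theta> * (real (d (fst h')) - 1) + \<theta> * (\<theta>\<^sub>0 * real K ^ 2) else 0)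
      + (if h' \<in> X then 2 * (\<theta> * \<mu>) else 0)"
      using quad[of h'] expX X(2) by (auto split: if_splits)
  qed
  also have "\<dots> = (real (card H) - 1)
      + (\<Sum>h'\<in>?Y. - \<theta> * (real (d (fst h')) - 1) + \<theta> * (\<theta>\<^sub>0 * real K ^ 2))
      + card X * (2 * (\<theta> * \<mu>))"
  proof -
    have "real (card (H - {h})) = real (card H) - 1"
      using H(2) fin(1) by (intro real_card_remove)
    moreover have "(H - {h}) \<inter> ?Y = ?Y" "(H - {h}) \<inter> X = X" using F X by auto
    ultimately show ?thesis
      using fin by (simp add: sum.distrib sum.If_cases Int_def)
  qed
  also have "(\<Sum>h'\<in>?Y. - \<theta> * (real (d (fst h')) - 1) + \<theta> * (\<theta>\<^sub>0 * real K ^ 2))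
      = - \<theta> * (\<Sum>h'\<in>?Y. real (d (fst h')) - 1) + card ?Y * (\<theta> * (\<theta>\<^sub>0 * real K ^ 2))"
    by (simp only: sum.distrib sum_distrib_left sum_constant)
  also have "\<dots> \<le> - \<theta> * ((\<mu> + 2 * \<delta> * \<mu> + \<theta>\<^sub>0 * real K ^ 2) * tot) + tot * (\<theta> * (\<theta>\<^sub>0 * real K ^ 2))"
  proof (intro add_mono mult_right_mono)
    show "- \<theta> * (\<Sum>h'\<in>?Y. real (d (fst h')) - 1)
        \<le> - \<theta> * ((\<mu> + 2 * \<delta> * \<mu> + \<theta>\<^sub>0 * real K ^ 2) * tot)"
      using sum_fresh_ge[OF FHE dam] theta by (simp add: tot_def)
    show "real (card ?Y) \<le> tot"
      unfolding tot_def using FHE finite_HE by (intro of_nat_mono card_mono) auto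
  qed (use theta theta0_pos in auto)
  also have "real (card X) * (2 * (\<theta> * \<mu>)) \<le> \<delta> * tot * (2 * (\<theta> * \<mu>))"
  proof (intro mult_right_mono)
    have "card X \<le> card (HE - F)"
      using X H finite_HE by (intro card_mono) auto
    then show "real (card X) \<le> \<delta> * tot" using dam by (simp add: tot_def)
  qed (use thmu in auto)
  finally have "(\<Sum>h' \<in> H - {h}. w h') \<le> (real (card H) - 1) - \<theta> * \<mu> * tot"
    by (simp add: algebra_simps)
  also have "\<dots> \<le> (real (card H) - 1) - \<theta> * \<mu> * (real (card H) - 1)"
  proof -
    have "card H \<le> card HE" using H finite_HE by (intro card_mono) auto
    then have "real (card H) - 1 \<le> tot" by (simp add: tot_def)
    then show ?thesis using thmu mult_left_mono[of "real (card H) - 1" tot "\<theta> * \<mu>"] by linarith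
  qed
  also have "\<dots> = (real (card H) - 1) * (1 - \<theta> * \<mu>)" by (simp add: algebra_simps)
  also have "\<dots> \<le> (real (card H) - 1) * exp (- \<theta> * \<mu>)"
  proof (rule mult_left_mono)
    show "1 - \<theta> * \<mu> \<le> exp (- \<theta> * \<mu>)" using exp_ge_add_one_self[of "- \<theta> * \<mu>"] by simp
    have "card H \<noteq> 0" using H(2) fin by auto
    then show "0 \<le> real (card H) - 1" by linarith
  qed
  finally show ?thesis .
qed


section \<open>Growing the two fronts generation by generation\<close>

text \<open>
  A stage of the exploration from \<open>x\<close> and \<open>y\<close>: the pairs in \<open>R\<close> have been revealed, \<open>H\<close> contains the
  half-edges that are still to be matched, and the fronts \<open>A\<close> and \<open>B\<close> are attached to vertices within
  distance \<open>i\<close> of \<open>x\<close> and \<open>j\<close> of \<open>y\<close>. The fronts need not contain all half-edges at these distances, so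
  half-edges that would complicate the exploration can be dropped from them.
\<close>

definition fronts :: "nat \<Rightarrow> nat \<Rightarrow> nat \<Rightarrow> nat \<Rightarrow> half_edge set set \<Rightarrow> half_edge set \<Rightarrow>
    half_edge set \<Rightarrow> half_edge set \<Rightarrow> bool" where
  "fronts x y i j R H A B \<longleftrightarrow> H \<subseteq> HE \<and> even (card H) \<and> A \<subseteq> H \<and> B \<subseteq> H \<and> A \<inter> B = {} \<and>
    (\<forall>a\<in>A. walk_within R i x (fst a)) \<and> (\<forall>b\<in>B. walk_within R j y (fst b))"

definition apart :: "nat \<Rightarrow> nat \<Rightarrow> nat \<Rightarrow> half_edge set set \<Rightarrow> half_edge set \<Rightarrow> real" where
  "apart x y r R H = match_prob H (\<lambda>P. \<not> walk_within (R \<union> P) r x y)"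

text \<open>
  The complement of the unexplored half-edges. Its size is the budget: the step estimates hold as long as it
  is at most \<open>\<delta>\<close> times the number of all half-edges.
\<close>

definition explored :: "half_edge set \<Rightarrow> half_edge set \<Rightarrow> half_edge set \<Rightarrow> half_edge set" where
  "explored H A B = HE - (H - A - B)"

lemma explored_commute: "explored H A B = explored H B A"
  by (auto simp: explored_def)

lemma fronts_commute: "fronts x y i j R H A B \<longleftrightarrow> fronts y x j i R H B A"
  by (auto simp: fronts_def)

lemma fronts_finite:
  assumes "fronts x y i j R H A B" shows "finite H" "finite A" "finite B"
proof -
  show "finite H" using assms finite_HE finite_subset unfolding fronts_def by blast
  then show "finite A" "finite B"
    using assms finite_subset unfolding fronts_def by blast+
qed

lemma fronts_mono:
  assumes "fronts x y i j R H A B" "i \<le> i'" "j \<le> j'"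
  shows "fronts x y i' j' R H A B"
  using assms unfolding fronts_def by (meson order_refl walk_within_mono)

lemma fronts_pair:
  assumes "fronts x y i j R H A B" "h \<in> H" "h' \<in> H - {h}"
  shows "fronts x y i j (insert {h, h'} R) (H - {h, h'}) (A - {h, h'}) (B - {h, h'})"
proof -
  have "finite H" by (rule fronts_finite[OF assms(1)])
  then have "card (H - {h, h'}) = card H - 2" using assms by (auto simp: card_Diff_subset)
  moreover have "walk_within (insert {h, h'} R) k u v" if "walk_within R k u v" for k u v
    by (rule walk_within_mono[OF that]) auto
  ultimately show ?thesis using assms(1) unfolding fronts_def by auto
qed

lemma fronts_add:
  assumes "fronts x y i j R H A B" "S \<subseteq> H" "S \<inter> B = {}" "\<And>s. s \<in> S \<Longrightarrow> walk_within R i x (fst s)"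
  shows "fronts x y i j R H (A \<union> S) B"
  using assms unfolding fronts_def by blast

lemma fronts_subset:
  assumes "fronts x y i j R H A B" "A' \<subseteq> A"
  shows "fronts x y i j R H A' B"
  using assms unfolding fronts_def by blast

lemma apart_commute: "apart x y r R H = apart y x r R H"
  unfolding apart_def by (subst walk_within_sym_iff) simp

lemma apart_le_1: "finite H \<Longrightarrow> apart x y r R H \<le> 1"
  unfolding apart_def by (rule match_prob_le_1)

lemma apart_eq_0:
  assumes "walk_within R r x y" shows "apart x y r R H = 0"
  unfolding apart_def using assms
  by (intro match_prob_eq_0) (auto intro: walk_within_mono)

lemma apart_step_le:
  assumes "finite H" "even (card H)" "h \<in> H"
    and "\<And>h'. h' \<in> H - {h} \<Longrightarrow> apart x y r (insert {h, h'} R) (H - {h, h'}) \<le> c * w h' + f"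
    and "(\<Sum>h' \<in> H - {h}. w h') \<le> (real (card H) - 1) * s" "c \<ge> 0"
  shows "apart x y r R H \<le> c * s + f"
  unfolding apart_def
  by (rule match_prob_step_le[of H h _ c w]) (use assms in \<open>simp_all add: apart_def\<close>)

lemma apart_eq_0_if_fronts_meet:
  assumes "fronts x y i j R H A B" "h \<in> A" "h' \<in> B" "i + j + 1 \<le> r"
  shows "apart x y r (insert {h, h'} R) H' = 0"
  using assms by (intro apart_eq_0 walk_within_join[of R i x h j y h']) (auto simp: fronts_def)

lemma card_explored_pair_le:
  assumes "H - A - B - S \<subseteq> H' - A' - B'" "finite S"
  shows "card (explored H' A' B') \<le> card (explored H A B) + card S"
proof -
  have "explored H' A' B' \<subseteq> explored H A B \<union> S" using assms by (auto simp: explored_def)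
  then have "card (explored H' A' B') \<le> card (explored H A B \<union> S)"
    using assms finite_HE by (intro card_mono) (auto simp: explored_def)
  also have "\<dots> \<le> card (explored H A B) + card S" by (rule card_Un_le)
  finally show ?thesis .
qed

text \<open>
  The half-edges of \<open>A\<close> are paired one after the other, and the half-edges found in this way are collected in
  the next front \<open>N\<close>. Each pairing either meets \<open>B\<close>, and then the vertices are close, or multiplies the bound
  on average by \<open>exp (- \<theta> * \<mu>)\<close>.
\<close>

lemma apart_one_generation:
  fixes \<theta> c f D :: real
  assumes theta: "0 < \<theta>" "\<theta> \<le> \<theta>\<^sub>0" and c: "c \<ge> 0" and f: "f \<ge> 0" and r: "i + j + 1 \<le> r"
    and D: "D \<le> \<delta> * card HE"
    and terminal: "\<And>R H N. fronts x y (i + 1) j R H N B \<Longrightarrow> card (explored H N B) \<le> D \<Longrightarrow>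
      apart x y r R H \<le> c * exp (- \<theta> * card N) + f"
  shows "fronts x y i j R H A B \<Longrightarrow> fronts x y (i + 1) j R H N B \<Longrightarrow> A \<inter> N = {} \<Longrightarrow>
      real (card (explored H (A \<union> N) B)) + real K * real (card A) \<le> D \<Longrightarrow>
      apart x y r R H \<le> c * exp (- \<theta> * card N) * exp (- \<theta> * \<mu> * card A) + f"
proof (induction "card A" arbitrary: R H A N rule: less_induct)
  case less
  note frA = less.prems(1) and frN = less.prems(2)
  note fin = fronts_finite[OF frA] fronts_finite(2)[OF frN]
  show ?case
  proof (cases "A = {}")
    case True
    then show ?thesis using terminal[OF frN] less.prems by simp
  next
    case False
    then obtain h where h: "h \<in> A" by blast
    then have hH: "h \<in> H" "h \<notin> B" "h \<notin> N" using frA less.prems(3) by (auto simp: fronts_def)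
    define F where "F = H - (A \<union> N) - B"
    define X where "X = (A - {h}) \<union> N"
    \<comment> \<open>The bound that is due after \<open>h\<close> has been paired, if nothing else changes.\<close>
    define C where "C = c * exp (- \<theta> * card N) * exp (- \<theta> * \<mu> * (real (card A) - 1))"
    define w where "w h' = (if h' \<in> F \<and> fresh F h' then exp (- \<theta> * (real (d (fst h')) - 1))
       else if h' \<in> X then exp (\<theta> * \<mu>) else 1)" for h'
    have cA: "card A > 0" "card (A - {h}) = card A - 1" using h fin by (auto simp: card_gt_0_iff)
    have C: "C \<ge> 0" using c by (simp add: C_def)
    have w0: "w h' \<ge> 0" for h' by (simp add: w_def)
    have FHE: "F \<subseteq> HE" using frA by (auto simp: F_def fronts_def)
    have "apart x y r R H \<le> C * exp (- \<theta> * \<mu>) + f"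
    proof (rule apart_step_le[OF fin(1) _ hH(1) _ _ C])
      show "even (card H)" using frA by (simp add: fronts_def)
      have "real (card (HE - F)) \<le> \<delta> * card HE"
      proof -
        have "real (card (HE - F)) + real K * real (card A) \<le> D"
          using less.prems(4) by (simp add: explored_def F_def)
        then show ?thesis using D by (smt (verit) of_nat_0_le_iff mult_nonneg_nonneg)
      qed
      then show "(\<Sum>h' \<in> H - {h}. w h') \<le> (real (card H) - 1) * exp (- \<theta> * \<mu>)"
        using frA frN h hH theta
        by (intro exploration_step_weight[of H h F X]) (auto simp: fronts_def F_def X_def w_def)
    next
      fix h' assume h': "h' \<in> H - {h}"
      let ?R = "insert {h, h'} R" and ?H = "H - {h, h'}"
      show "apart x y r ?R ?H \<le> C * w h' + f"
      proof (cases "h' \<in> B")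
        case True
        then show ?thesis
          using apart_eq_0_if_fronts_meet[OF frA h True r] C w0[of h'] f by simp
      next
        case nB: False
        have B: "B - {h, h'} = B" using nB hH by auto
        define A' where "A' = A - {h, h'}"
        define N' where "N' = N - {h, h'}"
        have fA: "fronts x y i j ?R ?H A' B"
          using fronts_pair[OF frA hH(1) h'] B by (simp add: A'_def)
        have fN: "fronts x y (i + 1) j ?R ?H N' B"
          using fronts_pair[OF frN hH(1) h'] B by (simp add: N'_def)
        have cA': "card A' \<le> card A - 1"
          using card_mono[of "A - {h}" A'] cA fin by (auto simp: A'_def)
        show ?thesis
        proof (cases "h' \<in> F \<and> fresh F h'")
          case True
          then have h'HE: "h' \<in> HE" using FHE by blast
          have sib: "siblings h' \<subseteq> F - {h'}" using True by (auto simp: fresh_def siblings_def)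
          have A'eq: "A' = A - {h}" and N'eq: "N' = N"
            using True hH by (auto simp: A'_def N'_def F_def)
          have wk: "walk_within ?R (i + 1) x (fst h')"
            using frA h by (intro walk_within_extend) (auto simp: fronts_def)
          have fN': "fronts x y (i + 1) j ?R ?H (N' \<union> siblings h') B"
            by (rule fronts_add[OF fN]) (use sib hH h wk in \<open>auto simp: F_def siblings_def\<close>)
          have "card (N' \<union> siblings h') = card N + (d (fst h') - 1)"
            using sib fin card_siblings[OF h'HE] unfolding N'eq
            by (subst card_Un_disjoint) (auto simp: F_def finite_siblings)
          then have cN: "real (card (N' \<union> siblings h')) = card N + (real (d (fst h')) - 1)"
            using degree_pos_if_half_edge[OF h'HE] by simp
          have "card (insert h' (siblings h')) \<le> K"
            using card_siblings[OF h'HE] degree_pos_if_half_edge[OF h'HE] True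
            by (subst card_insert_disjoint) (auto simp: finite_siblings siblings_def fresh_def)
          moreover have "card (explored ?H (A' \<union> (N' \<union> siblings h')) B)
              \<le> card (explored H (A \<union> N) B) + card (insert h' (siblings h'))"
            using h by (intro card_explored_pair_le) (auto simp: finite_siblings A'_def N'_def)
          moreover have "real K * card A' = real K * card A - K"
            using cA unfolding A'eq by (simp add: of_nat_diff algebra_simps)
          ultimately have "real (card (explored ?H (A' \<union> (N' \<union> siblings h')) B)) + real K * real (card A') \<le> D"
            using less.prems(4) by linarith
          moreover have "A' \<inter> (N' \<union> siblings h') = {}"
            using less.prems(3) sib by (auto simp: A'_def N'_def F_def)
          ultimately have "apart x y r ?R ?H \<le>
              c * exp (- \<theta> * card (N' \<union> siblings h')) * exp (- \<theta> * \<mu> * card A') + f"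
            using cA cA' by (intro less.hyps[OF _ fA fN']) auto
          also have "real (card A') = real (card A) - 1"
            using cA unfolding A'eq by simp
          also have "c * exp (- \<theta> * card (N' \<union> siblings h')) * exp (- \<theta> * \<mu> * (real (card A) - 1))
              = C * w h'"
            unfolding cN using True by (simp add: C_def w_def algebra_simps flip: exp_add)
          finally show ?thesis .
        next
          case nF: False
          have "card (explored ?H (A' \<union> N') B) \<le> card (explored H (A \<union> N) B) + card {h'}"
            using h by (intro card_explored_pair_le) (auto simp: A'_def N'_def)
          moreover have "real K * card A' \<le> real K * card A - K"
          proof -
            have "real (card A') \<le> real (card A) - 1" using cA cA' by linarith
            then have "real K * card A' \<le> real K * (real (card A) - 1)" by (intro mult_left_mono) auto
            then show ?thesis by (simp add: algebra_simps)
          qed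
          ultimately have "real (card (explored ?H (A' \<union> N') B)) + real K * real (card A') \<le> D"
            using less.prems(4) K_pos by simp
          moreover have "A' \<inter> N' = {}"
            using less.prems(3) by (auto simp: A'_def N'_def)
          ultimately have "apart x y r ?R ?H \<le>
              c * exp (- \<theta> * card N') * exp (- \<theta> * \<mu> * card A') + f"
            using cA cA' by (intro less.hyps[OF _ fA fN]) auto
          also have "c * exp (- \<theta> * card N') * exp (- \<theta> * \<mu> * card A') \<le> C * w h'"
          proof -
            have "exp (- \<theta> * card N' + (- \<theta> * \<mu> * card A')) \<le>
              exp (- \<theta> * card N + (- \<theta> * \<mu> * (real (card A) - 1))) * w h'"
            proof (cases "h' \<in> A")
              case True
              then have "card A' = card A - 2" "card A \<ge> 2"
                using h h' fin card_mono[of A "{h, h'}"] by (auto simp: A'_def card_Diff_subset)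
              moreover have "N' = N" using True less.prems(3) hH by (auto simp: N'_def)
              moreover have "w h' = exp (\<theta> * \<mu>)"
                using True h' by (auto simp: w_def F_def X_def)
              ultimately show ?thesis by (simp add: of_nat_diff algebra_simps flip: exp_add)
            next
              case nA: False
              then have A'eq: "A' = A - {h}" by (auto simp: A'_def)
              then have cA'': "real (card A') = real (card A) - 1" using cA by simp
              show ?thesis
              proof (cases "h' \<in> N")
                case True
                have "N' = N - {h'}" using hH by (auto simp: N'_def)
                then have cN: "real (card N') = real (card N) - 1"
                  using True fin by (simp only: real_card_remove)
                have "w h' = exp (\<theta> * \<mu>)" using True by (simp add: w_def F_def X_def)
                moreover have "\<theta> \<le> \<theta> * \<mu>" using theta mu_gt_1 by simp
                ultimately show ?thesis
                  unfolding cA'' cN by (simp add: algebra_simps flip: exp_add)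
              next
                case False
                then have "N' = N" "w h' = 1" using nA nF hH by (auto simp: N'_def w_def X_def)
                then show ?thesis unfolding cA'' by simp
              qed
            qed
            then have "c * exp (- \<theta> * card N' + (- \<theta> * \<mu> * card A')) \<le>
              c * (exp (- \<theta> * card N + (- \<theta> * \<mu> * (real (card A) - 1))) * w h')"
              using c by (rule mult_left_mono)
            then show ?thesis by (simp only: C_def exp_add mult.assoc)
          qed
          finally show ?thesis by simp
        qed
      qed
    qed
    also have "C * exp (- \<theta> * \<mu>) = c * exp (- \<theta> * card N) * exp (- \<theta> * \<mu> * card A)"
      by (simp add: C_def algebra_simps flip: exp_add)
    finally show ?thesis .
  qed
qed


text \<open>
  The rate \<open>1 / L\<close> of the trivial bound, improved \<open>k\<close> times by a factor \<open>\<mu>\<close>, but not beyond the largest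
  admissible rate \<open>\<theta>\<^sub>0\<close>.
\<close>

definition rate :: "nat \<Rightarrow> real \<Rightarrow> real" where
  "rate k L = min \<theta>\<^sub>0 (\<mu> ^ k / L)"

lemma rate_pos: "L > 0 \<Longrightarrow> rate k L > 0"
  using theta0_pos mu_gt_1 by (simp add: rate_def)

lemma rate_Suc_le: "rate (Suc k) L \<le> \<mu> * rate k L"
proof -
  have "\<theta>\<^sub>0 \<le> \<mu> * \<theta>\<^sub>0" using theta0_pos mu_gt_1 by simp
  then show ?thesis using mu_gt_1 by (auto simp: rate_def min_def)
qed

text \<open>
  Once the front has \<open>L\<close> half-edges, the exploration stops and the given bound \<open>f\<close> applies. A front that is still
  smaller when no generations are left satisfies \<open>exp (1 - size / L) \<ge> 1\<close>, so the claim is trivial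
  for it; the generations before improve the rate. Since only fronts smaller than \<open>L\<close> are processed, a generation
  costs at most \<open>K * L\<close> of the budget.
\<close>

lemma apart_generations:
  fixes L f D :: real
  assumes L: "L > 0" and f: "f \<ge> 0" and D: "D \<le> \<delta> * card HE" and r: "I + j + 1 \<le> r"
    and big: "\<And>R H A. fronts x y I j R H A B \<Longrightarrow> real (card A) \<ge> L \<Longrightarrow>
      real (card (explored H A B)) \<le> D \<Longrightarrow> apart x y r R H \<le> f"
  shows "fronts x y i j R H A B \<Longrightarrow> i + k \<le> I \<Longrightarrow>
    real (card (explored H A B)) + real k * real K * L \<le> D \<Longrightarrow>
    apart x y r R H \<le> exp 1 * exp (- rate k L * card A) + f"
proof (induction k arbitrary: i R H A)
  case 0
  note fin = fronts_finite[OF 0(1)]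
  show ?case
  proof (cases "real (card A) \<ge> L")
    case True
    then have "apart x y r R H \<le> f" using 0 fronts_mono[OF 0(1), of I j] by (intro big) auto
    then show ?thesis by (simp add: add_increasing)
  next
    case False
    have "rate 0 L * card A \<le> 1 / L * card A"
      by (intro mult_right_mono) (auto simp: rate_def)
    also have "\<dots> \<le> 1" using False L by (simp add: pos_divide_le_eq)
    finally have "1 \<le> exp 1 * exp (- rate 0 L * card A)" by (simp flip: exp_add)
    then show ?thesis using apart_le_1[OF fin(1), of x y r R] f by linarith
  qed
next
  case (Suc k)
  show ?case
  proof (cases "real (card A) \<ge> L")
    case True
    have "real (Suc k) * real K * L \<ge> 0" using L by simp
    then have "apart x y r R H \<le> f"
      using Suc.prems fronts_mono[OF Suc.prems(1), of I j] True by (intro big) auto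
    then show ?thesis by (simp add: add_increasing)
  next
    case False
    have frE: "fronts x y (i + 1) j R H {} B"
      using fronts_subset[OF fronts_mono[OF Suc.prems(1), of "i + 1" j]] by simp
    have KL: "real K * real (card A) \<le> real K * L" using False by (intro mult_left_mono) auto
    have "apart x y r R H \<le>
        exp 1 * exp (- rate k L * card ({} :: half_edge set)) * exp (- rate k L * \<mu> * card A) + f"
    proof (rule apart_one_generation[where D = "D - real k * real K * L" and i = i and j = j])
      show "fronts x y i j R H A B" "fronts x y (i + 1) j R H {} B" by fact+
      show "0 < rate k L" "rate k L \<le> \<theta>\<^sub>0" using rate_pos[OF L] by (auto simp: rate_def)
      have "real k * real K * L \<ge> 0" using L by simp
      then show "D - real k * real K * L \<le> \<delta> * card HE" using D by linarith
      show "real (card (explored H (A \<union> {}) B)) + real K * real (card A) \<le> D - real k * real K * L"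
        using Suc.prems(3) KL by (simp add: algebra_simps)
      show "i + j + 1 \<le> r" using Suc.prems(2) r by simp
      show "apart x y r R H \<le> exp 1 * exp (- rate k L * card N) + f"
        if "fronts x y (i + 1) j R H N B" "real (card (explored H N B)) \<le> D - real k * real K * L"
        for R H N
        using Suc.IH[OF that(1)] that(2) Suc.prems(2) by simp
    qed (use f in auto)
    also have "\<dots> \<le> exp 1 * exp (- rate (Suc k) L * card A) + f"
      using mult_right_mono[OF rate_Suc_le[of k L], of "card A"] by (simp add: mult_ac)
    finally show ?thesis .
  qed
qed

text \<open>
  Pairing the half-edges of \<open>A\<close> takes at least \<open>card A / 2\<close> steps, as two of them may be paired with each other,
  and each step misses \<open>B\<close> with probability at most \<open>1 - card B / card HE\<close>.
\<close>

lemma apart_collision: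
  assumes r: "i + j + 1 \<le> r"
  shows "fronts x y i j R H A B \<Longrightarrow>
    apart x y r R H \<le> exp (- (real (card A) * card B / (2 * card HE)))"
proof (induction "card A" arbitrary: R H A rule: less_induct)
  case less
  note fr = less.prems
  note fin = fronts_finite[OF fr]
  show ?case
  proof (cases "A = {}")
    case True
    then show ?thesis using apart_le_1[OF fin(1)] by simp
  next
    case False
    then obtain h where h: "h \<in> A" by blast
    then have hH: "h \<in> H" "h \<notin> B" using fr by (auto simp: fronts_def)
    define b l where "b = real (card B)" and "l = real (card HE)"
    have HHE: "card H \<le> card HE" using fr finite_HE by (intro card_mono) (auto simp: fronts_def)
    have cH: "card H > 0" using hH fin by (auto simp: card_gt_0_iff)
    then have l: "l > 0" using HHE by (simp add: l_def)
    define c where "c = exp (- ((real (card A) - 2) * b / (2 * l)))"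
    have "apart x y r R H \<le> c * (1 - b / l) + 0"
    proof (rule apart_step_le[OF fin(1) _ hH(1), where w = "\<lambda>h'. if h' \<in> B then 0 else 1"])
      show "even (card H)" using fr by (simp add: fronts_def)
      have "(H - {h}) \<inter> - B = (H - {h}) - B" by auto
      moreover have "B \<subseteq> H - {h}" using fr hH by (auto simp: fronts_def)
      moreover have "card ((H - {h}) - B) = card (H - {h}) - card B"
        using calculation(2) fin by (intro card_Diff_subset) auto
      moreover have "card B \<le> card (H - {h})" using calculation(2) fin by (intro card_mono) auto
      ultimately have "(\<Sum>h' \<in> H - {h}. if h' \<in> B then 0 else 1) = real (card H) - 1 - b"
        using fin hH real_card_remove[of H h] by (simp add: sum.If_cases b_def of_nat_diff)
      also have "\<dots> \<le> (real (card H) - 1) * (1 - b / l)"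
      proof -
        have "(real (card H) - 1) * (b / l) \<le> l * (b / l)"
          using HHE by (intro mult_right_mono) (auto simp: l_def b_def)
        then show ?thesis using l by (simp add: algebra_simps)
      qed
      finally show "(\<Sum>h' \<in> H - {h}. if h' \<in> B then 0 else 1) \<le> (real (card H) - 1) * (1 - b / l)" .
    next
      fix h' assume h': "h' \<in> H - {h}"
      show "apart x y r (insert {h, h'} R) (H - {h, h'}) \<le> c * (if h' \<in> B then 0 else 1) + 0"
      proof (cases "h' \<in> B")
        case True
        then show ?thesis using apart_eq_0_if_fronts_meet[OF fr h True r] by simp
      next
        case False
        then have "fronts x y i j (insert {h, h'} R) (H - {h, h'}) (A - {h, h'}) B"
          using fronts_pair[OF fr hH(1) h'] hH by simp
        moreover have "card (A - {h, h'}) < card A"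
          using h fin by (intro psubset_card_mono) auto
        ultimately have "apart x y r (insert {h, h'} R) (H - {h, h'})
            \<le> exp (- (real (card (A - {h, h'})) * card B / (2 * card HE)))"
          by (intro less.hyps)
        also have "\<dots> \<le> c"
        proof -
          have "card A - card {h, h'} \<le> card (A - {h, h'})" by (rule diff_card_le_card_Diff) simp
          moreover have "card {h, h'} = 2" using h' by auto
          ultimately have "real (card A) - 2 \<le> card (A - {h, h'})" by linarith
          then show ?thesis using l
            unfolding c_def b_def l_def by (auto intro!: divide_right_mono mult_right_mono)
        qed
        finally show ?thesis using False by simp
      qed
    qed (simp add: c_def)
    also have "\<dots> \<le> c * exp (- (b / l))"
      using exp_ge_add_one_self[of "- (b / l)"] by (simp add: c_def)
    also have "\<dots> = exp (- (real (card A) * card B / (2 * card HE)))"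
      using l unfolding c_def b_def[symmetric] of_nat_mult l_def[symmetric]
      by (simp add: field_simps flip: exp_add)
    finally show ?thesis .
  qed
qed

text \<open>
  The front \<open>B\<close> stays untouched while \<open>A\<close> grows to size \<open>L\<close>. Then \<open>B\<close> grows against this large front, and finally
  the two large fronts collide.
\<close>

lemma apart_two_fronts:
  fixes L :: real
  assumes L: "L > 0" and fr: "fronts x y i j R H A B" and k: "i + k \<le> I" "j + k \<le> J"
    and r: "I + J + 1 \<le> r"
    and D: "real (card (explored H A B)) + 2 * real k * real K * L \<le> \<delta> * card HE"
  shows "apart x y r R H \<le> exp 1 * exp (- rate k L * card A) +
    (exp 1 * exp (- rate k L * card B) + exp (- (L\<^sup>2 / (2 * card HE))))"
proof (rule apart_generations[where D = "\<delta> * card HE - real k * real K * L" and I = I and j = j and i = i])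
  have "real k * real K * L \<ge> 0" using L by simp
  then show "\<delta> * card HE - real k * real K * L \<le> \<delta> * card HE" by simp
  show "real (card (explored H A B)) + real k * real K * L \<le> \<delta> * card HE - real k * real K * L"
    using D by (simp add: algebra_simps)
  show "I + j + 1 \<le> r" using k r by simp
next
  fix R H A
  assume fr: "fronts x y I j R H A B" and A: "L \<le> real (card A)"
    and D: "real (card (explored H A B)) \<le> \<delta> * card HE - real k * real K * L"
  have "apart y x r R H \<le> exp 1 * exp (- rate k L * card B) + exp (- (L\<^sup>2 / (2 * card HE)))"
  proof (rule apart_generations[where D = "\<delta> * card HE" and I = J and j = I and i = j])
    show "fronts y x j I R H B A" using fr fronts_commute by blast
    show "real (card (explored H B A)) + real k * real K * L \<le> \<delta> * card HE"
      using D explored_commute[of H A B] by simp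
    show "J + I + 1 \<le> r" using r by simp
  next
    fix R H B
    assume fr: "fronts y x J I R H B A" and B: "L \<le> real (card B)"
    have "apart y x r R H \<le> exp (- (real (card B) * card A / (2 * card HE)))"
      by (rule apart_collision[OF _ fr]) (use r in simp)
    also have "L\<^sup>2 \<le> real (card B) * card A"
      unfolding power2_eq_square using A B L by (intro mult_mono) auto
    then have "exp (- (real (card B) * card A / (2 * card HE))) \<le> exp (- (L\<^sup>2 / (2 * card HE)))"
      by (simp add: divide_right_mono)
    finally show "apart y x r R H \<le> exp (- (L\<^sup>2 / (2 * card HE)))" .
  qed (use L k in auto)
  then show "apart x y r R H \<le> exp 1 * exp (- rate k L * card B) + exp (- (L\<^sup>2 / (2 * card HE)))"
    by (subst apart_commute)
qed (use L fr k in auto)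


section \<open>Exploring whole clusters\<close>

definition star :: "half_edge set \<Rightarrow> nat set \<Rightarrow> half_edge set" where
  "star H U = {h \<in> H. fst h \<in> U}"

text \<open>
  In contrast to \<open>fronts\<close>, the explored vertex sets \<open>U\<close> and \<open>V\<close> are closed: they contain the ends of all revealed
  pairs, and all their unpaired half-edges \<open>star H U\<close> and \<open>star H V\<close> count as active. So the cluster of
  \<open>x\<close> is exhausted as soon as \<open>star H U\<close> is empty.
\<close>

definition clusters :: "nat \<Rightarrow> nat \<Rightarrow> nat \<Rightarrow> nat \<Rightarrow> half_edge set set \<Rightarrow> half_edge set \<Rightarrow>
    nat set \<Rightarrow> nat set \<Rightarrow> bool" where
  "clusters x y i j R H U V \<longleftrightarrow> H \<subseteq> HE \<and> even (card H) \<and> x \<in> U \<and> y \<in> V \<and> U \<inter> V = {} \<and>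
    (\<forall>u\<in>U. walk_within R i x u) \<and> (\<forall>v\<in>V. walk_within R j y v) \<and>
    (\<forall>h\<in>HE - H. fst h \<in> U \<union> V) \<and> (\<forall>e\<in>R. fst ` e \<subseteq> U \<or> fst ` e \<subseteq> V)"

definition far :: "nat \<Rightarrow> nat \<Rightarrow> nat \<Rightarrow> half_edge set set \<Rightarrow> half_edge set \<Rightarrow> real" where
  "far x y r R H = match_prob H
    (\<lambda>P. (\<exists>m. walk_within (R \<union> P) m x y) \<and> \<not> walk_within (R \<union> P) r x y)"

lemma clusters_fronts:
  "clusters x y i j R H U V \<Longrightarrow> fronts x y i j R H (star H U) (star H V)"
  unfolding clusters_def fronts_def star_def by blast

lemma clusters_commute: "clusters x y i j R H U V \<longleftrightarrow> clusters y x j i R H V U"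
  unfolding clusters_def by blast

lemma far_commute: "far x y r R H = far y x r R H"
  unfolding far_def by (subst (1 2) walk_within_sym_iff) simp

lemma far_le_apart: "finite H \<Longrightarrow> far x y r R H \<le> apart x y r R H"
  unfolding far_def apart_def by (intro match_prob_mono) auto

lemma far_eq_0: "walk_within R r x y \<Longrightarrow> far x y r R H = 0"
  unfolding far_def by (intro match_prob_eq_0) (auto intro: walk_within_mono)

lemma far_step_le:
  assumes "finite H" "even (card H)" "h \<in> H"
    and "\<And>h'. h' \<in> H - {h} \<Longrightarrow> far x y r (insert {h, h'} R) (H - {h, h'}) \<le> c * w h' + f"
    and "(\<Sum>h' \<in> H - {h}. w h') \<le> (real (card H) - 1) * s" "c \<ge> 0"
  shows "far x y r R H \<le> c * s + f"
  unfolding far_def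
  by (rule match_prob_step_le[of H h _ c w]) (use assms in \<open>simp_all add: far_def\<close>)

text \<open>
  The revealed pairs do not leave \<open>U\<close>, and no remaining pair touches it, so every walk from \<open>x\<close> stays in \<open>U\<close>.
\<close>

lemma far_eq_0_if_exhausted:
  assumes cl: "clusters x y i j R H U V" and empty: "star H U = {}"
  shows "far x y r R H = 0"
proof -
  have "z \<in> U" if P: "P \<in> perfect_matchings H" and "(x, z) \<in> adj (R \<union> P) ^^ m" for P z m
    using that(2)
  proof (induction m arbitrary: z)
    case 0
    then show ?case using cl by (auto simp: clusters_def)
  next
    case (Suc m)
    then obtain u where u: "u \<in> U" "(u, z) \<in> adj (R \<union> P)" by auto
    then obtain a b where e: "{(u, a), (z, b)} \<in> R \<union> P" by (auto simp: adj_def)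
    then show ?case
    proof
      assume "{(u, a), (z, b)} \<in> R"
      then have "{u, z} \<subseteq> U \<or> {u, z} \<subseteq> V" using cl unfolding clusters_def by fastforce
      then show ?thesis using u cl by (auto simp: clusters_def)
    next
      assume "{(u, a), (z, b)} \<in> P"
      then have "(u, a) \<in> H" using perfect_matchings_elem_subset[OF P] by blast
      then have "(u, a) \<in> star H U" using u by (simp add: star_def)
      then show ?thesis using empty by simp
    qed
  qed
  moreover have "y \<notin> U" using cl by (auto simp: clusters_def)
  ultimately show ?thesis
    unfolding far_def by (intro match_prob_eq_0) (auto simp: walk_within_def)
qed

lemma clusters_pair:
  assumes cl: "clusters x y i j R H U V" and h: "h \<in> star H U" "h' \<in> H - {h}" "fst h' \<notin> V"
  shows "clusters x y (i + 1) j (insert {h, h'} R) (H - {h, h'}) (insert (fst h') U) V"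
proof -
  have fr: "fronts x y i j (insert {h, h'} R) (H - {h, h'}) (star H U - {h, h'}) (star H V - {h, h'})"
    using fronts_pair[OF clusters_fronts[OF cl], of h h'] h by (simp add: star_def)
  have new: "walk_within (insert {h, h'} R) (i + 1) x (fst h')"
    using cl h by (intro walk_within_extend) (auto simp: clusters_def star_def)
  have mono: "walk_within (insert {h, h'} R) k u v" if "walk_within R m u v" "m \<le> k" for m k u v
    using that by (intro walk_within_mono[OF that(1)]) auto
  have hU: "fst h \<in> U" using h by (simp add: star_def)
  have c: "x \<in> U" "y \<in> V" "U \<inter> V = {}" "\<And>u. u \<in> U \<Longrightarrow> walk_within R i x u"
    "\<And>v. v \<in> V \<Longrightarrow> walk_within R j y v" "\<And>g. g \<in> HE \<Longrightarrow> g \<notin> H \<Longrightarrow> fst g \<in> U \<union> V"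
    "\<And>e. e \<in> R \<Longrightarrow> fst ` e \<subseteq> U \<or> fst ` e \<subseteq> V"
    using cl unfolding clusters_def by (auto simp del: Un_iff)
  show ?thesis
    unfolding clusters_def
  proof (intro conjI ballI)
    show "H - {h, h'} \<subseteq> HE" "even (card (H - {h, h'}))"
      using fr by (auto simp only: fronts_def)
    show "walk_within (insert {h, h'} R) (i + 1) x u" if "u \<in> insert (fst h') U" for u
      using that new mono[OF c(4)] by (cases "u = fst h'") simp_all
    show "fst g \<in> insert (fst h') U \<union> V" if "g \<in> HE - (H - {h, h'})" for g
      using that c(6)[of g] hU by (cases "g \<in> H") auto
    show "fst ` e \<subseteq> insert (fst h') U \<or> fst ` e \<subseteq> V" if "e \<in> insert {h, h'} R" for e
      using that c(7)[of e] hU by (cases "e = {h, h'}") auto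
  qed (use c h mono[OF c(5)] in simp_all)
qed

text \<open>
  A step removes the half-edge that is paired, so the expected growth of the active set is at least \<open>\<mu> - 1\<close>, and
  the weight \<open>exp (- \<theta> * size)\<close> loses on average a factor \<open>exp (\<theta> * (\<mu> - 1))\<close> per step. This holds for a
  cluster of any size, even a single half-edge; if the cluster dies out, the vertices are not connected and the bound
  holds trivially. Closedness forbids dropping half-edges of large vertices, so here a step costs up to the maximal
  degree \<open>\<Delta>\<close> of the budget.
\<close>

lemma far_explore_cluster:
  fixes \<theta> c D :: real and g :: "nat \<Rightarrow> real"
  assumes theta: "0 < \<theta>" "\<theta> \<le> \<theta>\<^sub>0" and c: "c \<ge> 0" and g: "\<And>b. g b \<ge> 0" and r: "I + j + 1 \<le> r"
    and D: "D \<le> \<delta> * card HE" and \<Delta>: "\<And>v. v \<in> {1..n} \<Longrightarrow> d v \<le> \<Delta>"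
    and terminal: "\<And>R H U. clusters x y I j R H U V \<Longrightarrow>
      real (card (explored H (star H U) (star H V))) \<le> D \<Longrightarrow>
      far x y r R H \<le> c * exp (- \<theta> * card (star H U)) + g (card (star H V))"
  shows "clusters x y i j R H U V \<Longrightarrow> i + t = I \<Longrightarrow>
      real (card (explored H (star H U) (star H V))) + real t * real \<Delta> \<le> D \<Longrightarrow>
      far x y r R H \<le>
        c * exp (- \<theta> * (\<mu> - 1)) ^ t * exp (- \<theta> * card (star H U)) + g (card (star H V))"
proof (induction t arbitrary: i R H U)
  case 0
  then show ?case using terminal[of R H U] by simp
next
  case (Suc t)
  note cl = Suc.prems(1)
  define A B where "A = star H U" and "B = star H V"
  have fr: "fronts x y i j R H A B" unfolding A_def B_def by (rule clusters_fronts[OF cl])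
  note fin = fronts_finite[OF fr]
  let ?\<rho> = "exp (- \<theta> * (\<mu> - 1))"
  show ?case
  proof (cases "A = {}")
    case True
    then have "far x y r R H = 0" using far_eq_0_if_exhausted[OF cl] by (simp add: A_def)
    then show ?thesis using g c by simp
  next
    case False
    then obtain h where h: "h \<in> A" by blast
    then have hH: "h \<in> H" "h \<notin> B" using fr by (auto simp: fronts_def)
    define F where "F = H - A - B"
    define X where "X = A - {h}"
    define C where "C = c * ?\<rho> ^ t * exp (- \<theta> * (real (card A) - 1))"
    define w where "w h' = (if h' \<in> F \<and> fresh F h' then exp (- \<theta> * (real (d (fst h')) - 1))
       else if h' \<in> X then exp (\<theta> * \<mu>) else 1)" for h'
    have cA: "real (card (A - {h})) = real (card A) - 1" using h fin by (intro real_card_remove)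
    have C: "C \<ge> 0" using c by (simp add: C_def)
    have w0: "w h' \<ge> 0" for h' by (simp add: w_def)
    have FHE: "F \<subseteq> HE" using fr by (auto simp: F_def fronts_def)
    have dam: "real (card (explored H A B)) + real t * real \<Delta> + real \<Delta> \<le> D"
      using Suc.prems(3) by (simp add: A_def B_def algebra_simps)
    have "far x y r R H \<le> C * exp (- \<theta> * \<mu>) + g (card B)"
    proof (rule far_step_le[OF fin(1) _ hH(1) _ _ C])
      show "even (card H)" using fr by (simp add: fronts_def)
      have "real t * real \<Delta> \<ge> 0" by simp
      then have "real (card (HE - F)) \<le> \<delta> * card HE"
        using dam D unfolding explored_def F_def[symmetric] by linarith
      then show "(\<Sum>h' \<in> H - {h}. w h') \<le> (real (card H) - 1) * exp (- \<theta> * \<mu>)"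
        using fr h hH theta
        by (intro exploration_step_weight[of H h F X]) (auto simp: fronts_def F_def X_def w_def)
    next
      fix h' assume h': "h' \<in> H - {h}"
      let ?R = "insert {h, h'} R" and ?H = "H - {h, h'}"
      show "far x y r ?R ?H \<le> C * w h' + g (card B)"
      proof (cases "h' \<in> B")
        case True
        have "far x y r ?R ?H = 0"
          using fr h True Suc.prems(2) r
          by (intro far_eq_0 walk_within_join[of R i x h j y h']) (auto simp: fronts_def)
        then show ?thesis using C w0[of h'] g[of "card B"] by simp
      next
        case nB: False
        then have nV: "fst h' \<notin> V" using h' by (auto simp: B_def star_def)
        let ?U = "insert (fst h') U"
        have cl': "clusters x y (i + 1) j ?R ?H ?U V"
          using clusters_pair[OF cl _ h' nV] h by (simp add: A_def)
        have B': "star ?H V = B" using nB hH by (auto simp: B_def star_def)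
        have bound: "far x y r ?R ?H \<le> c * ?\<rho> ^ t * exp (- \<theta> * card (star ?H ?U)) + g (card B)"
          if "card (explored ?H (star ?H ?U) (star ?H V)) \<le> card (explored H A B) + \<Delta>"
        proof -
          have "real (card (explored ?H (star ?H ?U) (star ?H V))) + real t * real \<Delta> \<le> D"
            using that dam by linarith
          from Suc.IH[OF cl' _ this] show ?thesis using Suc.prems(2) B' by simp
        qed
        show ?thesis
        proof (cases "h' \<in> A")
          case True
          then have "?U = U" by (auto simp: A_def star_def)
          then have A': "star ?H ?U = A - {h, h'}" by (auto simp: A_def star_def)
          have "card (explored ?H (star ?H ?U) (star ?H V)) \<le> card (explored H A B) + card ({} :: half_edge set)"
            using h True unfolding A' B' by (intro card_explored_pair_le) auto
          then have "far x y r ?R ?H \<le> c * ?\<rho> ^ t * exp (- \<theta> * card (star ?H ?U)) + g (card B)"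
            by (intro bound) simp
          also have "real (card (star ?H ?U)) = real (card A) - 2"
          proof -
            have "real (card ((A - {h}) - {h'})) = real (card (A - {h})) - 1"
              using True h' fin by (intro real_card_remove) auto
            moreover have "A - {h, h'} = (A - {h}) - {h'}" by auto
            ultimately show ?thesis using cA A' by simp
          qed
          also have "exp (- \<theta> * (real (card A) - 2)) \<le> exp (- \<theta> * (real (card A) - 1)) * w h'"
          proof -
            have "\<theta> \<le> \<theta> * \<mu>" using theta mu_gt_1 by simp
            moreover have "w h' = exp (\<theta> * \<mu>)" using True h' by (auto simp: w_def F_def X_def)
            ultimately show ?thesis by (simp add: algebra_simps flip: exp_add)
          qed
          then have "c * ?\<rho> ^ t * exp (- \<theta> * (real (card A) - 2)) \<le> C * w h'"
            unfolding C_def mult.assoc using c by (intro mult_left_mono) auto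
          finally show ?thesis by simp
        next
          case nA: False
          have h'F: "h' \<in> F" using nA nB h' by (simp add: F_def)
          have h'HE: "h' \<in> HE" using h'F FHE by blast
          have new: "fst h' \<notin> U" "fst h' \<notin> V"
            using nA nB h' by (auto simp: A_def B_def star_def)
          have sub: "{fst h'} \<times> {..<d (fst h')} \<subseteq> F"
          proof
            fix g assume "g \<in> {fst h'} \<times> {..<d (fst h')}"
            then have g: "g \<in> HE" "fst g = fst h'" using h'HE by (auto simp: half_edges_def)
            have "\<forall>g\<in>HE - H. fst g \<in> U \<union> V" using cl by (simp add: clusters_def)
            then have "g \<in> H" using g new by (metis DiffI UnE)
            then show "g \<in> F" using g new by (simp add: F_def A_def B_def star_def)
          qed
          then have sib: "siblings h' \<subseteq> F - {h'}" by (auto simp: siblings_def)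
          have "fst h \<in> U" using h by (simp add: A_def star_def)
          have star_new: "star HE {fst h'} = {fst h'} \<times> {..<d (fst h')}"
            using h'HE by (auto simp: star_def half_edges_def)
          have "H \<subseteq> HE" using cl by (simp add: clusters_def)
          then have "z \<in> (A - {h}) \<union> siblings h'" if "z \<in> star ?H ?U" for z
            using that star_new unfolding A_def star_def siblings_def by blast
          then have "star ?H ?U \<subseteq> (A - {h}) \<union> siblings h'" by blast
          moreover have "(A - {h}) \<union> siblings h' \<subseteq> star ?H ?U"
            using sib nA h unfolding A_def F_def star_def siblings_def by auto
          ultimately have A': "star ?H ?U = (A - {h}) \<union> siblings h'" by blast
          have "card (star ?H ?U) = card (A - {h}) + card (siblings h')"
            unfolding A' using fin sib by (intro card_Un_disjoint) (auto simp: F_def finite_siblings)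
          then have cA': "real (card (star ?H ?U)) = (real (card A) - 1) + (real (d (fst h')) - 1)"
            using cA card_siblings[OF h'HE] degree_pos_if_half_edge[OF h'HE] by simp
          have "card (explored ?H (star ?H ?U) (star ?H V))
              \<le> card (explored H A B) + card (insert h' (siblings h'))"
            using h unfolding A' B' by (intro card_explored_pair_le) (auto simp: finite_siblings)
          moreover have "card (insert h' (siblings h')) \<le> \<Delta>"
          proof -
            have "card (insert h' (siblings h')) = d (fst h')"
              using card_siblings[OF h'HE] degree_pos_if_half_edge[OF h'HE]
              by (subst card_insert_disjoint) (auto simp: finite_siblings siblings_def)
            then show ?thesis using \<Delta>[of "fst h'"] h'HE by (auto simp: half_edges_def)
          qed
          ultimately have "far x y r ?R ?H \<le> c * ?\<rho> ^ t * exp (- \<theta> * card (star ?H ?U)) + g (card B)"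
            by (intro bound) simp
          also have "exp (- \<theta> * card (star ?H ?U)) \<le> exp (- \<theta> * (real (card A) - 1)) * w h'"
          proof -
            have "exp (- \<theta> * (real (d (fst h')) - 1)) \<le> w h'"
              using nA theta degree_pos_if_half_edge[OF h'HE] by (auto simp: w_def X_def)
            then have "exp (- \<theta> * (real (card A) - 1)) * exp (- \<theta> * (real (d (fst h')) - 1))
                \<le> exp (- \<theta> * (real (card A) - 1)) * w h'" by simp
            then show ?thesis unfolding cA' by (simp add: algebra_simps flip: exp_add)
          qed
          then have "c * ?\<rho> ^ t * exp (- \<theta> * card (star ?H ?U)) \<le> C * w h'"
            unfolding C_def mult.assoc using c by (intro mult_left_mono) auto
          finally show ?thesis by simp
        qed
      qed
    qed
    also have "C * exp (- \<theta> * \<mu>) = c * ?\<rho> ^ Suc t * exp (- \<theta> * card A)"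
    proof -
      have "exp (- \<theta> * (real (card A) - 1)) * exp (- \<theta> * \<mu>) = ?\<rho> * exp (- \<theta> * card A)"
        by (simp add: algebra_simps flip: exp_add)
      then show ?thesis by (simp add: C_def mult_ac)
    qed
    finally show ?thesis by (simp add: A_def B_def)
  qed
qed

lemma card_star_singleton: "v \<in> {1..n} \<Longrightarrow> card (star HE {v}) = d v"
proof -
  assume "v \<in> {1..n}"
  then have "star HE {v} = {v} \<times> {..<d v}" by (auto simp: star_def half_edges_def)
  then show ?thesis by simp
qed

lemma clusters_init:
  assumes "even (card HE)" "x \<noteq> y"
  shows "clusters x y 0 0 {} HE {x} {y}"
  using assms by (auto simp: clusters_def walk_within_refl)

lemma card_explored_init_le:
  assumes "x \<in> {1..n}" "y \<in> {1..n}" "d x \<le> \<Delta>" "d y \<le> \<Delta>"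
  shows "card (explored HE (star HE {x}) (star HE {y})) \<le> 2 * \<Delta>"
proof -
  have "explored HE (star HE {x}) (star HE {y}) \<subseteq> star HE {x} \<union> star HE {y}"
    by (auto simp: explored_def)
  then have "card (explored HE (star HE {x}) (star HE {y})) \<le> card (star HE {x} \<union> star HE {y})"
    using finite_HE by (intro card_mono) (auto simp: star_def)
  also have "\<dots> \<le> d x + d y"
    using card_Un_le[of "star HE {x}" "star HE {y}"] card_star_singleton assms by simp
  finally show ?thesis using assms by simp
qed

text \<open>
  The order of the exploration is: cluster of \<open>y\<close>, cluster of \<open>x\<close>, front of \<open>x\<close>, front of \<open>y\<close>, collision. As bounds
  are propagated backwards, the facts below appear in the reverse order.
\<close>

lemma far_le:
  fixes L :: real
  assumes L: "L > 0" and xy: "x \<in> {1..n}" "y \<in> {1..n}" "x \<noteq> y" and ev: "even (card HE)"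
    and \<Delta>: "\<And>v. v \<in> {1..n} \<Longrightarrow> d v \<le> \<Delta>" and r: "2 * (T + k) + 1 \<le> r"
    and D: "2 * (real T + 1) * real \<Delta> + 2 * real k * real K * L \<le> \<delta> * card HE"
  shows "far x y r {} HE \<le>
    2 * exp 1 * exp (- rate k L * (\<mu> - 1)) ^ T + exp (- (L\<^sup>2 / (2 * card HE)))"
proof -
  let ?\<rho> = "exp (- rate k L * (\<mu> - 1)) ^ T" and ?\<eta> = "exp (- (L\<^sup>2 / (2 * card HE)))"
  define D1 where "D1 = \<delta> * card HE - 2 * real k * real K * L"
  define D2 where "D2 = D1 - real T * real \<Delta>"
  have "real k * real K * L \<ge> 0" using L by simp
  then have D1: "D1 \<le> \<delta> * card HE" unfolding D1_def by linarith
  moreover have "real T * real \<Delta> \<ge> 0" by simp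
  ultimately have D2: "D2 \<le> \<delta> * card HE" unfolding D2_def by linarith
  have rt: "0 < rate k L" "rate k L \<le> \<theta>\<^sub>0" using rate_pos[OF L] by (auto simp: rate_def)
  have base: "far x y r R H \<le> exp 1 * exp (- rate k L * card (star H U)) +
      (exp 1 * exp (- rate k L * card (star H V)) + ?\<eta>)"
    if cl: "clusters x y T T R H U V" and "real (card (explored H (star H U) (star H V))) \<le> D1"
    for R H U V
  proof -
    note fr = clusters_fronts[OF cl]
    have "far x y r R H \<le> apart x y r R H" by (rule far_le_apart[OF fronts_finite(1)[OF fr]])
    also have "\<dots> \<le> exp 1 * exp (- rate k L * card (star H U)) +
      (exp 1 * exp (- rate k L * card (star H V)) + ?\<eta>)"
      by (rule apart_two_fronts[OF L fr, of k "T + k" "T + k"]) (use that r D1_def in auto)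
    finally show ?thesis .
  qed
  have one: "far x y r R H \<le> exp 1 * ?\<rho> * exp (- rate k L * card (star H U)) +
      (exp 1 * exp (- rate k L * card (star H V)) + ?\<eta>)"
    if cl: "clusters x y 0 T R H U V" and "real (card (explored H (star H U) (star H V))) \<le> D2"
    for R H U V
  proof (rule far_explore_cluster[OF rt, where I = T and j = T and i = 0 and D = D1 and \<Delta> = \<Delta> and V = V
        and g = "\<lambda>b. exp 1 * exp (- rate k L * b) + ?\<eta>"])
    show "real (card (explored H (star H U) (star H V))) + real T * real \<Delta> \<le> D1"
      using that(2) by (simp add: D2_def)
  qed (use cl base D1 r \<Delta> in auto)
  have "far y x r {} HE \<le> exp 1 * ?\<rho> * exp (- rate k L * card (star HE {y})) +
      (exp 1 * ?\<rho> * exp (- rate k L * card (star HE {x})) + ?\<eta>)"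
  proof (rule far_explore_cluster[OF rt, where I = T and j = 0 and i = 0 and D = D2 and \<Delta> = \<Delta> and V = "{x}"
        and g = "\<lambda>b. exp 1 * ?\<rho> * exp (- rate k L * b) + ?\<eta>"])
    show "clusters y x 0 0 {} HE {y} {x}" using xy by (intro clusters_init[OF ev]) auto
    show "real (card (explored HE (star HE {y}) (star HE {x}))) + real T * real \<Delta> \<le> D2"
    proof -
      have "real (card (explored HE (star HE {y}) (star HE {x}))) \<le> 2 * real \<Delta>"
        using of_nat_mono[OF card_explored_init_le[of y x \<Delta>], where 'a = real] xy \<Delta> by simp
      then show ?thesis using D by (simp add: D1_def D2_def algebra_simps)
    qed
    show "far y x r R H \<le> exp 1 * exp (- rate k L * card (star H U)) +
        (exp 1 * ?\<rho> * exp (- rate k L * card (star H {x})) + ?\<eta>)"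
      if "clusters y x T 0 R H U {x}" "real (card (explored H (star H U) (star H {x}))) \<le> D2" for R H U
      using one[of R H "{x}" U] that clusters_commute[of y x] explored_commute[of H "star H U"]
        far_commute[of x y] by simp
  qed (use D2 r \<Delta> in auto)
  moreover have "exp 1 * ?\<rho> * exp (- rate k L * real m) \<le> exp 1 * ?\<rho> * 1" for m :: nat
    using rt by (intro mult_left_mono) auto
  ultimately have "far y x r {} HE \<le> exp 1 * ?\<rho> * 1 + (exp 1 * ?\<rho> * 1 + ?\<eta>)"
    by (smt (verit, best))
  then show ?thesis using far_commute[of x y] by simp
qed

section \<open>Connection has positive probability\<close>

text \<open>
  With probability at least \<open>(\<mu> - 1) / K\<close>, a step leads to a fresh vertex of degree at least 3 and enlarges the front
  by at least one half-edge.
\<close>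

lemma apart_growth:
  fixes q D :: real
  assumes q: "q \<ge> 0" and r: "I + j + 1 \<le> r" and D: "D \<le> \<delta> * card HE"
    and big: "\<And>R H A. fronts x y I j R H A B \<Longrightarrow> card A \<ge> m \<Longrightarrow>
      real (card (explored H A B)) \<le> D \<Longrightarrow> apart x y r R H \<le> 1 - q"
  shows "fronts x y i j R H A B \<Longrightarrow> i + t = I \<Longrightarrow> card A \<ge> 1 \<Longrightarrow> card A + t \<ge> m \<Longrightarrow>
    real (card (explored H A B)) + real t * real K \<le> D \<Longrightarrow>
    apart x y r R H \<le> 1 - ((\<mu> - 1) / K) ^ t * q"
proof (induction t arbitrary: i R H A)
  case 0
  then show ?case using big[of R H A] by simp
next
  case (Suc t)
  note fr = Suc.prems(1)
  note fin = fronts_finite[OF fr]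
  define p where "p = (\<mu> - 1) / K"
  define F where "F = H - A - B"
  let ?Z = "{h \<in> F. fresh F h \<and> d (fst h) \<ge> 3}"
  have "A \<noteq> {}" using Suc.prems(3) by auto
  then obtain h where h: "h \<in> A" by blast
  then have hH: "h \<in> H" "h \<notin> B" using fr by (auto simp: fronts_def)
  have p: "p \<ge> 0" using mu_gt_1 by (simp add: p_def)
  have HHE: "H \<subseteq> HE" and FHE: "F \<subseteq> HE" using fr by (auto simp: F_def fronts_def)
  have dam: "real (card (explored H A B)) + real t * real K + real K \<le> D"
    using Suc.prems(5) by (simp add: algebra_simps)
  have "apart x y r R H \<le> (p ^ t * q) * (1 - p) + (1 - p ^ t * q)"
  proof (rule apart_step_le[OF fin(1) _ hH(1), where w = "\<lambda>h'. if h' \<in> ?Z then 0 else 1"])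
    show "even (card H)" using fr by (simp add: fronts_def)
    have "real t * real K \<ge> 0" by simp
    then have "real (card (HE - F)) \<le> \<delta> * card HE"
      using dam D unfolding explored_def F_def[symmetric] by linarith
    then have "(\<mu> - 1) * card HE \<le> K * card ?Z" by (rule card_fresh_branching_ge[OF FHE])
    then have pZ: "p * card HE \<le> card ?Z" using K_pos by (simp add: p_def field_simps)
    have ZH: "?Z \<subseteq> H - {h}" using h by (auto simp: F_def)
    have "(\<Sum>h' \<in> H - {h}. if h' \<in> ?Z then 0 else (1::real)) = card ((H - {h}) - ?Z)"
      using fin by (simp add: sum.If_cases Diff_eq Compl_eq)
    also have "\<dots> = real (card (H - {h})) - card ?Z"
      using ZH fin finite_subset[OF ZH] by (subst card_Diff_subset) (auto simp: of_nat_diff card_mono)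
    also have "\<dots> \<le> (real (card H) - 1) * (1 - p)"
    proof -
      have "real (card (H - {h})) = real (card H) - 1" using hH fin by (intro real_card_remove)
      moreover have "real (card H) - 1 \<le> card HE"
        using of_nat_mono[OF card_mono[OF finite_HE HHE], where 'a = real] by linarith
      then have "(real (card H) - 1) * p \<le> p * card HE" using p by (simp add: mult.commute mult_left_mono)
      ultimately show ?thesis using pZ by (simp add: algebra_simps)
    qed
    finally show "(\<Sum>h' \<in> H - {h}. if h' \<in> ?Z then 0 else 1) \<le> (real (card H) - 1) * (1 - p)" .
  next
    fix h' assume h': "h' \<in> H - {h}"
    let ?R = "insert {h, h'} R" and ?H = "H - {h, h'}"
    show "apart x y r ?R ?H \<le> p ^ t * q * (if h' \<in> ?Z then 0 else 1) + (1 - p ^ t * q)"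
    proof (cases "h' \<in> ?Z")
      case False
      have "apart x y r ?R ?H \<le> p ^ t * q * 1 + (1 - p ^ t * q)"
        using apart_le_1[of ?H] fin by simp
      then show ?thesis unfolding if_not_P[OF False] .
    next
      case True
      then have h'HE: "h' \<in> HE" using FHE by blast
      have h'n: "h' \<notin> A" "h' \<notin> B" using True by (auto simp: F_def)
      have sib: "siblings h' \<subseteq> F - {h'}" using True by (auto simp: fresh_def siblings_def)
      let ?A = "(A - {h}) \<union> siblings h'"
      have eqs: "A - {h, h'} = A - {h}" "B - {h, h'} = B" using hH h'n by auto
      have "fronts x y (i + 1) j ?R ?H (A - {h}) B"
        using fronts_mono[OF fronts_pair[OF fr hH(1) h'], of "i + 1" j] by (simp add: eqs)
      then have fr': "fronts x y (i + 1) j ?R ?H ?A B"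
      proof (rule fronts_add)
        show "walk_within ?R (i + 1) x (fst s)" if "s \<in> siblings h'" for s
        proof -
          have "fst s = fst h'" using that by (auto simp: siblings_def)
          moreover have "walk_within ?R (i + 1) x (fst h')"
            using fr h by (intro walk_within_extend) (auto simp: fronts_def)
          ultimately show ?thesis by simp
        qed
      qed (use sib h in \<open>auto simp: F_def\<close>)
      have "card ?A = card (A - {h}) + card (siblings h')"
        using fin sib by (intro card_Un_disjoint) (auto simp: F_def finite_siblings)
      moreover have "card (A - {h}) = card A - 1" using h by simp
      moreover have "d (fst h') \<ge> 3" using True by simp
      ultimately have cA: "card ?A \<ge> card A + 1"
        using card_siblings[OF h'HE] Suc.prems(3) by arith
      have "card (explored ?H ?A B) \<le> card (explored H A B) + card (insert h' (siblings h'))"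
        using h by (intro card_explored_pair_le) (auto simp: finite_siblings)
      moreover have "card (insert h' (siblings h')) \<le> K"
        using card_siblings[OF h'HE] degree_pos_if_half_edge[OF h'HE] True
        by (subst card_insert_disjoint) (auto simp: finite_siblings siblings_def fresh_def)
      ultimately have "real (card (explored ?H ?A B)) + real t * real K \<le> D" using dam by linarith
      then have "apart x y r ?R ?H \<le> 1 - p ^ t * q"
        unfolding p_def using Suc.prems cA by (intro Suc.IH[OF fr']) auto
      then show ?thesis using True by simp
    qed
  qed (use p q in auto)
  then show ?case by (simp add: p_def algebra_simps)
qed

text \<open>
  After \<open>t\<close> such steps from either side, both fronts have at least \<open>t\<close> half-edges. For a large constant \<open>t\<close> the
  bound of \<open>apart_two_fronts\<close> is then below \<open>1 - q\<close>.
\<close>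

lemma apart_le_uniform:
  fixes L q :: real
  assumes L: "L > 0" and xy: "x \<in> {1..n}" "y \<in> {1..n}" "x \<noteq> y" "d x \<ge> 1" "d y \<ge> 1"
    and ev: "even (card HE)" and \<Delta>: "d x \<le> \<Delta>" "d y \<le> \<Delta>" and r: "2 * (t + k) + 1 \<le> r"
    and D: "2 * real \<Delta> + 2 * real t * real K + 2 * real k * real K * L \<le> \<delta> * card HE"
    and q: "q \<ge> 0"
      "2 * exp 1 * exp (- rate k L * real t) + exp (- (L\<^sup>2 / (2 * card HE))) \<le> 1 - q"
  shows "apart x y r {} HE \<le> 1 - ((\<mu> - 1) / K) ^ t * (((\<mu> - 1) / K) ^ t * q)"
proof -
  let ?\<eta> = "exp (- (L\<^sup>2 / (2 * card HE)))"
  define D1 where "D1 = \<delta> * card HE - 2 * real k * real K * L"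
  define D2 where "D2 = D1 - real t * real K"
  have "real k * real K * L \<ge> 0" using L by simp
  then have D1: "D1 \<le> \<delta> * card HE" unfolding D1_def by linarith
  moreover have "real t * real K \<ge> 0" by simp
  ultimately have D2: "D2 \<le> \<delta> * card HE" unfolding D2_def by linarith
  have rt: "0 < rate k L" using rate_pos[OF L] .
  have base: "apart x y r R H \<le> 1 - q"
    if fr: "fronts x y t t R H A B" and AB: "card A \<ge> t" "card B \<ge> t"
      and dam: "real (card (explored H A B)) \<le> D1" for R H A B
  proof -
    have two: "apart x y r R H \<le> exp 1 * exp (- rate k L * card A) +
        (exp 1 * exp (- rate k L * card B) + ?\<eta>)"
      by (rule apart_two_fronts[OF L fr, of k "t + k" "t + k"]) (use dam r D1_def in auto)
    have "exp 1 * exp (- rate k L * real m) \<le> exp 1 * exp (- rate k L * real t)"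
      if "m \<ge> t" for m
      using rt that by simp
    from this[OF AB(1)] this[OF AB(2)] two show ?thesis using q(2) by linarith
  qed
  have one: "apart x y r R H \<le> 1 - ((\<mu> - 1) / K) ^ t * q"
    if fr: "fronts x y 0 t R H A B" and AB: "card A \<ge> 1" "card B \<ge> t"
      and dam: "real (card (explored H A B)) \<le> D2" for R H A B
    by (rule apart_growth[OF q(1), where I = t and i = 0 and j = t and D = D1 and m = t])
      (use base that r D1 D2_def in auto)
  have fr0: "fronts x y 0 0 {} HE (star HE {x}) (star HE {y})"
    by (rule clusters_fronts[OF clusters_init[OF ev xy(3)]])
  have "apart y x r {} HE \<le> 1 - ((\<mu> - 1) / K) ^ t * (((\<mu> - 1) / K) ^ t * q)"
  proof (rule apart_growth[where I = t and i = 0 and j = 0 and D = D2 and m = t])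
    show "fronts y x 0 0 {} HE (star HE {y}) (star HE {x})" using fr0 fronts_commute by blast
    show "real (card (explored HE (star HE {y}) (star HE {x}))) + real t * real K \<le> D2"
    proof -
      have "real (card (explored HE (star HE {y}) (star HE {x}))) \<le> 2 * real \<Delta>"
        using of_nat_mono[OF card_explored_init_le[of y x \<Delta>], where 'a = real] xy \<Delta> by simp
      then show ?thesis using D by (simp add: D1_def D2_def algebra_simps)
    qed
    show "apart y x r R H \<le> 1 - ((\<mu> - 1) / K) ^ t * q"
      if "fronts y x t 0 R H A (star HE {x})" "t \<le> card A"
        "real (card (explored H A (star HE {x}))) \<le> D2" for R H A
    proof -
      have "fronts x y 0 t R H (star HE {x}) A" using that(1) fronts_commute by blast
      moreover have "card (star HE {x}) \<ge> 1" using card_star_singleton[OF xy(1)] xy by simp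
      ultimately have "apart x y r R H \<le> 1 - ((\<mu> - 1) / K) ^ t * q"
        using one that(2,3) unfolding explored_commute[of H A] by blast
      then show ?thesis by (subst apart_commute)
    qed
    show "0 \<le> ((\<mu> - 1) / K) ^ t * q" using q mu_gt_1 by simp
  qed (use D2 r xy card_star_singleton in auto)
  then show ?thesis by (subst apart_commute)
qed

end

section \<open>The expected number of short trails\<close>

text \<open>
  Reachability of \<open>w\<close> by a walk that starts with the half-edge \<open>g\<close> and uses no pair twice. Deleting the pair used
  last makes the recursion match that of \<open>match_prob_step\<close>: the rest of the trail lives in the rest of the matching.
\<close>

fun trail_within :: "('v \<times> 'k) set set \<Rightarrow> nat \<Rightarrow> 'v \<times> 'k \<Rightarrow> 'v \<Rightarrow> bool" where
  "trail_within P 0 g w \<longleftrightarrow> False"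
| "trail_within P (Suc j) g w \<longleftrightarrow> (\<exists>h'. {g, h'} \<in> P \<and>
     (fst h' = w \<or> (\<exists>g'. fst g' = fst h' \<and> trail_within (P - {{g, h'}}) j g' w)))"

lemma trail_within_mono: "trail_within P j g w \<Longrightarrow> P \<subseteq> Q \<Longrightarrow> trail_within Q j g w"
proof (induction j arbitrary: P Q g)
  case (Suc j)
  then obtain h' where h': "{g, h'} \<in> P"
    "fst h' = w \<or> (\<exists>g'. fst g' = fst h' \<and> trail_within (P - {{g, h'}}) j g' w)"
    unfolding trail_within.simps by blast
  moreover have "P - {{g, h'}} \<subseteq> Q - {{g, h'}}" using Suc.prems by blast
  ultimately have "fst h' = w \<or> (\<exists>g'. fst g' = fst h' \<and> trail_within (Q - {{g, h'}}) j g' w)"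
    using Suc.IH by blast
  then show ?case unfolding trail_within.simps using h'(1) Suc.prems(2) by blast
qed simp

lemma trail_within_start: "trail_within P j g w \<Longrightarrow> g \<in> \<Union>P"
  by (cases j) auto

text \<open>
  If the walk visits \<open>u\<close>, its part after the last visit is a walk from \<open>u\<close> that is not longer.
\<close>

lemma relpow_adj_avoid_or_revisit:
  assumes "(v, w) \<in> adj P ^^ j"
  shows "(v, w) \<in> adj {e \<in> P. \<forall>h\<in>e. fst h \<noteq> u} ^^ j \<or> (\<exists>i\<le>j. (u, w) \<in> adj P ^^ i)"
  using assms
proof (induction j arbitrary: v)
  case (Suc j)
  obtain v' where v': "(v, v') \<in> adj P" "(v', w) \<in> adj P ^^ j"
    using relpow_Suc_D2[OF Suc.prems] by blast
  show ?case
  proof (cases "u = v \<or> u = v' \<or> (\<exists>i\<le>j. (u, w) \<in> adj P ^^ i)")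
    case True
    then show ?thesis using v'(2) Suc.prems by (metis le_Suc_eq order_refl)
  next
    case False
    then have "(v', w) \<in> adj {e \<in> P. \<forall>h\<in>e. fst h \<noteq> u} ^^ j" using Suc.IH[OF v'(2)] by blast
    moreover have "(v, v') \<in> adj {e \<in> P. \<forall>h\<in>e. fst h \<noteq> u}"
      using v'(1) False by (auto simp: adj_def)
    ultimately show ?thesis using relpow_Suc_I2 by fast
  qed
qed simp

text \<open>
  A shortest walk from \<open>u\<close> never returns to \<open>u\<close>, so after its first step it avoids all pairs at \<open>u\<close>, in particular the
  pair just used.
\<close>

lemma walk_within_imp_trail_within:
  "walk_within P k u w \<Longrightarrow> u \<noteq> w \<Longrightarrow> \<exists>g. fst g = u \<and> trail_within P k g w"
proof (induction k arbitrary: P u)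
  case 0
  then show ?case by (simp add: walk_within_def)
next
  case (Suc k)
  define j where "j = (LEAST j. (u, w) \<in> adj P ^^ j)"
  obtain j' where j': "j' \<le> Suc k" "(u, w) \<in> adj P ^^ j'"
    using Suc.prems(1) by (auto simp: walk_within_def)
  have j: "(u, w) \<in> adj P ^^ j" "j \<le> Suc k"
    unfolding j_def using j' by (auto intro: LeastI order_trans[OF Least_le])
  have "j \<noteq> 0" using j(1) Suc.prems(2) by (cases j) auto
  then obtain m where m: "j = Suc m" by (cases j) auto
  obtain v where v: "(u, v) \<in> adj P" "(v, w) \<in> adj P ^^ m"
    using j(1) unfolding m by (meson relpow_Suc_D2)
  let ?Q = "{e \<in> P. \<forall>h\<in>e. fst h \<noteq> u}"
  obtain a b where e: "{(u, a), (v, b)} \<in> P" using v(1) by (auto simp: adj_def)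
  have "\<not> (\<exists>i\<le>m. (u, w) \<in> adj P ^^ i)"
    using m not_less_Least[of _ "\<lambda>j. (u, w) \<in> adj P ^^ j"] unfolding j_def[symmetric] by auto
  then have "(v, w) \<in> adj ?Q ^^ m" using relpow_adj_avoid_or_revisit[OF v(2)] by blast
  then have vw: "walk_within ?Q k v w" using j(2) m by (auto simp: walk_within_def)
  have "v = w \<or> (\<exists>g'. fst g' = v \<and> trail_within (P - {{(u, a), (v, b)}}) k g' w)"
  proof (cases "v = w")
    case False
    obtain g' where g': "fst g' = v" "trail_within ?Q k g' w" using Suc.IH[OF vw False] by blast
    have "?Q \<subseteq> P - {{(u, a), (v, b)}}" by auto
    from trail_within_mono[OF g'(2) this] show ?thesis using g'(1) by blast
  qed simp
  then have "trail_within P (Suc k) (u, a) w"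
    unfolding trail_within.simps using e by (intro exI[of _ "(v, b)"]) simp
  then show ?case by (intro exI[of _ "(u, a)"]) simp
qed

text \<open>
  The first pair leads to \<open>w\<close> for at most \<open>d w\<close> of the partners. For any other partner the trail continues through one of its
  siblings, so the bound for \<open>j\<close> further steps is multiplied by the average number of siblings, which is at most
  \<open>\<beta>\<close>. The slack \<open>2 * real j\<close> accounts for the two half-edges that each step removes: at every step at least
  \<open>M\<close> possible partners are left.
\<close>

lemma match_prob_trail_le:
  fixes M \<beta> :: real
  assumes M: "M > 0" and S: "(\<Sum>h\<in>half_edges n d. real (d (fst h)) - 1) \<le> \<beta> * M" and lam: "\<beta> \<ge> 0"
  shows "H \<subseteq> half_edges n d \<Longrightarrow> even (card H) \<Longrightarrow> g \<in> H \<Longrightarrow> M + 2 * real j \<le> card H + 1 \<Longrightarrow>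
    match_prob H (\<lambda>P. trail_within P j g w) \<le> d w / M * (\<Sum>i<j. \<beta> ^ i)"
proof (induction j arbitrary: H g)
  case 0
  then show ?case by (simp add: match_prob_eq_0)
next
  case (Suc j)
  define Q where "Q = d w / M * (\<Sum>i<j. \<beta> ^ i)"
  have Q: "Q \<ge> 0" unfolding Q_def using M lam by (intro mult_nonneg_nonneg sum_nonneg) auto
  have fin: "finite H" by (rule finite_subset[OF Suc.prems(1) finite_half_edges])
  have cH: "M \<le> real (card H) - 1" using Suc.prems(4) by simp
  let ?E = "\<lambda>h'. \<lambda>P. trail_within (insert {g, h'} P) (Suc j) g w"
  have step: "match_prob (H - {g, h'}) (?E h')
      \<le> (if fst h' = w then 1 else 0) + (real (d (fst h')) - 1) * Q" if h': "h' \<in> H - {g}" for h'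
  proof -
    have h'd: "snd h' < d (fst h')" using h' Suc.prems(1) by (auto simp: half_edges_def)
    let ?H = "H - {g, h'}" and ?sib = "{fst h'} \<times> {..<d (fst h')} - {h'}"
    let ?I = "?sib \<inter> ?H"
    have "card ?sib = d (fst h') - 1"
      using h'd by (subst card_Diff_subset) (auto simp: mem_Times_iff)
    moreover have "card ?I \<le> card ?sib" by (intro card_mono) auto
    ultimately have cI: "real (card ?I) \<le> real (d (fst h')) - 1" using h'd by linarith
    have Qbound: "match_prob ?H (\<lambda>P. trail_within P j g' w) \<le> Q" if g': "g' \<in> ?H" for g'
      unfolding Q_def
    proof (rule Suc.IH[OF _ _ g'])
      have c: "card ?H = card H - 2" "card H \<ge> 2"
        using h' Suc.prems(3) fin card_mono[of H "{g, h'}"] by (auto simp: card_Diff_subset)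
      then show "even (card ?H)" "M + 2 * real j \<le> card ?H + 1"
        using Suc.prems(2,4) by (auto simp: of_nat_diff)
    qed (use Suc.prems(1) in auto)
    have continue: "fst h' = w \<or> (\<exists>g'\<in>?I. trail_within P j g' w)"
      if P: "P \<in> perfect_matchings ?H" and t: "?E h' P" for P
    proof -
      obtain h'' where h'': "{g, h''} \<in> insert {g, h'} P"
        "fst h'' = w \<or> (\<exists>g'. fst g' = fst h'' \<and> trail_within (insert {g, h'} P - {{g, h''}}) j g' w)"
        using t unfolding trail_within.simps by blast
      have gP: "{g, z} \<notin> P" for z using perfect_matchings_elem_subset[OF P, of "{g, z}"] by auto
      then have "h'' = h'" using h''(1) by (auto simp: doubleton_eq_iff)
      then have "fst h' = w \<or> (\<exists>g'. fst g' = fst h' \<and> trail_within P j g' w)"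
        using h''(2) gP by simp
      moreover have "g' \<in> ?I" if "fst g' = fst h'" "trail_within P j g' w" for g'
      proof -
        have "g' \<in> ?H" using trail_within_start[OF that(2)] perfect_matchings_elem_subset[OF P] by blast
        moreover from this have "snd g' < d (fst g')" using Suc.prems(1) by (auto simp: half_edges_def)
        ultimately show ?thesis using that(1) by (auto simp: mem_Times_iff)
      qed
      ultimately show ?thesis by blast
    qed
    have "match_prob ?H (?E h') \<le>
        (if fst h' = w then 1 else match_prob ?H (\<lambda>P. \<exists>g'\<in>?I. trail_within P j g' w))"
    proof (cases "fst h' = w")
      case True
      then show ?thesis using match_prob_le_1[of ?H] fin by simp
    next
      case False
      have "match_prob ?H (?E h') \<le> match_prob ?H (\<lambda>P. \<exists>g'\<in>?I. trail_within P j g' w)"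
        using fin continue False by (intro match_prob_mono) blast+
      then show ?thesis unfolding if_not_P[OF False] .
    qed
    also have "\<dots> \<le> (if fst h' = w then 1 else 0) + real (card ?I) * Q"
    proof (cases "fst h' = w")
      case False
      have "match_prob ?H (\<lambda>P. \<exists>g'\<in>?I. trail_within P j g' w) \<le>
          (\<Sum>g'\<in>?I. match_prob ?H (\<lambda>P. trail_within P j g' w))"
        using fin by (intro match_prob_union_bound) auto
      also have "\<dots> \<le> real (card ?I) * Q" using Qbound by (intro sum_bounded_above) auto
      finally show ?thesis using False by simp
    qed (use Q in simp)
    also have "real (card ?I) * Q \<le> (real (d (fst h')) - 1) * Q" using cI Q by (rule mult_right_mono)
    finally show ?thesis by simp
  qed
  have "(\<Sum>h' \<in> H - {g}. match_prob (H - {g, h'}) (?E h')) \<le>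
      (\<Sum>h' \<in> H - {g}. (if fst h' = w then 1 else 0) + (real (d (fst h')) - 1) * Q)"
    by (intro sum_mono step)
  also have "\<dots> \<le> (\<Sum>h' \<in> half_edges n d. (if fst h' = w then 1 else 0) + (real (d (fst h')) - 1) * Q)"
    using Suc.prems(1) Q finite_half_edges
    by (intro sum_mono2) (auto simp: half_edges_def)
  also have "\<dots> = card {h' \<in> half_edges n d. fst h' = w} + (\<Sum>h\<in>half_edges n d. real (d (fst h)) - 1) * Q"
    using finite_half_edges[of n d]
    by (simp add: sum.distrib sum_distrib_right sum.If_cases Int_def)
  also have "\<dots> \<le> d w + \<beta> * M * Q"
  proof (intro add_mono mult_right_mono S Q)
    have "{h' \<in> half_edges n d. fst h' = w} \<subseteq> {w} \<times> {..<d w}" by (auto simp: half_edges_def)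
    from card_mono[OF _ this] show "real (card {h' \<in> half_edges n d. fst h' = w}) \<le> d w" by simp
  qed
  finally have "match_prob H (\<lambda>P. trail_within P (Suc j) g w) \<le> (d w + \<beta> * M * Q) / (card H - 1)"
    unfolding match_prob_step[OF fin Suc.prems(2,3)] using cH M by (intro divide_right_mono) auto
  also have "\<dots> \<le> (d w + \<beta> * M * Q) / M"
  proof (rule divide_left_mono)
    show "M \<le> real (card H - 1)" using cH M by linarith
    then show "0 < real (card H - 1) * M" using M by simp
  qed (use M lam Q in simp)
  also have "\<dots> = d w / M + \<beta> * Q" using M by (simp add: add_divide_distrib)
  also have "\<dots> = d w / M * (\<Sum>i<Suc j. \<beta> ^ i)"
  proof -
    have "(\<Sum>i<Suc j. \<beta> ^ i) = 1 + \<beta> * (\<Sum>i<j. \<beta> ^ i)"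
      by (simp add: sum.lessThan_Suc_shift sum_distrib_left del: sum.lessThan_Suc)
    then show ?thesis by (simp add: Q_def algebra_simps)
  qed
  finally show ?case .
qed

lemma match_prob_walk_le:
  fixes M \<beta> :: real
  assumes M: "M > 0" "M + 2 * real k \<le> card (half_edges n d) + 1"
    and S: "(\<Sum>h\<in>half_edges n d. real (d (fst h)) - 1) \<le> \<beta> * M" and lam: "\<beta> \<ge> 0"
    and ev: "even (card (half_edges n d))" and u: "u \<noteq> w"
  shows "match_prob (half_edges n d) (\<lambda>P. walk_within P k u w)
    \<le> d u * d w / M * (\<Sum>i<k. \<beta> ^ i)"
proof -
  let ?H = "half_edges n d"
  let ?G = "{g \<in> ?H. fst g = u}"
  have "match_prob ?H (\<lambda>P. walk_within P k u w) \<le>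
      match_prob ?H (\<lambda>P. \<exists>g\<in>?G. trail_within P k g w)"
  proof (rule match_prob_mono[OF finite_half_edges])
    fix P assume P: "P \<in> perfect_matchings ?H" and wk: "walk_within P k u w"
    obtain g where g: "fst g = u" "trail_within P k g w"
      using walk_within_imp_trail_within[OF wk u] by blast
    then have "g \<in> ?H"
      using trail_within_start[OF g(2)] perfect_matchings_elem_subset[OF P] by blast
    then show "\<exists>g\<in>?G. trail_within P k g w" using g by blast
  qed
  also have "\<dots> \<le> (\<Sum>g\<in>?G. match_prob ?H (\<lambda>P. trail_within P k g w))"
    by (rule match_prob_union_bound) (simp add: finite_half_edges)
  also have "\<dots> \<le> card ?G * (d w / M * (\<Sum>i<k. \<beta> ^ i))"
  proof (rule sum_bounded_above)
    fix g assume "g \<in> ?G"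
    then show "match_prob ?H (\<lambda>P. trail_within P k g w) \<le> d w / M * (\<Sum>i<k. \<beta> ^ i)"
      using M(2) by (intro match_prob_trail_le[OF M(1) S lam order_refl ev]) simp_all
  qed
  also have "\<dots> \<le> d u * (d w / M * (\<Sum>i<k. \<beta> ^ i))"
  proof (rule mult_right_mono)
    have "?G \<subseteq> {u} \<times> {..<d u}" by (auto simp: half_edges_def)
    from card_mono[OF _ this] show "real (card ?G) \<le> d u" by simp
    show "0 \<le> d w / M * (\<Sum>i<k. \<beta> ^ i)"
      using M lam by (intro mult_nonneg_nonneg sum_nonneg) auto
  qed
  finally show ?thesis by simp
qed

section \<open>Distances in the configuration model\<close>

lemma awalk_pairing_graph_iff:
  assumes P: "P \<in> perfect_matchings (half_edges n d)" and u: "u \<in> {1..n}"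
  shows "(\<exists>p. pre_digraph.awalk (pairing_graph n P) u p v \<and> length p = j) \<longleftrightarrow> (u, v) \<in> adj P ^^ j"
proof -
  interpret wf_digraph "pairing_graph n P" by (rule wf_pairing_graph[OF P])
  have vert: "fst h' \<in> {1..n}" if "{h, h'} \<in> P" for h h'
    using perfect_matchings_elem_subset[OF P that] by (auto simp: half_edges_def)
  have G: "verts (pairing_graph n P) = {1..n}" "arcs (pairing_graph n P) = {(h, h'). {h, h'} \<in> P}"
    "tail (pairing_graph n P) = (\<lambda>a. fst (fst a))" "head (pairing_graph n P) = (\<lambda>a. fst (snd a))"
    by (simp_all add: pairing_graph_def)
  show ?thesis
    using u
  proof (induction j arbitrary: u)
    case 0
    then show ?case by (auto simp: awalk_Nil_iff G)
  next
    case (Suc j)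
    show ?case
    proof
      assume "\<exists>p. awalk u p v \<and> length p = Suc j"
      then obtain a p where "awalk u (a # p) v" "length p = j" by (auto simp: length_Suc_conv)
      then have a: "a \<in> arcs (pairing_graph n P)" "u = fst (fst a)" "awalk (fst (snd a)) p v"
        by (auto simp: awalk_Cons_iff G)
      then have e: "{fst a, snd a} \<in> P" by (auto simp: G)
      have "fst (snd a) \<in> {1..n}" by (rule vert[OF e])
      then have "(fst (snd a), v) \<in> adj P ^^ j" using Suc.IH a(3) \<open>length p = j\<close> by blast
      then show "(u, v) \<in> adj P ^^ Suc j" using adj_pairI[OF e] a(2) relpow_Suc_I2 by metis
    next
      assume "(u, v) \<in> adj P ^^ Suc j"
      then obtain z where z: "(u, z) \<in> adj P" "(z, v) \<in> adj P ^^ j" by (meson relpow_Suc_D2)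
      then obtain i k where e: "{(u, i), (z, k)} \<in> P" by (auto simp: adj_def)
      have "z \<in> {1..n}" using vert[OF e] by simp
      then obtain p where p: "awalk z p v" "length p = j" using Suc.IH z(2) by blast
      have "awalk u (((u, i), (z, k)) # p) v"
        using p(1) e by (auto simp: awalk_Cons_iff G)
      then show "\<exists>p. awalk u p v \<and> length p = Suc j" using p(2) by (metis length_Cons)
    qed
  qed
qed

text \<open>
  Every arc has cost 1, so the distance is the infimum of the lengths of walks.
\<close>

lemma graph_dist_pairing_graph:
  assumes P: "P \<in> perfect_matchings (half_edges n d)" and u: "u \<in> {1..n}"
  shows "graph_dist (pairing_graph n P) u v = (INF j\<in>{j. (u, v) \<in> adj P ^^ j}. ereal (real j))"
proof -
  interpret wf_digraph "pairing_graph n P" by (rule wf_pairing_graph[OF P])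
  have cost: "awalk_cost (\<lambda>_. 1) p = real (length p)" for p :: "(half_edge \<times> half_edge) list"
    by (induction p) (auto simp: awalk_cost_def)
  have "(\<lambda>p. ereal (awalk_cost (\<lambda>_. 1) p)) ` {p. awalk u p v} =
      (\<lambda>j. ereal (real j)) ` length ` {p. awalk u p v}"
    by (simp add: cost image_image)
  also have "length ` {p. awalk u p v} = {j. (u, v) \<in> adj P ^^ j}"
    unfolding awalk_pairing_graph_iff[OF P u, symmetric] by blast
  finally show ?thesis unfolding graph_dist_def \<mu>_def by simp
qed

lemma graph_dist_nonneg:
  assumes "P \<in> perfect_matchings (half_edges n d)" "u \<in> {1..n}"
  shows "0 \<le> graph_dist (pairing_graph n P) u v"
  unfolding graph_dist_pairing_graph[OF assms] by (intro INF_greatest) simp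

lemma graph_dist_le_iff:
  assumes "P \<in> perfect_matchings (half_edges n d)" "u \<in> {1..n}"
  shows "graph_dist (pairing_graph n P) u v \<le> ereal (real k) \<longleftrightarrow> walk_within P k u v"
proof
  assume "graph_dist (pairing_graph n P) u v \<le> ereal (real k)"
  then have "(INF j\<in>{j. (u, v) \<in> adj P ^^ j}. ereal (real j)) < ereal (real k + 1)"
    unfolding graph_dist_pairing_graph[OF assms]
    by (rule order.strict_trans1) simp
  then obtain j where "(u, v) \<in> adj P ^^ j" "ereal (real j) < ereal (real k + 1)"
    unfolding INF_less_iff by blast
  then show "walk_within P k u v" unfolding walk_within_def by (intro exI[of _ j]) auto
next
  assume "walk_within P k u v"
  then obtain j where j: "j \<le> k" "(u, v) \<in> adj P ^^ j" by (auto simp: walk_within_def)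
  then have "graph_dist (pairing_graph n P) u v \<le> ereal (real j)"
    unfolding graph_dist_pairing_graph[OF assms] by (intro INF_lower) simp
  also have "\<dots> \<le> ereal (real k)" using j by simp
  finally show "graph_dist (pairing_graph n P) u v \<le> ereal (real k)" .
qed

lemma graph_dist_finite_iff:
  assumes "P \<in> perfect_matchings (half_edges n d)" "u \<in> {1..n}"
  shows "graph_dist (pairing_graph n P) u v < \<infinity> \<longleftrightarrow> (\<exists>m. walk_within P m u v)"
  unfolding graph_dist_pairing_graph[OF assms] INF_less_iff
  by (auto simp: walk_within_def)

lemma pair_pmf_of_set:
  assumes "finite A" "A \<noteq> {}" "finite B" "B \<noteq> {}"
  shows "pair_pmf (pmf_of_set A) (pmf_of_set B) = pmf_of_set (A \<times> B)"
proof (rule pmf_eqI)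
  fix z :: "'a \<times> 'b"
  show "pmf (pair_pmf (pmf_of_set A) (pmf_of_set B)) z = pmf (pmf_of_set (A \<times> B)) z"
    using assms by (cases z) (simp add: pmf_pair indicator_def card_cartesian_product)
qed

lemma prob_configuration_model_uniform:
  assumes n: "n \<ge> 1" and ev: "even (card (half_edges n d))"
  shows "measure_pmf.prob (pair_pmf (configuration_model n d) (pair_pmf (uniform_vertex n) (uniform_vertex n)))
      {(G, x, y). \<phi> G x y} =
    (\<Sum>x\<in>{1..n}. \<Sum>y\<in>{1..n}. match_prob (half_edges n d) (\<lambda>P. \<phi> (pairing_graph n P) x y)) / real n ^ 2"
proof -
  let ?PM = "perfect_matchings (half_edges n d)" and ?V = "{1..n}"
  have fin: "finite ?PM" "?PM \<noteq> {}" "finite ?V" "?V \<noteq> {}"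
    using finite_perfect_matchings[OF finite_half_edges] perfect_matchings_nonempty[OF finite_half_edges ev] n
    by auto
  have eq: "pair_pmf (configuration_model n d) (pair_pmf (uniform_vertex n) (uniform_vertex n)) =
      map_pmf (apfst (pairing_graph n)) (pmf_of_set (?PM \<times> ?V \<times> ?V))"
    unfolding configuration_model_def uniform_vertex_def pair_map_pmf1
    using fin by (simp add: pair_pmf_of_set)
  have "measure_pmf.prob (pair_pmf (configuration_model n d) (pair_pmf (uniform_vertex n) (uniform_vertex n)))
      {(G, x, y). \<phi> G x y} =
      card ((?PM \<times> ?V \<times> ?V) \<inter> {(P, x, y). \<phi> (pairing_graph n P) x y}) / card (?PM \<times> ?V \<times> ?V)"
  proof -
    have "apfst (pairing_graph n) -` {(G, x, y). \<phi> G x y} = {(P, x, y). \<phi> (pairing_graph n P) x y}"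
      by auto
    then show ?thesis
      unfolding eq measure_map_pmf using fin by (subst measure_pmf_of_set) simp_all
  qed
  also have "card ((?PM \<times> ?V \<times> ?V) \<inter> {(P, x, y). \<phi> (pairing_graph n P) x y}) =
      card (SIGMA x:?V. SIGMA y:?V. {P \<in> ?PM. \<phi> (pairing_graph n P) x y})"
    by (rule bij_betw_same_card[of "\<lambda>(P, x, y). (x, y, P)"], rule bij_betwI[where g = "\<lambda>(x, y, P). (P, x, y)"]) auto
  also have "\<dots> = (\<Sum>x\<in>?V. \<Sum>y\<in>?V. card {P \<in> ?PM. \<phi> (pairing_graph n P) x y})"
    using fin by (subst card_SigmaI; (subst card_SigmaI)?) auto
  finally show ?thesis
    by (simp add: match_prob_def card_cartesian_product power2_eq_square flip: sum_divide_distrib)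
qed

section \<open>Asymptotics\<close>

lemma sum_half_edges:
  fixes f :: "nat \<Rightarrow> real"
  shows "(\<Sum>h\<in>half_edges n d. f (fst h)) = (\<Sum>v=1..n. real (d v) * f v)"
proof -
  have "(\<Sum>v=1..n. \<Sum>k<d v. f v) = (\<Sum>(v, k)\<in>half_edges n d. f v)"
    unfolding half_edges_def by (rule sum.Sigma) auto
  then show ?thesis by (simp add: case_prod_beta)
qed

text \<open>
  What the proof needs to know about the degrees, in terms of sums over the vertices: their mean converges to
  \<open>m\<close>, the mean number of ordered pairs of half-edges at a common vertex converges to \<open>\<nu> * m\<close>, and this limit is not
  created by vertices of unbounded degree.
\<close>

locale regular_degrees =
  fixes d :: "nat \<Rightarrow> nat \<Rightarrow> nat" and m \<nu> :: real
  assumes deg_pos: "\<And>n i. i \<in> {1..n} \<Longrightarrow> d n i \<ge> 1"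
    and even_total: "\<And>n. even (\<Sum>i=1..n. d n i)"
    and mean: "(\<lambda>n. (\<Sum>i=1..n. real (d n i)) / n) \<longlonglongrightarrow> m"
    and forward: "(\<lambda>n. (\<Sum>i=1..n. real (d n i) * (real (d n i) - 1)) / n) \<longlonglongrightarrow> \<nu> * m"
    and truncated: "\<And>c. c < \<nu> \<Longrightarrow> \<exists>K\<ge>1. \<forall>\<^sub>F n in sequentially.
      c * (\<Sum>i=1..n. real (d n i))
        \<le> (\<Sum>v | v \<in> {1..n} \<and> d n v \<le> K. real (d n v) * (real (d n v) - 1))"
    and nu_gt_1: "\<nu> > 1"
begin

abbreviation halves :: "nat \<Rightarrow> half_edge set" where "halves n \<equiv> half_edges n (d n)"

abbreviation total :: "nat \<Rightarrow> real" where "total n \<equiv> \<Sum>i=1..n. real (d n i)"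

text \<open>
  The probability of an event that depends on the matching and on two independent uniform vertices.
\<close>

definition avg :: "nat \<Rightarrow> (half_edge set set \<Rightarrow> nat \<Rightarrow> nat \<Rightarrow> bool) \<Rightarrow> real" where
  "avg n \<phi> = (\<Sum>x\<in>{1..n}. \<Sum>y\<in>{1..n}. match_prob (halves n) (\<lambda>P. \<phi> P x y)) / real n ^ 2"

lemma real_card_HE: "real (card (halves n)) = total n"
  by (simp add: card_half_edges)

lemma even_card_HE: "even (card (halves n))"
  using even_total by (simp add: card_half_edges)

lemma total_ge: "total n \<ge> n"
proof -
  have "(\<Sum>i=1..n. 1) \<le> total n" using deg_pos by (intro sum_mono) fastforce
  then show ?thesis by simp
qed

lemma mean_ge_1: "m \<ge> 1"
proof (rule LIMSEQ_le_const[OF mean])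
  have "1 \<le> total n / n" if "n \<ge> 1" for n using total_ge[of n] that by simp
  then show "\<exists>N. \<forall>n\<ge>N. 1 \<le> total n / n" by blast
qed

lemma total_le: "\<forall>\<^sub>F n in sequentially. total n \<le> (m + 1) * n"
proof -
  have "\<forall>\<^sub>F n in sequentially. total n / n < m + 1"
    using mean by (rule order_tendstoD) simp
  then show ?thesis
    using eventually_gt_at_top[of 0] by eventually_elim (simp add: field_simps)
qed

lemma avg_nonneg: "avg n \<phi> \<ge> 0"
  unfolding avg_def by (intro divide_nonneg_nonneg sum_nonneg match_prob_nonneg) simp

lemma avg_mono:
  assumes "\<And>P x y. P \<in> perfect_matchings (halves n) \<Longrightarrow> x \<in> {1..n} \<Longrightarrow> y \<in> {1..n} \<Longrightarrow> \<phi> P x y \<Longrightarrow> \<psi> P x y"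
  shows "avg n \<phi> \<le> avg n \<psi>"
  unfolding avg_def using assms
  by (intro divide_right_mono sum_mono match_prob_mono finite_half_edges) auto

lemma avg_disj_le: "avg n (\<lambda>P x y. \<phi> P x y \<or> \<psi> P x y) \<le> avg n \<phi> + avg n \<psi>"
proof -
  have "match_prob (halves n) (\<lambda>P. \<phi> P x y \<or> \<psi> P x y)
      \<le> match_prob (halves n) (\<lambda>P. \<phi> P x y) + match_prob (halves n) (\<lambda>P. \<psi> P x y)" for x y
    using match_prob_union_bound[of "UNIV :: bool set" "halves n" "\<lambda>b P. if b then \<phi> P x y else \<psi> P x y"]
    by (simp add: UNIV_bool ex_bool_eq disj_commute)
  then show ?thesis
    unfolding avg_def by (simp add: sum_mono divide_right_mono flip: sum.distrib add_divide_distrib)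
qed

text \<open>
  Equal vertices occur with probability \<open>1 / n\<close> and need no estimate.
\<close>

lemma avg_le_off_diagonal:
  assumes n: "n \<ge> 1" and le: "\<And>x y. x \<in> {1..n} \<Longrightarrow> y \<in> {1..n} \<Longrightarrow> x \<noteq> y \<Longrightarrow>
      match_prob (halves n) (\<lambda>P. \<phi> P x y) \<le> b x y" and b: "\<And>x y. b x y \<ge> 0"
  shows "avg n \<phi> \<le> 1 / n + (\<Sum>x\<in>{1..n}. \<Sum>y\<in>{1..n}. b x y) / real n ^ 2"
proof -
  have "(\<Sum>x\<in>{1..n}. \<Sum>y\<in>{1..n}. match_prob (halves n) (\<lambda>P. \<phi> P x y))
      \<le> (\<Sum>x\<in>{1..n}. \<Sum>y\<in>{1..n}. (if x = y then 1 else 0) + b x y)"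
  proof (intro sum_mono)
    fix x y assume "x \<in> {1..n}" "y \<in> {1..n}"
    then show "match_prob (halves n) (\<lambda>P. \<phi> P x y) \<le> (if x = y then 1 else 0) + b x y"
      using le[of x y] b[of x y] match_prob_le_1[OF finite_half_edges[of n "d n"], of "\<lambda>P. \<phi> P x y"]
      by (cases "x = y") auto
  qed
  also have "\<dots> = n + (\<Sum>x\<in>{1..n}. \<Sum>y\<in>{1..n}. b x y)"
    by (simp add: sum.distrib)
  finally have "avg n \<phi> \<le> (n + (\<Sum>x\<in>{1..n}. \<Sum>y\<in>{1..n}. b x y)) / real n ^ 2"
    unfolding avg_def by (intro divide_right_mono) auto
  also have "\<dots> = 1 / n + (\<Sum>x\<in>{1..n}. \<Sum>y\<in>{1..n}. b x y) / real n ^ 2"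
    using n by (simp add: add_divide_distrib power2_eq_square)
  finally show ?thesis .
qed

text \<open>
  Choose \<open>\<beta> > \<nu>\<close> with \<open>c * ln \<beta> < 1\<close>. The bound of \<open>match_prob_walk_le\<close> averages to about
  \<open>k * \<beta> ^ k / n\<close>, which is \<open>n powr (c * ln \<beta> - 1)\<close> up to logarithmic factors.
\<close>

lemma avg_short_walk_tendsto_0:
  assumes c: "c > 0" "c * ln \<nu> < 1"
  shows "(\<lambda>n. avg n (\<lambda>P. walk_within P (nat \<lceil>c * ln n\<rceil>))) \<longlonglongrightarrow> 0"
proof -
  \<comment> \<open>The midpoint of the interval in which \<open>ln \<beta>\<close> must lie.\<close>
  define b where "b = (ln \<nu> + 1 / c) / 2"
  define \<beta> where "\<beta> = exp b"
  have lnnu: "ln \<nu> > 0" using nu_gt_1 by simp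
  have "ln \<nu> < 1 / c" using c by (simp add: field_simps)
  then have b1: "ln \<nu> < b" "b < 1 / c" by (auto simp: b_def)
  then have b: "ln \<nu> < b" "b * c < 1" "b > 0" using c lnnu by (auto simp: field_simps)
  have "exp (ln \<nu>) < \<beta>" unfolding \<beta>_def using b by (simp only: exp_less_mono)
  then have beta: "\<nu> < \<beta>" "\<beta> > 1" using nu_gt_1 by auto
  define k where "k n = nat \<lceil>c * ln (real n)\<rceil>" for n
  define M where "M n = total n + 1 - 2 * real (k n)" for n
  have kle: "\<forall>\<^sub>F n in sequentially. real (k n) \<le> c * ln n + 1"
    using eventually_ge_at_top[of 1]
  proof eventually_elim
    case (elim n)
    then have "c * ln n \<ge> 0" using c by simp
    then show ?case unfolding k_def by linarith
  qed
  have "(\<lambda>n. (c * ln (real n) + 1) / real n) \<longlonglongrightarrow> 0" by real_asymp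
  then have kn: "(\<lambda>n. real (k n) / real n) \<longlonglongrightarrow> 0"
  proof (rule tendsto_sandwich[rotated 2, OF tendsto_const])
    show "\<forall>\<^sub>F n in sequentially. real (k n) / n \<le> (c * ln n + 1) / n"
      using kle by eventually_elim (simp add: divide_right_mono)
  qed simp
  have Mn: "(\<lambda>n. M n / n) \<longlonglongrightarrow> m"
  proof -
    have "(\<lambda>n. total n / n + 1 / n - 2 * (real (k n) / n)) \<longlonglongrightarrow> m + 0 - 2 * 0"
      by (intro tendsto_intros mean kn lim_1_over_n)
    then show ?thesis by (simp add: M_def add_divide_distrib diff_divide_distrib)
  qed
  \<comment> \<open>The limit is \<open>m\<close>, and \<open>1 / 2 < 1 \<le> m\<close>.\<close>
  have ev1: "\<forall>\<^sub>F n in sequentially. M n / n > 1 / 2"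
    using Mn mean_ge_1 by (intro order_tendstoD) auto
  have "(\<lambda>n. \<beta> * (M n / n) - (\<Sum>i=1..n. real (d n i) * (real (d n i) - 1)) / n)
      \<longlonglongrightarrow> \<beta> * m - \<nu> * m"
    by (intro tendsto_intros Mn forward)
  moreover have "\<beta> * m - \<nu> * m > 0" using beta mean_ge_1 by simp
  ultimately have ev2: "\<forall>\<^sub>F n in sequentially.
      \<beta> * (M n / n) - (\<Sum>i=1..n. real (d n i) * (real (d n i) - 1)) / n > 0"
    by (rule order_tendstoD)
  have bound: "\<forall>\<^sub>F n in sequentially. avg n (\<lambda>P. walk_within P (k n)) \<le>
      1 / n + 2 * (m + 1) ^ 2 * ((c * ln n + 1) * (\<beta> * exp (b * c * ln n))) / n"
    using ev1 ev2 kle total_le eventually_ge_at_top[of 1]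
  proof eventually_elim
    case (elim n)
    let ?S = "\<Sum>i<k n. \<beta> ^ i"
    have n: "real n > 0" using elim by simp
    have M: "M n > n / 2" using elim(1) n by (simp add: field_simps)
    then have M0: "M n > 0" using n by linarith
    have S0: "?S \<ge> 0" using beta by (intro sum_nonneg) auto
    have "avg n (\<lambda>P. walk_within P (k n)) \<le> 1 / n +
        (\<Sum>x\<in>{1..n}. \<Sum>y\<in>{1..n}. real (d n x) * real (d n y) / M n * ?S) / real n ^ 2"
    proof (rule avg_le_off_diagonal)
      show "match_prob (halves n) (\<lambda>P. walk_within P (k n) x y) \<le> real (d n x) * real (d n y) / M n * ?S"
        if "x \<noteq> y" for x y
      proof -
        have "(\<Sum>h\<in>halves n. real (d n (fst h)) - 1) \<le> \<beta> * M n"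
          unfolding sum_half_edges[of "\<lambda>v. real (d n v) - 1"] using elim(2) n by (simp add: field_simps)
        then show ?thesis
          using match_prob_walk_le[of "M n" "k n" n "d n" \<beta> x y] M0 beta even_card_HE that
          by (simp add: real_card_HE M_def)
      qed
      show "real (d n x) * real (d n y) / M n * ?S \<ge> 0" for x y
        using M0 S0 by (intro mult_nonneg_nonneg divide_nonneg_nonneg) auto
    qed (use elim in simp)
    also have "(\<Sum>x\<in>{1..n}. \<Sum>y\<in>{1..n}. real (d n x) * real (d n y) / M n * ?S)
        = total n * total n / M n * ?S"
    proof -
      define z where "z = ?S / M n"
      have "real (d n x) * real (d n y) / M n * ?S = real (d n x) * real (d n y) * z" for x y
        by (simp add: z_def)
      then have "(\<Sum>x\<in>{1..n}. \<Sum>y\<in>{1..n}. real (d n x) * real (d n y) / M n * ?S)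
          = total n * total n * z"
        by (simp only: flip: sum_product sum_distrib_right)
      then show ?thesis by (simp add: z_def)
    qed
    also have "total n * total n / M n * ?S / real n ^ 2
        \<le> 2 * (m + 1) ^ 2 * ((c * ln n + 1) * (\<beta> * exp (b * c * ln n))) / n"
    proof -
      have "?S \<le> (c * ln n + 1) * (\<beta> * exp (b * c * ln n))"
      proof -
        have "?S \<le> (\<Sum>i<k n. \<beta> ^ k n)"
          using beta by (intro sum_mono power_increasing) auto
        also have "\<dots> = real (k n) * \<beta> ^ k n" by simp
        also have "\<dots> \<le> (c * ln n + 1) * \<beta> ^ k n"
          using elim(3) beta by (intro mult_right_mono) auto
        also have "\<beta> ^ k n \<le> \<beta> * exp (b * c * ln n)"
        proof -
          have "\<beta> ^ k n = exp (real (k n) * b)" by (simp add: \<beta>_def exp_of_nat_mult)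
          also have "\<dots> \<le> exp ((c * ln n + 1) * b)" using elim(3) b by simp
          also have "\<dots> = \<beta> * exp (b * c * ln n)"
            by (simp add: \<beta>_def algebra_simps flip: exp_add)
          finally show ?thesis .
        qed
        then have "(c * ln n + 1) * \<beta> ^ k n \<le> (c * ln n + 1) * (\<beta> * exp (b * c * ln n))"
          using c elim(5) by (intro mult_left_mono) (auto intro: add_nonneg_nonneg)
        finally show ?thesis .
      qed
      moreover have "total n * total n / M n \<le> 2 * (m + 1) ^ 2 * n"
      proof -
        have t0: "total n \<ge> 0" by (intro sum_nonneg) auto
        have "total n * total n \<le> ((m + 1) * n) * ((m + 1) * n)"
          using elim(4) t0 mean_ge_1 by (intro mult_mono) auto
        also have "\<dots> \<le> (2 * (m + 1) ^ 2 * n) * M n"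
        proof -
          have "(2 * (m + 1) ^ 2 * n) * (n / 2) \<le> (2 * (m + 1) ^ 2 * n) * M n"
            using M by (intro mult_left_mono) auto
          then show ?thesis by (simp add: power2_eq_square algebra_simps)
        qed
        finally show ?thesis using M0 by (simp add: pos_divide_le_eq)
      qed
      ultimately have "total n * total n / M n * ?S \<le>
          2 * (m + 1) ^ 2 * n * ((c * ln n + 1) * (\<beta> * exp (b * c * ln n)))"
        using S0 by (intro mult_mono) auto
      then have "total n * total n / M n * ?S / real n ^ 2 \<le>
          2 * (m + 1) ^ 2 * n * ((c * ln n + 1) * (\<beta> * exp (b * c * ln n))) / real n ^ 2"
        by (intro divide_right_mono) auto
      also have "\<dots> = 2 * (m + 1) ^ 2 * ((c * ln n + 1) * (\<beta> * exp (b * c * ln n))) / n"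
        using n by (simp add: power2_eq_square[of "real n"])
      finally show ?thesis .
    qed
    finally show ?case by simp
  qed
  have lim: "(\<lambda>n. 1 / real n + 2 * (m + 1) ^ 2 * ((c * ln n + 1) * (\<beta> * exp (b * c * ln n))) / n) \<longlonglongrightarrow> 0"
  proof -
    define a where "a = 1 - b * c"
    have a: "a > 0" using b by (simp add: a_def)
    have lim0: "(\<lambda>n. 1 / real n + 2 * (m + 1) ^ 2 * \<beta> * ((c * ln n + 1) * exp (- (a * ln n)))) \<longlonglongrightarrow> 0 + 2 * (m + 1) ^ 2 * \<beta> * 0"
    proof (intro tendsto_intros lim_1_over_n)
      show "(\<lambda>n. (c * ln (real n) + 1) * exp (- (a * ln (real n)))) \<longlonglongrightarrow> 0"
        using a c by real_asymp
    qed
    have eq: "\<forall>\<^sub>F n in sequentially. 1 / real n + 2 * (m + 1) ^ 2 * \<beta> * ((c * ln n + 1) * exp (- (a * ln n)))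
       = 1 / real n + 2 * (m + 1) ^ 2 * ((c * ln n + 1) * (\<beta> * exp (b * c * ln n))) / n"
      using eventually_gt_at_top[of 0]
    proof eventually_elim
      case (elim n)
      have "exp (- (a * ln n)) = exp (b * c * ln n - ln n)" by (simp add: a_def algebra_simps)
      also have "\<dots> = exp (b * c * ln n) / n" using elim by (simp add: exp_diff)
      finally show ?case by simp
    qed
    show ?thesis using Lim_transform_eventually[OF lim0 eq] by simp
  qed
  show ?thesis
    unfolding k_def[symmetric]
    by (rule tendsto_sandwich[OF _ bound tendsto_const lim]) (simp add: avg_nonneg)
qed


lemma exploration_eventually:
  assumes mu: "1 < \<mu>" "\<mu> < \<nu>"
  obtains K \<delta> \<theta>\<^sub>0 where "\<delta> > 0" "0 < \<theta>\<^sub>0" "\<theta>\<^sub>0 \<le> 1" "K \<ge> 1"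
    "\<forall>\<^sub>F n in sequentially. exploration n (d n) K \<mu> \<delta> \<theta>\<^sub>0"
proof -
  \<comment> \<open>The truncated average gain is made larger than the midpoint of \<open>\<mu>\<close> and \<open>\<nu>\<close>. The difference to
    \<open>\<mu>\<close> is shared equally by the two losses that \<open>\<delta>\<close> and \<open>\<theta>\<^sub>0\<close> control.\<close>
  define c where "c = (\<mu> + \<nu>) / 2"
  have c: "\<mu> < c" "c < \<nu>" using mu by (auto simp: c_def)
  obtain K where K: "K \<ge> 1" "\<forall>\<^sub>F n in sequentially.
      c * total n \<le> (\<Sum>v | v \<in> {1..n} \<and> d n v \<le> K. real (d n v) * (real (d n v) - 1))"
    using truncated[OF c(2)] by blast
  define \<delta> where "\<delta> = (c - \<mu>) / 2 / (real K ^ 2 + 2 * \<mu>)"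
  define \<theta>\<^sub>0 where "\<theta>\<^sub>0 = min (1 / \<mu>) ((c - \<mu>) / (2 * real K ^ 2))"
  have pos: "real K ^ 2 > 0" "real K ^ 2 + 2 * \<mu> > 0" using K(1) mu by (auto intro: add_pos_pos)
  have dK: "\<delta> * (real K ^ 2 + 2 * \<mu>) = (c - \<mu>) / 2"
  proof -
    define Q where "Q = real K ^ 2 + 2 * \<mu>"
    have "Q > 0" using pos(2) by (simp add: Q_def)
    then show ?thesis unfolding \<delta>_def Q_def[symmetric] by simp
  qed
  have "\<theta>\<^sub>0 * real K ^ 2 \<le> (c - \<mu>) / (2 * real K ^ 2) * real K ^ 2"
    by (intro mult_right_mono) (auto simp: \<theta>\<^sub>0_def)
  then have "\<theta>\<^sub>0 * real K ^ 2 \<le> (c - \<mu>) / 2" using pos by simp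
  then have le: "\<mu> + \<delta> * (real K ^ 2 + 2 * \<mu>) + \<theta>\<^sub>0 * real K ^ 2 \<le> c"
    unfolding dK diff_divide_distrib by linarith
  have th: "0 < \<theta>\<^sub>0" using c mu pos by (simp add: \<theta>\<^sub>0_def)
  have dl: "\<delta> > 0" using c pos by (simp add: \<delta>_def)
  have "\<theta>\<^sub>0 * \<mu> \<le> 1 / \<mu> * \<mu>" using mu by (intro mult_right_mono) (auto simp: \<theta>\<^sub>0_def)
  then have th1: "\<theta>\<^sub>0 * \<mu> \<le> 1" using mu by simp
  have "\<theta>\<^sub>0 \<le> 1 / \<mu>" by (simp add: \<theta>\<^sub>0_def)
  also have "1 / \<mu> \<le> 1" using mu by simp
  finally have th2: "\<theta>\<^sub>0 \<le> 1" .
  have "\<forall>\<^sub>F n in sequentially. exploration n (d n) K \<mu> \<delta> \<theta>\<^sub>0"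
    using K(2)
  proof eventually_elim
    case (elim n)
    have t0: "0 \<le> total n" by (intro sum_nonneg) auto
    show ?case
    proof
      show "(\<mu> + \<delta> * (real K ^ 2 + 2 * \<mu>) + \<theta>\<^sub>0 * real K ^ 2) * card (halves n)
          \<le> (\<Sum>v | v \<in> {1..n} \<and> d n v \<le> K. real (d n v) * (real (d n v) - 1))"
        using elim mult_right_mono[OF le t0] unfolding real_card_HE by linarith
    qed (use mu K(1) dl th th1 in auto)
  qed
  then show ?thesis using that dl th th2 K(1) by blast
qed

text \<open>
  A single squared degree is at most the sum of all squared degrees, which is of order \<open>n\<close>.
\<close>

lemma max_degree_le:
  "\<forall>\<^sub>F n in sequentially. \<forall>v\<in>{1..n}. d n v \<le> nat \<lfloor>sqrt ((\<nu> * m + m + 1) * n)\<rfloor>"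
proof -
  let ?s = "\<nu> * m + m + 1"
  have "(\<lambda>n. (\<Sum>i=1..n. real (d n i) * (real (d n i) - 1)) / n + total n / n) \<longlonglongrightarrow> \<nu> * m + m"
    by (intro tendsto_intros forward mean)
  then have "\<forall>\<^sub>F n in sequentially. (\<Sum>i=1..n. real (d n i) * (real (d n i) - 1)) / n + total n / n < ?s"
    by (rule order_tendstoD) simp
  then show ?thesis
    using eventually_gt_at_top[of 0]
  proof eventually_elim
    case (elim n)
    have "(\<Sum>i=1..n. (real (d n i))\<^sup>2)
        = (\<Sum>i=1..n. real (d n i) * (real (d n i) - 1)) + total n"
      by (simp add: power2_eq_square algebra_simps flip: sum.distrib)
    also have "\<dots> \<le> ?s * n" using elim by (simp add: field_simps)
    finally have le: "(\<Sum>i=1..n. (real (d n i))\<^sup>2) \<le> ?s * n" .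
    show ?case
    proof
      fix v assume "v \<in> {1..n}"
      then have "(real (d n v))\<^sup>2 \<le> (\<Sum>i=1..n. (real (d n i))\<^sup>2)"
        by (intro member_le_sum) auto
      then have "real (d n v) \<le> sqrt (?s * n)" using le by (intro real_le_rsqrt) linarith
      then have "int (d n v) \<le> \<lfloor>sqrt (?s * n)\<rfloor>" by (simp only: le_floor_iff of_int_of_nat_eq)
      then show "d n v \<le> nat \<lfloor>sqrt (?s * n)\<rfloor>" by linarith
    qed
  qed
qed

text \<open>
  The radius \<open>r\<close> adds up both exploration phases on both sides and the pair that joins them. With \<open>L = sqrt n * ln n\<close> the number of
  generations on either side is about \<open>ln n / (2 * ln \<mu>)\<close>, the collision of two fronts of size \<open>L\<close> fails with
  probability about \<open>exp (- (ln n)\<^sup>2 / (2 * m))\<close>, and all phases together explore only a number of half-edges of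
  order \<open>sqrt n * (ln n)\<^sup>2\<close>.
\<close>

lemma typical_distance_upper:
  assumes eps: "\<epsilon> > 0"
  obtains r c where "c > 0" "\<forall>\<^sub>F n in sequentially. real (r n) \<le> (1 / ln \<nu> + \<epsilon>) * ln n"
    "(\<lambda>n. avg n (\<lambda>P x y. (\<exists>j. walk_within P j x y) \<and> \<not> walk_within P (r n) x y)) \<longlonglongrightarrow> 0"
    "\<forall>\<^sub>F n in sequentially. avg n (\<lambda>P. walk_within P (r n)) \<ge> c"
proof -
  have lnnu: "ln \<nu> > 0" using nu_gt_1 by simp
  \<comment> \<open>Half of \<open>\<epsilon>\<close> pays for the difference between \<open>1 / ln \<mu>\<close> and \<open>1 / ln \<nu>\<close>, the other half for exploring
    the two clusters. Here \<open>t = ln \<mu>\<close> is chosen with \<open>1 / t < s\<close> and \<open>t < ln \<nu>\<close>.\<close>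
  define s where "s = 1 / ln \<nu> + \<epsilon> / 2"
  define t where "t = (1 / s + ln \<nu>) / 2"
  define \<mu> where "\<mu> = exp t"
  have s: "s > 1 / ln \<nu>" "s > 0" using eps lnnu by (auto simp: s_def add_pos_pos)
  then have "1 / s < ln \<nu>" using lnnu by (simp add: field_simps)
  then have t: "1 / s < t" "t < ln \<nu>" by (auto simp: t_def)
  moreover have "1 / s > 0" using s(2) by simp
  ultimately have tpos: "t > 0" by linarith
  have ts: "1 / t < s" using t(1) tpos s(2) by (simp add: field_simps)
  have mu: "1 < \<mu>" "\<mu> < \<nu>"
  proof -
    show "1 < \<mu>" using tpos by (simp add: \<mu>_def)
    have "exp t < exp (ln \<nu>)" using t(2) by (simp only: exp_less_mono)
    then show "\<mu> < \<nu>" using nu_gt_1 by (simp add: \<mu>_def)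
  qed
  obtain K \<delta> \<theta>\<^sub>0 where par: "\<delta> > 0" "0 < \<theta>\<^sub>0" "\<theta>\<^sub>0 \<le> 1" "K \<ge> 1"
    and expl: "\<forall>\<^sub>F n in sequentially. exploration n (d n) K \<mu> \<delta> \<theta>\<^sub>0"
    by (rule exploration_eventually[OF mu])
  define S where "S = \<nu> * m + m + 1"
  have S: "S > 0" using mean_ge_1 nu_gt_1 by (auto simp: S_def intro!: add_pos_pos)
  define \<Delta> where "\<Delta> n = nat \<lfloor>sqrt (S * n)\<rfloor>" for n :: nat
  define L where "L n = sqrt (real n) * ln n" for n :: nat
  define k where "k n = nat \<lceil>ln (L n) / t\<rceil>" for n
  define T where "T n = nat \<lfloor>\<epsilon> / 4 * ln (real n)\<rfloor>" for n
  define r where "r n = 2 * (T n + k n) + 1" for n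
  \<comment> \<open>With \<open>t\<^sub>0\<close> active half-edges on each side, the two front terms sum to at most \<open>1 / 4\<close>. The collision term
    will be below \<open>1 / 4\<close> too, so that \<open>apart_le_uniform\<close> applies with \<open>q = 1 / 2\<close>.\<close>
  obtain t\<^sub>0 :: nat where t0: "ln (8 * exp 1) / \<theta>\<^sub>0 \<le> real t\<^sub>0"
    using real_arch_simple[of "ln (8 * exp 1) / \<theta>\<^sub>0"] by blast
  have "exp (- \<theta>\<^sub>0 * real t\<^sub>0) \<le> exp (- ln (8 * exp 1))"
    using t0 par by (simp add: field_simps)
  also have "\<dots> = 1 / (8 * exp 1)" by (simp add: exp_minus inverse_eq_divide)
  finally have t0e: "2 * exp 1 * exp (- \<theta>\<^sub>0 * real t\<^sub>0) \<le> 1 / 4" by (simp add: field_simps)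
  have ln_gt: "\<forall>\<^sub>F n in sequentially. ln (real n) > 1" by real_asymp
  have Lpos: "\<forall>\<^sub>F n in sequentially. L n > 0 \<and> real (k n) \<le> (ln n / 2 + ln (ln n)) / t + 1 \<and> L n \<le> \<mu> ^ k n"
    using ln_gt eventually_gt_at_top[of 0]
  proof eventually_elim
    case (elim n)
    have "ln (real n) > 0" using elim by linarith
    then have L: "L n > 0" using elim(2) unfolding L_def by (intro mult_pos_pos) auto
    have lnL: "ln (L n) = ln n / 2 + ln (ln n)"
      using elim by (simp add: L_def ln_mult ln_sqrt)
    have "ln (L n) \<ge> 0" unfolding lnL using elim by simp
    then have "ln (L n) / t \<ge> 0" using tpos by simp
    then have kk: "ln (L n) / t \<le> k n" "real (k n) \<le> ln (L n) / t + 1" unfolding k_def by linarith+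
    have "L n = exp (ln (L n))" using L by simp
    also have "\<dots> \<le> exp (real (k n) * t)" using kk(1) tpos by (simp add: field_simps)
    also have "\<dots> = \<mu> ^ k n" by (simp add: \<mu>_def exp_of_nat_mult)
    finally show ?case using L kk(2) lnL by simp
  qed
  have Tb: "\<forall>\<^sub>F n in sequentially. real (T n) \<le> \<epsilon> / 4 * ln n \<and> \<epsilon> / 4 * ln n - 1 \<le> real (T n)"
    using ln_gt
  proof eventually_elim
    case (elim n)
    then have "\<epsilon> / 4 * ln n \<ge> 0" using eps by simp
    then show ?case unfolding T_def by linarith
  qed
  have rle: "\<forall>\<^sub>F n in sequentially. real (r n) \<le> (1 / ln \<nu> + \<epsilon>) * ln n"
  proof -
    define a where "a = s - 1 / t"
    have a: "a > 0" using ts by (simp add: a_def)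
    have "filterlim (\<lambda>n. a * ln (real n) - 2 / t * ln (ln n) - 3) at_top sequentially"
      using a tpos by real_asymp
    then have "\<forall>\<^sub>F n in sequentially. a * ln (real n) - 2 / t * ln (ln n) - 3 \<ge> 0"
      unfolding filterlim_at_top by blast
    then show ?thesis
      using Lpos Tb
    proof eventually_elim
      case (elim n)
      have "real (r n) = 2 * real (T n) + 2 * real (k n) + 1" by (simp add: r_def)
      also have "\<dots> \<le> 2 * (\<epsilon> / 4 * ln n) + 2 * ((ln n / 2 + ln (ln n)) / t + 1) + 1"
        using elim(2,3) by (intro add_mono mult_left_mono order_refl) auto
      also have "\<dots> = (\<epsilon> / 2 + 1 / t) * ln n + 2 / t * ln (ln n) + 3"
        using tpos by (simp add: field_simps)
      also have "\<dots> \<le> (\<epsilon> / 2 + 1 / t) * ln n + a * ln n" using elim(1) by simp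
      also have "\<dots> = (1 / ln \<nu> + \<epsilon>) * ln n" by (simp add: a_def s_def algebra_simps)
      finally show ?case .
    qed
  qed
  have budget: "\<forall>\<^sub>F n in sequentially. 2 * (real (T n) + 1) * real (\<Delta> n) + 2 * real t\<^sub>0 * real K
      + 2 * real (k n) * real K * L n \<le> \<delta> * card (halves n)"
  proof -
    have "(\<lambda>n. (2 * (\<epsilon> / 4 * ln n + 1) * sqrt (S * real n) + 2 * real t\<^sub>0 * real K
        + 2 * ((ln n / 2 + ln (ln n)) / t + 1) * real K * (sqrt n * ln n)) / n) \<longlonglongrightarrow> 0"
    proof -
      have "(\<lambda>n. (2 * (\<epsilon> / 4 * ln n + 1) * sqrt (S * real n)) / n) \<longlonglongrightarrow> 0"
        using eps S by real_asymp
      moreover have "(\<lambda>n. (2 * real t\<^sub>0 * real K) / real n) \<longlonglongrightarrow> 0" by real_asymp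
      moreover have "(\<lambda>n. real K * ((2 * ((ln (real n) / 2 + ln (ln n)) / t + 1) * (sqrt n * ln n)) / n)) \<longlonglongrightarrow> real K * 0"
        using tpos by (intro tendsto_mult tendsto_const) real_asymp
      ultimately have "(\<lambda>n. (2 * (\<epsilon> / 4 * ln n + 1) * sqrt (S * real n)) / n + (2 * real t\<^sub>0 * real K) / real n
        + real K * ((2 * ((ln (real n) / 2 + ln (ln n)) / t + 1) * (sqrt n * ln n)) / n)) \<longlonglongrightarrow> 0 + 0 + real K * 0"
        by (intro tendsto_add)
      then show ?thesis by (simp add: add_divide_distrib mult_ac)
    qed
    then have "\<forall>\<^sub>F n in sequentially. (2 * (\<epsilon> / 4 * ln n + 1) * sqrt (S * real n) + 2 * real t\<^sub>0 * real K
        + 2 * ((ln n / 2 + ln (ln n)) / t + 1) * real K * (sqrt n * ln n)) / n < \<delta>"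
      by (rule order_tendstoD) (use par in auto)
    then show ?thesis
      using Lpos Tb eventually_gt_at_top[of 0]
    proof eventually_elim
      case (elim n)
      have "real (\<Delta> n) \<le> sqrt (S * n)" unfolding \<Delta>_def using S by simp
      then have "2 * (real (T n) + 1) * real (\<Delta> n) \<le> 2 * (\<epsilon> / 4 * ln n + 1) * sqrt (S * real n)"
        using elim(3) S by (intro mult_mono) auto
      moreover have "2 * real (k n) * real K * L n
          \<le> 2 * ((ln n / 2 + ln (ln n)) / t + 1) * real K * L n"
        using elim(2) by (intro mult_right_mono mult_left_mono) auto
      moreover have "2 * (\<epsilon> / 4 * ln n + 1) * sqrt (S * real n) + 2 * real t\<^sub>0 * real K
        + 2 * ((ln n / 2 + ln (ln n)) / t + 1) * real K * L n \<le> \<delta> * n"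
        using elim(1,4) unfolding L_def by (simp add: pos_divide_less_eq)
      moreover have "\<delta> * n \<le> \<delta> * card (halves n)"
        unfolding real_card_HE using total_ge par by (intro mult_left_mono) auto
      ultimately show ?case by linarith
    qed
  qed
  define \<eta> where "\<eta> n = exp (- ((ln (real n))\<^sup>2 / (2 * (m + 1))))" for n
  have etale: "\<forall>\<^sub>F n in sequentially. exp (- ((L n)\<^sup>2 / (2 * card (halves n)))) \<le> \<eta> n"
    using total_le eventually_gt_at_top[of 0]
  proof eventually_elim
    case (elim n)
    have "(ln (real n))\<^sup>2 / (2 * (m + 1)) = (L n)\<^sup>2 / (2 * ((m + 1) * n))"
      using elim(2) by (simp add: L_def power_mult_distrib)
    also have "\<dots> \<le> (L n)\<^sup>2 / (2 * total n)"
      using elim total_ge[of n] mean_ge_1 by (intro divide_left_mono) (auto intro!: mult_pos_pos)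
    finally show ?case unfolding \<eta>_def of_nat_mult real_card_HE by simp
  qed
  have eta0: "\<eta> \<longlonglongrightarrow> 0" unfolding \<eta>_def using mean_ge_1 by real_asymp
  define a where "a = \<theta>\<^sub>0 * (\<mu> - 1)"
  have a: "a > 0" using par mu by (simp add: a_def)
  define U where "U n = 2 * exp 1 * exp (- a * (\<epsilon> / 4 * ln (real n) - 1)) + \<eta> n" for n
  have "(\<lambda>n. 2 * exp 1 * exp (- a * (\<epsilon> / 4 * ln (real n) - 1))) \<longlonglongrightarrow> 0"
    using a eps by real_asymp
  then have U0: "(\<lambda>n. 1 / real n + U n) \<longlonglongrightarrow> 0"
    unfolding U_def using eta0 by (auto intro!: tendsto_add_zero lim_1_over_n)
  have deg: "\<forall>\<^sub>F n in sequentially. \<forall>v\<in>{1..n}. d n v \<le> \<Delta> n"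
    using max_degree_le by (simp add: \<Delta>_def S_def)
  have "\<forall>\<^sub>F n in sequentially.
      avg n (\<lambda>P x y. (\<exists>j. walk_within P j x y) \<and> \<not> walk_within P (r n) x y) \<le> 1 / n + U n"
    using expl Lpos Tb budget etale deg eventually_ge_at_top[of 1]
  proof eventually_elim
    case (elim n)
    interpret exploration n "d n" K \<mu> \<delta> \<theta>\<^sub>0 by (rule elim(1))
    have rate: "rate (k n) (L n) = \<theta>\<^sub>0"
    proof -
      have "1 \<le> \<mu> ^ k n / L n" using elim(2) by simp
      then show ?thesis using par(3) by (simp add: rate_def min_def)
    qed
    have "avg n (\<lambda>P x y. (\<exists>j. walk_within P j x y) \<and> \<not> walk_within P (r n) x y)
        \<le> 1 / n + (\<Sum>x\<in>{1..n}. \<Sum>y\<in>{1..n}. U n) / real n ^ 2"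
    proof (rule avg_le_off_diagonal)
      fix x y assume xy: "x \<in> {1..n}" "y \<in> {1..n}" "x \<noteq> y"
      have "far x y (r n) {} HE \<le> 2 * exp 1 * exp (- rate (k n) (L n) * (\<mu> - 1)) ^ T n
          + exp (- ((L n)\<^sup>2 / (2 * card HE)))"
      proof (rule far_le[OF _ xy even_card_HE])
        have "2 * real t\<^sub>0 * real K \<ge> 0" by simp
        then show "2 * (real (T n) + 1) * real (\<Delta> n) + 2 * real (k n) * real K * L n \<le> \<delta> * card HE"
          using elim(4) by linarith
      qed (use elim(2,6) r_def in auto)
      also have "exp (- rate (k n) (L n) * (\<mu> - 1)) ^ T n = exp (- a * T n)"
        unfolding rate by (simp add: a_def mult_ac flip: exp_of_nat_mult)
      also have "\<dots> \<le> exp (- a * (\<epsilon> / 4 * ln (real n) - 1))"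
        using a elim(3) by simp
      finally have "far x y (r n) {} HE \<le> U n" unfolding U_def using elim(5) by simp
      then show "match_prob HE (\<lambda>P. (\<exists>j. walk_within P j x y) \<and> \<not> walk_within P (r n) x y) \<le> U n"
        by (simp add: far_def)
    qed (use elim(7) in \<open>auto simp: U_def \<eta>_def\<close>)
    also have "(\<Sum>x\<in>{1..n}. \<Sum>y\<in>{1..n}. U n) / real n ^ 2 = U n"
      using elim(7) by (simp add: power2_eq_square)
    finally show ?case .
  qed
  then have lim: "(\<lambda>n. avg n (\<lambda>P x y. (\<exists>j. walk_within P j x y) \<and> \<not> walk_within P (r n) x y)) \<longlonglongrightarrow> 0"
    using U0 by (intro tendsto_sandwich[OF _ _ tendsto_const U0]) (auto simp: avg_nonneg)
  define c where "c = ((\<mu> - 1) / K) ^ t\<^sub>0 * (((\<mu> - 1) / K) ^ t\<^sub>0 * (1 / 2))"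
  have c: "c > 0" unfolding c_def using mu par(4) by simp
  have Tt0: "\<forall>\<^sub>F n in sequentially. \<epsilon> / 4 * ln (real n) - 1 \<ge> t\<^sub>0"
  proof -
    have "filterlim (\<lambda>n. \<epsilon> / 4 * ln (real n) - 1) at_top sequentially"
      using eps by real_asymp
    then show ?thesis unfolding filterlim_at_top by blast
  qed
  have eta4: "\<forall>\<^sub>F n in sequentially. \<eta> n < 1 / 4" using eta0 by (rule order_tendstoD) simp
  have "\<forall>\<^sub>F n in sequentially. avg n (\<lambda>P. walk_within P (r n)) \<ge> c / 2"
    using expl Lpos Tb budget etale deg eventually_ge_at_top[of 2] Tt0 eta4
  proof eventually_elim
    case (elim n)
    interpret exploration n "d n" K \<mu> \<delta> \<theta>\<^sub>0 by (rule elim(1))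
    have rate: "rate (k n) (L n) = \<theta>\<^sub>0"
    proof -
      have "1 \<le> \<mu> ^ k n / L n" using elim(2) by simp
      then show ?thesis using par(3) by (simp add: rate_def min_def)
    qed
    have walk: "c \<le> match_prob HE (\<lambda>P. walk_within P (r n) x y)"
      if xy: "x \<in> {1..n}" "y \<in> {1..n}" "x \<noteq> y" for x y
    proof -
      have "apart x y (r n) {} HE \<le> 1 - c"
        unfolding c_def
      proof (rule apart_le_uniform[OF _ xy _ _ even_card_HE])
        show "1 \<le> d n x" "1 \<le> d n y" using deg_pos xy by auto
        show "d n x \<le> \<Delta> n" "d n y \<le> \<Delta> n" using elim(6) xy by auto
        have "real t\<^sub>0 \<le> T n" using elim(3,8) by linarith
        then show "2 * (t\<^sub>0 + k n) + 1 \<le> r n" by (simp add: r_def)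
        have "real (T n) * real (\<Delta> n) \<ge> 0" by simp
        then show "2 * real (\<Delta> n) + 2 * real t\<^sub>0 * real K + 2 * real (k n) * real K * L n \<le> \<delta> * card HE"
          using elim(4) unfolding ring_distribs by linarith
        show "2 * exp 1 * exp (- rate (k n) (L n) * real t\<^sub>0) + exp (- ((L n)\<^sup>2 / (2 * card HE))) \<le> 1 - 1 / 2"
          unfolding rate using t0e elim(5,9) by linarith
      qed (use elim(2) in auto)
      then show ?thesis
        unfolding apart_def using match_prob_compl[OF finite_HE even_card_HE, of "\<lambda>P. walk_within P (r n) x y"]
        by simp
    qed
    have "c / 2 * real n ^ 2 \<le> (real n * real n - real n) * c"
    proof -
      have "real n * 2 \<le> real n * real n" using elim(7) by (intro mult_left_mono) auto
      then have "c * (2 * real n) \<le> c * (real n * real n)" using c by (intro mult_left_mono) auto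
      then show ?thesis by (simp add: power2_eq_square algebra_simps)
    qed
    also have "\<dots> = (\<Sum>x\<in>{1..n}. \<Sum>y\<in>{1..n}. c - (if x = y then c else 0))"
      by (simp add: sum_subtractf algebra_simps)
    also have "\<dots> \<le> (\<Sum>x\<in>{1..n}. \<Sum>y\<in>{1..n}. match_prob HE (\<lambda>P. walk_within P (r n) x y))"
      using walk by (intro sum_mono) (auto simp: match_prob_nonneg)
    finally show ?case
      unfolding avg_def using elim(7) by (simp add: pos_le_divide_eq)
  qed
  then show ?thesis using that[of "c / 2" r] c rle lim by simp
qed

end

section \<open>Weak convergence gives the truncated mean forward degree\<close>

text \<open>
  A bounded continuous substitute for \<open>x * (x - 1)\<close> restricted to \<open>1 \<le> x \<le> K\<close>. It agrees with it there, vanishes from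
  \<open>K + 1\<close> on, and thus on integers never exceeds it.
\<close>

definition smooth_forward :: "nat \<Rightarrow> real \<Rightarrow> real" where
  "smooth_forward K x = max 1 x * (max 1 x - 1) * max 0 (min 1 (real K + 1 - max 1 x))"

lemma smooth_forward_bounds: "0 \<le> smooth_forward K x" "smooth_forward K x \<le> (real K + 1)\<^sup>2"
proof -
  define y where "y = max 1 x"
  have y: "y \<ge> 1" by (simp add: y_def)
  have eq: "smooth_forward K x = y * (y - 1) * max 0 (min 1 (real K + 1 - y))"
    by (simp add: smooth_forward_def y_def)
  show "0 \<le> smooth_forward K x" unfolding eq using y by simp
  show "smooth_forward K x \<le> (real K + 1)\<^sup>2"
  proof (cases "y \<le> real K + 1")
    case True
    have "y * (y - 1) * max 0 (min 1 (real K + 1 - y)) \<le> y * (y - 1) * 1"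
      using y by (intro mult_left_mono) auto
    also have "\<dots> \<le> (real K + 1) * (real K + 1)" unfolding mult_1_right
      using y True by (intro mult_mono) auto
    finally show ?thesis unfolding eq by (simp add: power2_eq_square)
  qed (simp add: eq)
qed

lemma smooth_forward_le_square: "1 \<le> x \<Longrightarrow> smooth_forward K x \<le> x\<^sup>2"
proof -
  assume x: "1 \<le> x"
  have "x * (x - 1) * max 0 (min 1 (real K + 1 - x)) \<le> x * (x - 1) * 1"
    using x by (intro mult_left_mono) auto
  also have "\<dots> \<le> x * x" unfolding mult_1_right using x by (intro mult_left_mono) auto
  finally show ?thesis using x by (simp add: smooth_forward_def max_def power2_eq_square)
qed

lemma smooth_forward_eq:
  fixes x :: real
  shows "1 \<le> x \<Longrightarrow> x \<le> real K \<Longrightarrow> smooth_forward K x = x * (x - 1)"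
  by (simp add: smooth_forward_def max_def min_def)

lemma smooth_forward_nat_le:
  assumes "k \<ge> 1"
  shows "smooth_forward K (real k) \<le> (if k \<le> K then real k * (real k - 1) else 0)"
proof (cases "k \<le> K")
  case True
  then show ?thesis using assms smooth_forward_eq[of "real k" K] by simp
next
  case False
  then have "real K + 1 - max 1 (real k) \<le> 0" by (simp add: max_def)
  then have "max 0 (min 1 (real K + 1 - max 1 (real k))) = 0" by linarith
  then show ?thesis using False by (simp only: smooth_forward_def if_False mult_zero_right order_refl)
qed

lemma isCont_smooth_forward: "isCont (smooth_forward K) x"
  unfolding smooth_forward_def by (intro continuous_intros)

lemma expectation_uniform_vertex:
  fixes f :: "nat \<Rightarrow> real"
  shows "n \<ge> 1 \<Longrightarrow> measure_pmf.expectation (uniform_vertex n) f = (\<Sum>v=1..n. f v) / n"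
  unfolding uniform_vertex_def by (subst integral_pmf_of_set) auto

text \<open>
  By dominated convergence a constant \<open>K\<close> retains more than \<open>c * m\<close> of the expectation of \<open>D * (D - 1)\<close>. For this fixed
  \<open>K\<close> the truncated expectation is that of a bounded continuous function, so weak convergence carries it over to the
  degrees.
\<close>

lemma truncated_forward_degree:
  fixes d :: "nat \<Rightarrow> nat \<Rightarrow> nat" and M :: "'a measure" and D :: "'a \<Rightarrow> real"
  assumes deg_pos: "\<And>n i. i \<in> {1..n} \<Longrightarrow> d n i \<ge> 1"
    and prob: "prob_space M" and D_rv: "D \<in> borel_measurable M" and D_ge_1: "AE \<omega> in M. D \<omega> \<ge> 1"
    and conv_distr:
      "weak_conv_m (\<lambda>n. distr (uniform_vertex n) borel (\<lambda>v. real (d n v))) (distr M borel D)"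
    and mean: "(\<lambda>n. (\<Sum>i=1..n. real (d n i)) / n) \<longlonglongrightarrow> m"
    and D2_integrable: "integrable M (\<lambda>\<omega>. (D \<omega>)\<^sup>2)"
    and c: "c * m < (\<integral>\<omega>. D \<omega> * (D \<omega> - 1) \<partial>M)"
  shows "\<exists>K\<ge>1. \<forall>\<^sub>F n in sequentially. c * (\<Sum>i=1..n. real (d n i))
    \<le> (\<Sum>v | v \<in> {1..n} \<and> d n v \<le> K. real (d n v) * (real (d n v) - 1))"
proof -
  interpret prob_space M by (rule prob)
  have meas: "smooth_forward K \<in> borel_measurable borel" for K
    by (intro borel_measurable_continuous_onI continuous_at_imp_continuous_on ballI isCont_smooth_forward)
  have "(\<lambda>K. \<integral>\<omega>. smooth_forward K (D \<omega>) \<partial>M) \<longlonglongrightarrow> (\<integral>\<omega>. D \<omega> * (D \<omega> - 1) \<partial>M)"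
  proof (rule integral_dominated_convergence[where w = "\<lambda>\<omega>. (D \<omega>)\<^sup>2"])
    show "AE \<omega> in M. (\<lambda>K. smooth_forward K (D \<omega>)) \<longlonglongrightarrow> D \<omega> * (D \<omega> - 1)"
      using D_ge_1
    proof eventually_elim
      case (elim \<omega>)
      obtain K0 :: nat where K0: "D \<omega> \<le> K0" using real_arch_simple by blast
      have "\<forall>\<^sub>F K in sequentially. smooth_forward K (D \<omega>) = D \<omega> * (D \<omega> - 1)"
        using eventually_ge_at_top[of K0]
      proof eventually_elim
        fix K assume "K0 \<le> K"
        then have "D \<omega> \<le> real K" using K0 by linarith
        then show "smooth_forward K (D \<omega>) = D \<omega> * (D \<omega> - 1)" using elim by (intro smooth_forward_eq)
      qed
      then show ?case by (rule tendsto_eventually)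
    qed
    show "AE \<omega> in M. norm (smooth_forward K (D \<omega>)) \<le> (D \<omega>)\<^sup>2" for K
      using D_ge_1 by eventually_elim (simp add: smooth_forward_bounds smooth_forward_le_square)
    show "(\<lambda>\<omega>. smooth_forward K (D \<omega>)) \<in> borel_measurable M" for K
      by (rule measurable_compose[OF D_rv meas])
  qed (use D_rv D2_integrable in auto)
  then have "\<forall>\<^sub>F K in sequentially. c * m < (\<integral>\<omega>. smooth_forward K (D \<omega>) \<partial>M)"
    using c by (rule order_tendstoD)
  then have "\<forall>\<^sub>F K in sequentially. K \<ge> 1 \<and> c * m < (\<integral>\<omega>. smooth_forward K (D \<omega>) \<partial>M)"
    using eventually_ge_at_top[of 1] by eventually_elim simp
  from eventually_happens'[OF sequentially_bot this]
  obtain K where K: "K \<ge> 1" "c * m < (\<integral>\<omega>. smooth_forward K (D \<omega>) \<partial>M)" by blast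
  have "(\<lambda>n. integral\<^sup>L (distr (uniform_vertex n) borel (\<lambda>v. real (d n v))) (smooth_forward K))
      \<longlonglongrightarrow> integral\<^sup>L (distr M borel D) (smooth_forward K)"
  proof (rule weak_conv_imp_integral_bdd_continuous_conv[OF _ _ conv_distr])
    show "real_distribution (distr (uniform_vertex n) borel (\<lambda>v. real (d n v)))" for n
      by (intro prob_space.real_distribution_distr measure_pmf.prob_space_axioms) simp
    show "real_distribution (distr M borel D)"
      by (intro real_distribution_distr D_rv)
    show "norm (smooth_forward K x) \<le> (real K + 1)\<^sup>2" for x
      using smooth_forward_bounds[of K x] by simp
  qed (rule isCont_smooth_forward)
  then have "(\<lambda>n. measure_pmf.expectation (uniform_vertex n) (\<lambda>v. smooth_forward K (real (d n v))))
      \<longlonglongrightarrow> (\<integral>\<omega>. smooth_forward K (D \<omega>) \<partial>M)"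
    using D_rv meas by (simp add: integral_distr)
  moreover have "\<forall>\<^sub>F n in sequentially.
      measure_pmf.expectation (uniform_vertex n) (\<lambda>v. smooth_forward K (real (d n v))) =
      (\<Sum>v=1..n. smooth_forward K (real (d n v))) / n"
    using eventually_ge_at_top[of 1] by eventually_elim (rule expectation_uniform_vertex)
  ultimately have "(\<lambda>n. (\<Sum>v=1..n. smooth_forward K (real (d n v))) / n)
      \<longlonglongrightarrow> (\<integral>\<omega>. smooth_forward K (D \<omega>) \<partial>M)"
    by (rule Lim_transform_eventually)
  then have "(\<lambda>n. (\<Sum>v=1..n. smooth_forward K (real (d n v))) / n - c * ((\<Sum>i=1..n. real (d n i)) / n))
      \<longlonglongrightarrow> (\<integral>\<omega>. smooth_forward K (D \<omega>) \<partial>M) - c * m"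
    by (intro tendsto_intros mean)
  then have "\<forall>\<^sub>F n in sequentially.
      (\<Sum>v=1..n. smooth_forward K (real (d n v))) / n - c * ((\<Sum>i=1..n. real (d n i)) / n) > 0"
    by (rule order_tendstoD) (use K in simp)
  then have "\<forall>\<^sub>F n in sequentially. c * (\<Sum>i=1..n. real (d n i))
    \<le> (\<Sum>v | v \<in> {1..n} \<and> d n v \<le> K. real (d n v) * (real (d n v) - 1))"
    using eventually_gt_at_top[of 0]
  proof eventually_elim
    case (elim n)
    have "c * (\<Sum>i=1..n. real (d n i)) \<le> (\<Sum>v=1..n. smooth_forward K (real (d n v)))"
      using elim by (simp add: field_simps)
    also have "\<dots> \<le> (\<Sum>v=1..n. if d n v \<le> K then real (d n v) * (real (d n v) - 1) else 0)"
      using deg_pos by (intro sum_mono smooth_forward_nat_le) auto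
    also have "\<dots> = (\<Sum>v | v \<in> {1..n} \<and> d n v \<le> K. real (d n v) * (real (d n v) - 1))"
      by (subst sum.inter_filter[symmetric]) auto
    finally show ?case .
  qed
  then show ?thesis using K(1) by blast
qed

section \<open>Typical distances\<close>

theorem theorem3p9:
  fixes d :: "nat \<Rightarrow> nat \<Rightarrow> nat"
    and M :: "'a measure" and D :: "'a \<Rightarrow> real" and \<nu> :: real
  assumes deg_pos: "\<And>n i. i \<in> {1..n} \<Longrightarrow> d n i \<ge> 1"
    and even_total: "\<And>n. even (\<Sum>i=1..n. d n i)"
    and prob: "prob_space M"
    and D_rv: "D \<in> borel_measurable M"
    and D_ge_1: "\<P>(\<omega> in M. D \<omega> \<ge> 1) = 1"
    and conv_distr:
      "weak_conv_m (\<lambda>n. distr (uniform_vertex n) borel (\<lambda>v. real (d n v))) (distr M borel D)"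
    and D_integrable: "integrable M D"
    and conv_mean:
      "(\<lambda>n. measure_pmf.expectation (uniform_vertex n) (\<lambda>v. real (d n v)))
         \<longlonglongrightarrow> (\<integral>\<omega>. D \<omega> \<partial>M)"
    and D2_integrable: "integrable M (\<lambda>\<omega>. (D \<omega>)\<^sup>2)"
    and conv_second_moment:
      "(\<lambda>n. measure_pmf.expectation (uniform_vertex n) (\<lambda>v. (real (d n v))\<^sup>2))
         \<longlonglongrightarrow> (\<integral>\<omega>. (D \<omega>)\<^sup>2 \<partial>M)"
    and nu_eq: "\<nu> = (\<integral>\<omega>. D \<omega> * (D \<omega> - 1) \<partial>M) / (\<integral>\<omega>. D \<omega> \<partial>M)"
    and nu_gt_1: "\<nu> > 1"
  shows "\<forall>\<epsilon>>0.
    (\<lambda>n. \<P>((G, o1, o2) in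
            pair_pmf (configuration_model n (d n)) (pair_pmf (uniform_vertex n) (uniform_vertex n)).
            \<bar>graph_dist G o1 o2 / ereal (ln (real n)) - ereal (1 / ln \<nu>)\<bar> > ereal \<epsilon>
            \<bar> graph_dist G o1 o2 < \<infinity>))
      \<longlonglongrightarrow> 0"
proof (intro allI impI)
  fix \<epsilon> :: real assume eps: "\<epsilon> > 0"
  interpret M: prob_space M by (rule prob)
  define m where "m = (\<integral>\<omega>. D \<omega> \<partial>M)"
  have AE1: "AE \<omega> in M. D \<omega> \<ge> 1"
    using M.AE_prob_1[OF D_ge_1] by eventually_elim simp
  have "(\<integral>\<omega>. D \<omega> * (D \<omega> - 1) \<partial>M) = (\<integral>\<omega>. (D \<omega>)\<^sup>2 - D \<omega> \<partial>M)"
    by (simp add: power2_eq_square right_diff_distrib)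
  also have "\<dots> = (\<integral>\<omega>. (D \<omega>)\<^sup>2 \<partial>M) - m"
    unfolding m_def by (rule Bochner_Integration.integral_diff[OF D2_integrable D_integrable])
  finally have DD: "(\<integral>\<omega>. D \<omega> * (D \<omega> - 1) \<partial>M) = (\<integral>\<omega>. (D \<omega>)\<^sup>2 \<partial>M) - m" .
  have "m \<noteq> 0" using nu_eq nu_gt_1 by (auto simp: m_def)
  then have num: "\<nu> * m = (\<integral>\<omega>. D \<omega> * (D \<omega> - 1) \<partial>M)" using nu_eq by (simp add: m_def)
  have mpos: "m > 0"
  proof -
    have "0 \<le> m" unfolding m_def by (rule integral_nonneg_AE) (use AE1 in eventually_elim, simp)
    then show ?thesis using \<open>m \<noteq> 0\<close> by simp
  qed
  have mean: "(\<lambda>n. (\<Sum>i=1..n. real (d n i)) / n) \<longlonglongrightarrow> m"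
    unfolding m_def
  proof (rule Lim_transform_eventually[OF conv_mean])
    show "\<forall>\<^sub>F n in sequentially. measure_pmf.expectation (uniform_vertex n) (\<lambda>v. real (d n v))
        = (\<Sum>i=1..n. real (d n i)) / n"
      using eventually_ge_at_top[of 1] by eventually_elim (rule expectation_uniform_vertex)
  qed
  have second: "(\<lambda>n. (\<Sum>i=1..n. (real (d n i))\<^sup>2) / n) \<longlonglongrightarrow> (\<integral>\<omega>. (D \<omega>)\<^sup>2 \<partial>M)"
  proof (rule Lim_transform_eventually[OF conv_second_moment])
    show "\<forall>\<^sub>F n in sequentially. measure_pmf.expectation (uniform_vertex n) (\<lambda>v. (real (d n v))\<^sup>2)
        = (\<Sum>i=1..n. (real (d n i))\<^sup>2) / n"
      using eventually_ge_at_top[of 1] by eventually_elim (rule expectation_uniform_vertex)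
  qed
  interpret regular_degrees d m \<nu>
  proof
    show "(\<lambda>n. (\<Sum>i=1..n. real (d n i) * (real (d n i) - 1)) / n) \<longlonglongrightarrow> \<nu> * m"
      using tendsto_diff[OF second mean] unfolding num DD
      by (simp add: power2_eq_square right_diff_distrib sum_subtractf diff_divide_distrib)
    show "\<exists>K\<ge>1. \<forall>\<^sub>F n in sequentially. c * (\<Sum>i=1..n. real (d n i))
        \<le> (\<Sum>v | v \<in> {1..n} \<and> d n v \<le> K. real (d n v) * (real (d n v) - 1))" if "c < \<nu>" for c
      by (rule truncated_forward_degree[OF deg_pos prob D_rv AE1 conv_distr mean D2_integrable])
        (use that mpos in \<open>simp_all flip: num\<close>)
  qed (use deg_pos even_total mean nu_gt_1 in auto)
  have lnnu: "ln \<nu> > 0" using nu_gt_1 by simp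
  obtain r c where c: "c > 0" and r: "\<forall>\<^sub>F n in sequentially. real (r n) \<le> (1 / ln \<nu> + \<epsilon>) * ln n"
    and far: "(\<lambda>n. avg n (\<lambda>P x y. (\<exists>j. walk_within P j x y) \<and> \<not> walk_within P (r n) x y)) \<longlonglongrightarrow> 0"
    and near: "\<forall>\<^sub>F n in sequentially. avg n (\<lambda>P. walk_within P (r n)) \<ge> c"
    by (rule typical_distance_upper[OF eps])
  \<comment> \<open>The maximum keeps the constant positive when \<open>\<epsilon>\<close> is large.\<close>
  define a where "a = max (1 / ln \<nu> - \<epsilon>) (1 / (2 * ln \<nu>))"
  have a: "a > 0" "a * ln \<nu> < 1"
    using lnnu eps by (auto simp: a_def max_def field_simps)
  define s where "s n = nat \<lceil>a * ln (real n)\<rceil>" for n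
  have short: "(\<lambda>n. avg n (\<lambda>P. walk_within P (s n))) \<longlonglongrightarrow> 0"
    unfolding s_def by (rule avg_short_walk_tendsto_0[OF a])
  let ?N = "\<lambda>n. pair_pmf (configuration_model n (d n)) (pair_pmf (uniform_vertex n) (uniform_vertex n))"
  let ?dev = "\<lambda>n G x y. \<bar>graph_dist G x y / ereal (ln (real n)) - ereal (1 / ln \<nu>)\<bar> > ereal \<epsilon>"
  let ?p = "\<lambda>n. \<P>((G, x, y) in ?N n. ?dev n G x y \<bar> graph_dist G x y < \<infinity>)"
  let ?e = "\<lambda>n. avg n (\<lambda>P. walk_within P (s n))
      + avg n (\<lambda>P x y. (\<exists>j. walk_within P j x y) \<and> \<not> walk_within P (r n) x y)"
  have upper: "\<forall>\<^sub>F n in sequentially. ?p n \<le> ?e n / c"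
    using r near eventually_ge_at_top[of 2]
  proof eventually_elim
    case (elim n)
    have n1: "n \<ge> 1" and lnn: "ln (real n) > 0" using elim by auto
    have avg_eq: "measure_pmf.prob (?N n) {(G, x, y). \<phi> G x y} = avg n (\<lambda>P. \<phi> (pairing_graph n P))" for \<phi>
      unfolding avg_def by (rule prob_configuration_model_uniform[OF n1 even_card_HE])
    have "measure_pmf.prob (?N n) {(G, x, y). ?dev n G x y \<and> graph_dist G x y < \<infinity>}
        \<le> avg n (\<lambda>P x y. walk_within P (s n) x y \<or>
            ((\<exists>j. walk_within P j x y) \<and> \<not> walk_within P (r n) x y))"
      unfolding avg_eq
    proof (rule avg_mono)
      fix P x y assume P: "P \<in> perfect_matchings (halves n)" and x: "x \<in> {1..n}"
        and dev: "?dev n (pairing_graph n P) x y \<and> graph_dist (pairing_graph n P) x y < \<infinity>"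
      have conn: "\<exists>j. walk_within P j x y" using dev graph_dist_finite_iff[OF P x] by blast
      have "graph_dist (pairing_graph n P) x y < \<infinity>" using dev by (rule conjunct2)
      then obtain g where g: "graph_dist (pairing_graph n P) x y = ereal g"
        using graph_dist_nonneg[OF P x, of y] by (cases "graph_dist (pairing_graph n P) x y") auto
      have "\<bar>g / ln n - 1 / ln \<nu>\<bar> > \<epsilon>" using dev lnn unfolding g by simp
      then consider "g / ln n > 1 / ln \<nu> + \<epsilon>" | "g / ln n < 1 / ln \<nu> - \<epsilon>" by linarith
      then show "walk_within P (s n) x y \<or> ((\<exists>j. walk_within P j x y) \<and> \<not> walk_within P (r n) x y)"
      proof cases
        case 1
        then have "g > (1 / ln \<nu> + \<epsilon>) * ln n" using lnn by (simp add: pos_less_divide_eq)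
        then have "\<not> graph_dist (pairing_graph n P) x y \<le> ereal (real (r n))"
          unfolding g using elim(1) by simp
        then show ?thesis using graph_dist_le_iff[OF P x] conn by blast
      next
        case 2
        then have "g < (1 / ln \<nu> - \<epsilon>) * ln n" using lnn by (simp add: pos_divide_less_eq)
        also have "\<dots> \<le> a * ln n" using lnn by (intro mult_right_mono) (auto simp: a_def)
        also have "\<dots> \<le> s n" unfolding s_def by linarith
        finally have "graph_dist (pairing_graph n P) x y \<le> ereal (real (s n))" unfolding g by simp
        then show ?thesis using graph_dist_le_iff[OF P x] by blast
      qed
    qed
    also have "\<dots> \<le> ?e n" by (rule avg_disj_le)
    finally have num_le: "measure_pmf.prob (?N n) {(G, x, y). ?dev n G x y \<and> graph_dist G x y < \<infinity>} \<le> ?e n" .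
    have "c \<le> avg n (\<lambda>P. walk_within P (r n))" by (rule elim(2))
    also have "\<dots> \<le> measure_pmf.prob (?N n) {(G, x, y). graph_dist G x y < \<infinity>}"
      unfolding avg_eq by (rule avg_mono) (use graph_dist_finite_iff in blast)
    finally have den_ge: "c \<le> measure_pmf.prob (?N n) {(G, x, y). graph_dist G x y < \<infinity>}" .
    have "?p n = measure_pmf.prob (?N n) {(G, x, y). ?dev n G x y \<and> graph_dist G x y < \<infinity>}
        / measure_pmf.prob (?N n) {(G, x, y). graph_dist G x y < \<infinity>}"
      unfolding cond_prob_def by (simp add: case_prod_unfold)
    also have "\<dots> \<le> ?e n / c"
      using num_le den_ge c by (intro frac_le) (auto intro: add_nonneg_nonneg avg_nonneg)
    finally show ?case .
  qed
  have "(\<lambda>n. ?e n / c) \<longlonglongrightarrow> (0 + 0) / c"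
    using c by (intro tendsto_intros short far) auto
  then have lim: "(\<lambda>n. ?e n / c) \<longlonglongrightarrow> 0" by simp
  have "?p n \<ge> 0" for n
    unfolding cond_prob_def by simp
  then have lower: "\<forall>\<^sub>F n in sequentially. 0 \<le> ?p n" by simp
  show "?p \<longlonglongrightarrow> 0"
    by (rule tendsto_sandwich[OF lower upper tendsto_const lim])
qed

end
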